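(* Let $P(x)=x(x+1)$. Then the limiting pair correlation function of the sequence $(\mathcal{F}_{Q,P})_Q$ exists, i.e. for every $\Lambda>0$, $\lim_{Q\to\infty}\mathcal{S}_{\mathcal{F}_{Q,P}}(\Lambda)=\int_0^\Lambda\mathfrak{g}_2(\lambda)\,d\lambda$, where \[\mathfrak{g}_2(\lambda)=\frac{1}{\zeta(2)\lambda^2}\sum_{d_2,d_4=1}^{\infty}\frac{\mu(d_2)\mu(d_4)}{d_2d_4\phi(d_2)\phi(d_4)}\sum_{1\leq m<\frac{2\lambda}{\beta_P}}\mathfrak{h}(m)\log\left(\frac{2\lambda}{m\beta_P}\right),\] with \[\mathfrak{h}(m)=\sum_{\substack{n,\delta, d_1,d_3\geq 1\\ n\delta d_1d_3=m\\ \gcd\left(\frac{d_2}{dG_1},\frac{d_4}{DG_2}\right)=1}}n\mu(d_1)\mu(d_3)\,dDG_1G_2\prod_{p\mid\frac{d_2d_4}{dDG_1G_2}}\left(1+\frac{1}{p}\right)^{-1},\] where $d=\gcd(d_1,d_2)$, $D=\gcd(d_3,d_4)$, $G_1=\gcd(\delta,d_2/d)$, $G_2=\gcd(\delta,d_4/D)$ (so $\mathfrak h$ also depends on $d_2,d_4$).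
   Context: $f_P(m)=\#\{1\le a\le m: P(a)\equiv0\pmod m\}$, $\beta_P=\prod_p(1-f_P(p)/p^2)$. $\mathcal{F}_{Q,P}=\{a/q: 1\leq a\leq q\leq Q,\ \gcd(P(a),q)=1\}$, $\mathcal{N}_{Q,P}=\#\mathcal{F}_{Q,P}$, and $\mathcal{S}_{\mathcal{F}_{Q,P}}(\Lambda)=\frac{1}{\mathcal{N}_{Q,P}}\#\{(\gamma_1,\gamma_2)\in\mathcal{F}_{Q,P}^2:\gamma_1\ne\gamma_2,\ \gamma_1-\gamma_2\in\frac{1}{\mathcal{N}_{Q,P}}(0,\Lambda)+\mathbb{Z}\}$. $\mu$ is the Möbius function, $\phi$ Euler's totient, $\zeta$ the Riemann zeta function. *)

theory Defs
  imports
    "HOL-Analysis.Analysis"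
    "HOL-Number_Theory.Number_Theory"
    "HOL-Computational_Algebra.Computational_Algebra"
begin

definition moebius :: "nat \<Rightarrow> int" where
  "moebius n = (if squarefree n then (-1) ^ card (prime_factors n) else 0)"

text \<open>Dirichlet series of the Riemann zeta function, meaningful for real \<open>s > 1\<close>.\<close>

definition zeta :: "real \<Rightarrow> real" where
  "zeta s = (\<Sum>n. 1 / real (Suc n) powr s)"

definition root_count :: "int poly \<Rightarrow> nat \<Rightarrow> nat" where
  "root_count P m = card {a::nat. 1 \<le> a \<and> a \<le> m \<and> [poly P (int a) = 0] (mod int m)}"

definition beta :: "int poly \<Rightarrow> real" where
  "beta P = (\<Prod>p. if prime p then 1 - real (root_count P p) / (real p)\<^sup>2 else 1)"

definition poly_farey :: "int poly \<Rightarrow> nat \<Rightarrow> real set" where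
  "poly_farey P Q =
     {real a / real q | a q::nat. 1 \<le> a \<and> a \<le> q \<and> q \<le> Q \<and> gcd (poly P (int a)) (int q) = 1}"

definition pair_correlation :: "real set \<Rightarrow> real \<Rightarrow> real" where
  "pair_correlation F \<Lambda> =
     1 / real (card F) *
     real (card {(\<gamma>1, \<gamma>2). \<gamma>1 \<in> F \<and> \<gamma>2 \<in> F \<and> \<gamma>1 \<noteq> \<gamma>2 \<and>
       (\<exists>x\<in>{0<..<\<Lambda>}. \<exists>k::int. \<gamma>1 - \<gamma>2 = 1 / real (card F) * x + of_int k)})"

text \<open>All uses of \<open>div\<close> below are exact divisions.\<close>

definition h_fun :: "nat \<Rightarrow> nat \<Rightarrow> nat \<Rightarrow> real" where
  "h_fun d2 d4 m =
     (\<Sum>(n, \<delta>, d1, d3) \<in> {(n, \<delta>, d1, d3).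
          n \<ge> 1 \<and> \<delta> \<ge> 1 \<and> d1 \<ge> 1 \<and> d3 \<ge> 1 \<and> n * \<delta> * d1 * d3 = m \<and>
          (let d = gcd d1 d2; D = gcd d3 d4;
               G1 = gcd \<delta> (d2 div d); G2 = gcd \<delta> (d4 div D)
           in gcd (d2 div (d * G1)) (d4 div (D * G2)) = 1)}.
        let d = gcd d1 d2; D = gcd d3 d4;
            G1 = gcd \<delta> (d2 div d); G2 = gcd \<delta> (d4 div D)
        in real n * of_int (moebius d1) * of_int (moebius d3) * real (d * D * G1 * G2) *
           (\<Prod>p \<in> prime_factors ((d2 * d4) div (d * D * G1 * G2)). inverse (1 + 1 / real p)))"

definition g2_term :: "int poly \<Rightarrow> real \<Rightarrow> nat \<Rightarrow> nat \<Rightarrow> real" where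
  "g2_term P t d2 d4 =
     of_int (moebius d2) * of_int (moebius d4) /
       (real d2 * real d4 * real (totient d2) * real (totient d4)) *
     (\<Sum>m | 1 \<le> m \<and> real m < 2 * t / beta P. h_fun d2 d4 m * ln (2 * t / (real m * beta P)))"

definition g2 :: "int poly \<Rightarrow> real \<Rightarrow> real" where
  "g2 P t = 1 / (zeta 2 * t\<^sup>2) * (\<Sum>\<^sub>\<infinity>(d2, d4) \<in> {1..} \<times> {1..}. g2_term P t d2 d4)"

end

theory Submission
  imports Defs
begin

text \<open>
  Two fractions \<open>a/q\<close>, \<open>b/y\<close> of the sequence at distance less than \<open>\<Lambda>/N\<close> modulo 1 have a
  determinant \<open>r = a y - b q\<close> that is positive and bounded independently of \<open>Q\<close>. Completing \<open>(b, y)\<close> to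
  a matrix of \<open>SL\<^sub>2(\<int>)\<close> with first row \<open>(c, x)\<close> gives \<open>(a, q) = r (c, x) + k (b, y)\<close> with a unique
  \<open>k\<close> modulo \<open>r\<close>, prime to \<open>r\<close>, and all coprimality conditions become
  \<open>gcd(x, y) = gcd(x - 1, y) = gcd(x - k, y + r) = 1\<close>. So the pairs are lattice points \<open>(x, y)\<close> in a
  region bounded by a hyperbola that avoid three points modulo every prime, and a sieve gives their
  density as a product of local factors \<open>1 - 3/p\<^sup>2\<close> (\<open>1 - 2/p\<^sup>2\<close> if \<open>p\<close> divides \<open>r\<close> and \<open>k - 1\<close>). The
  same sieve gives \<open>N \<sim> \<beta> Q\<^sup>2 / 2\<close>. Summing over \<open>k\<close> and comparing Euler factors identifies the
  density with the double series over \<open>d2\<close>, \<open>d4\<close>, and the area above the hyperbola is the integral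
  of the logarithmic kernel of \<open>g2\<close>.
\<close>


section \<open>Equidistribution of lattice points in residue classes\<close>

text \<open>The determinant \<open>r\<close> is the index \<open>m\<close> in \<open>g2\<close>: the
  gap condition reads \<open>r N < \<Lambda> q y\<close>, where \<open>q y \<le> Q^2\<close> and
  \<open>N\<close> is about \<open>\<beta> Q^2 / 2\<close>, so only
  \<open>r < 2 \<Lambda> / \<beta>\<close> contribute in the limit. Of the coprimality conditions,
  \<open>gcd(x, y) = 1\<close> makes \<open>(c, b)\<close> exist, \<open>gcd(k, r) = 1\<close> says
  that \<open>a\<close> is prime to \<open>q\<close>, \<open>gcd(x - 1, y) = 1\<close> that
  \<open>b + 1\<close> is prime to \<open>y\<close>, and \<open>gcd(x - k, y + r) = 1\<close> that
  \<open>a + 1\<close> is prime to \<open>q\<close>.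

  The obstacle is that the count yields one infinite product for each \<open>k\<close>, whereas
  \<open>g2\<close> is an infinite double sum with iterated gcds, so no term of one side matches a
  term of the other. The two are compared over a finite set of primes containing those of
  \<open>r\<close>: there the sum over \<open>k\<close> and the sum over squarefree
  \<open>d2\<close>, \<open>d4\<close> are both finite Euler products and agree prime by prime. Only
  then does the set of primes grow, and absolute convergence of the double series lets its sum be
  read off along that exhaustion.\<close>

lemma LIMSEQ_const_over_nat: "(\<lambda>n. c / real n) \<longlonglongrightarrow> 0"
  by (rule tendsto_divide_0[OF tendsto_const filterlim_at_top_imp_at_infinity[OF filterlim_real_sequentially]])

text \<open>Half-open intervals make the count an exact difference of two floors, whatever the
  endpoints; \<open>max 0\<close> covers \<open>U < L\<close>, where the set is empty.\<close>

lemma card_cong_interval_bound: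
  fixes L U :: real and M \<alpha> :: int
  assumes "M > 0"
  shows "finite {x::int. L < x \<and> x \<le> U \<and> [x = \<alpha>] (mod M)}"
    and "\<bar>real (card {x::int. L < x \<and> x \<le> U \<and> [x = \<alpha>] (mod M)}) - max 0 (U - L) / M\<bar> \<le> 1"
proof -
  define l u where "l = \<lfloor>(L - \<alpha>) / M\<rfloor>" and "u = \<lfloor>(U - \<alpha>) / M\<rfloor>"
  have M: "real_of_int M > 0" using assms by simp
  have lt: "L < \<alpha> + M * j \<longleftrightarrow> l < j" for j :: int
    unfolding l_def using M by (simp add: floor_less_iff field_simps)
  have le: "\<alpha> + M * j \<le> U \<longleftrightarrow> j \<le> u" for j :: int
    unfolding u_def using M by (simp add: le_floor_iff field_simps)
  have eq: "{x::int. L < x \<and> x \<le> U \<and> [x = \<alpha>] (mod M)} = (\<lambda>j. \<alpha> + M * j) ` {l<..u}"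
  proof (intro equalityI subsetI)
    fix x assume x: "x \<in> {x::int. L < x \<and> x \<le> U \<and> [x = \<alpha>] (mod M)}"
    then obtain j where j: "x = \<alpha> + M * j"
      by (metis (no_types, lifting) cong_iff_lin cong_sym mem_Collect_eq)
    have "l < j" "j \<le> u" using x lt[of j] le[of j] by (auto simp: j)
    then show "x \<in> (\<lambda>j. \<alpha> + M * j) ` {l<..u}" using j by auto
  qed (use lt le in \<open>auto simp: cong_def\<close>)
  show "finite {x::int. L < x \<and> x \<le> U \<and> [x = \<alpha>] (mod M)}" by (simp add: eq)
  have "inj_on (\<lambda>j. \<alpha> + M * j) {l<..u}" using assms by (auto simp: inj_on_def)
  then have card: "card {x::int. L < x \<and> x \<le> U \<and> [x = \<alpha>] (mod M)} = nat (u - l)"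
    by (simp add: eq card_image)
  have *: "(U - \<alpha>) / M - (L - \<alpha>) / M = (U - L) / M"
    by (simp add: diff_divide_distrib)
  have b: "\<bar>real_of_int (u - l) - (U - L) / M\<bar> \<le> 1"
    unfolding l_def u_def *[symmetric] by linarith
  show "\<bar>real (card {x::int. L < x \<and> x \<le> U \<and> [x = \<alpha>] (mod M)}) - max 0 (U - L) / M\<bar> \<le> 1"
  proof (cases "L \<le> U")
    case True
    then have "l \<le> u" unfolding l_def u_def using M by (intro floor_mono divide_right_mono) auto
    then show ?thesis using b True by (simp add: card max_def)
  next
    case False
    then have "u \<le> l" unfolding l_def u_def using M by (intro floor_mono divide_right_mono) auto
    then show ?thesis using False by (simp add: card max_def)
  qed
qed

text \<open>Abel summation: a nondecreasing \<open>f\<close> is a sum of nonnegative jumps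
  \<open>g j\<close>, and the jump at \<open>j\<close> is counted once for each \<open>y\<close> of
  the class in \<open>{j..n}\<close>. Each such interval contains its expected share of the class up
  to an error of 1, so the total error is at most the sum of the jumps, which telescopes to
  \<open>f n\<close>.\<close>

lemma sum_residue_class_mono_bound:
  fixes f :: "int \<Rightarrow> real" and n M \<beta> :: int
  assumes "M > 0" and "n \<ge> 1" and pos: "f 1 \<ge> 0"
    and mono: "\<And>y z. 1 \<le> y \<Longrightarrow> y \<le> z \<Longrightarrow> z \<le> n \<Longrightarrow> f y \<le> f z"
  shows "\<bar>(\<Sum>y | 1 \<le> y \<and> y \<le> n \<and> [y = \<beta>] (mod M). f y) - (\<Sum>y\<in>{1..n}. f y) / M\<bar> \<le> f n"
proof -
  \<comment> \<open>Extending \<open>f\<close> by 0 below 1 makes the first jump equal to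
    \<open>f 1\<close>, so that the jumps add up to \<open>f\<close> itself.\<close>
  define f0 where "f0 y = (if y < 1 then 0 else f y)" for y
  define g where "g j = f0 j - f0 (j - 1)" for j
  have g_nonneg: "g j \<ge> 0" if "1 \<le> j" "j \<le> n" for j
    using that pos mono[of "j - 1" j] by (cases "j = 1") (auto simp: g_def f0_def)
  have tele0: "(\<Sum>j\<in>{1..int k}. g j) = f0 (int k)" for k :: nat
  proof (induction k)
    case 0 then show ?case by (simp add: f0_def)
  next
    case (Suc k)
    have "{1..int (Suc k)} = insert (int (Suc k)) {1..int k}" by auto
    then show ?case using Suc by (simp add: g_def)
  qed
  have tele: "(\<Sum>j\<in>{1..y}. g j) = f y" if "1 \<le> y" for y
    using tele0[of "nat y"] that by (simp add: f0_def)
  have swap: "(\<Sum>y | 1 \<le> y \<and> y \<le> n \<and> P y. f y) = (\<Sum>j\<in>{1..n}. g j * card {y::int. real_of_int (j - 1) < y \<and> y \<le> real_of_int n \<and> P y})" for P :: "int \<Rightarrow> bool"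
  proof -
    have "(\<Sum>y | 1 \<le> y \<and> y \<le> n \<and> P y. f y) = (\<Sum>y\<in>{y\<in>{1..n}. P y}. \<Sum>j\<in>{j\<in>{1..n}. j \<le> y}. g j)"
    proof (intro sum.cong)
      fix y assume "y \<in> {y\<in>{1..n}. P y}"
      then have "{j\<in>{1..n}. j \<le> y} = {1..y}" "1 \<le> y" by auto
      then show "f y = (\<Sum>j\<in>{j\<in>{1..n}. j \<le> y}. g j)" using tele by simp
    qed auto
    also have "\<dots> = (\<Sum>j\<in>{1..n}. \<Sum>y\<in>{y\<in>{y\<in>{1..n}. P y}. j \<le> y}. g j)"
      by (rule sum.swap_restrict) (rule finite_subset[of _ "{1..n}"], auto)
    also have "\<dots> = (\<Sum>j\<in>{1..n}. g j * card {y::int. real_of_int (j - 1) < y \<and> y \<le> real_of_int n \<and> P y})"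
    proof (intro sum.cong refl)
      fix j assume "j \<in> {1..n}"
      then have "{y\<in>{y\<in>{1..n}. P y}. j \<le> y} = {y::int. real_of_int (j - 1) < y \<and> y \<le> real_of_int n \<and> P y}"
        by (auto simp del: of_int_diff)
      then show "(\<Sum>y\<in>{y\<in>{y\<in>{1..n}. P y}. j \<le> y}. g j) = g j * card {y::int. real_of_int (j - 1) < y \<and> y \<le> real_of_int n \<and> P y}"
        by simp
    qed
    finally show ?thesis .
  qed
  have all: "(\<Sum>y\<in>{1..n}. f y) = (\<Sum>j\<in>{1..n}. g j * (real_of_int n - real_of_int (j - 1)))"
  proof -
    have "(\<Sum>y\<in>{1..n}. f y) = (\<Sum>y | 1 \<le> y \<and> y \<le> n \<and> True. f y)" by (intro sum.cong) auto
    also have "\<dots> = (\<Sum>j\<in>{1..n}. g j * (real_of_int n - real_of_int (j - 1)))"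
      unfolding swap
    proof (intro sum.cong refl)
      fix j assume "j \<in> {1..n}"
      moreover have "{y::int. real_of_int (j - 1) < y \<and> y \<le> real_of_int n \<and> True} = {j..n}"
        by (auto simp del: of_int_diff)
      ultimately show "g j * card {y::int. real_of_int (j - 1) < y \<and> y \<le> real_of_int n \<and> True}
          = g j * (real_of_int n - real_of_int (j - 1))"
        by (simp only: card_atLeastAtMost_int) simp
    qed
    finally show ?thesis .
  qed
  have "\<bar>(\<Sum>y | 1 \<le> y \<and> y \<le> n \<and> [y = \<beta>] (mod M). f y) - (\<Sum>y\<in>{1..n}. f y) / M\<bar>
      = \<bar>\<Sum>j\<in>{1..n}. g j * (card {y::int. real_of_int (j - 1) < y \<and> y \<le> real_of_int n \<and> [y = \<beta>] (mod M)}
            - (real_of_int n - real_of_int (j - 1)) / M)\<bar>"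
    unfolding swap all sum_divide_distrib by (simp add: sum_subtractf right_diff_distrib)
  also have "\<dots> \<le> (\<Sum>j\<in>{1..n}. g j)"
  proof (rule order_trans[OF sum_abs sum_mono])
    fix j assume j: "j \<in> {1..n}"
    then have "max 0 (real_of_int n - real_of_int (j - 1)) = real_of_int n - real_of_int (j - 1)"
      by auto
    then have "\<bar>card {y::int. real_of_int (j - 1) < y \<and> y \<le> real_of_int n \<and> [y = \<beta>] (mod M)}
            - (real_of_int n - real_of_int (j - 1)) / M\<bar> \<le> 1"
      using card_cong_interval_bound(2)[OF assms(1), of "real_of_int (j - 1)" "real_of_int n" \<beta>] by simp
    with g_nonneg[of j] j show "\<bar>g j * (card {y::int. real_of_int (j - 1) < y \<and> y \<le> real_of_int n \<and> [y = \<beta>] (mod M)}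
            - (real_of_int n - real_of_int (j - 1)) / M)\<bar> \<le> g j"
      unfolding abs_mult using mult_left_le[of _ "g j"] by simp
  qed
  also have "\<dots> = f n" using assms(2) by (rule tele)
  finally show ?thesis .
qed

text \<open>Two errors of order \<open>Q\<close> are negligible against \<open>Q^2\<close>: at most
  1 for each of at most \<open>Q\<close> fibres when \<open>x\<close> is counted in its class, and
  at most the longest fibre when the sum of the lengths is restricted to the class of
  \<open>y\<close>. The latter is where monotonicity of the lengths enters.\<close>

lemma fibred_region_equidistributed:
  fixes L U :: "nat \<Rightarrow> int \<Rightarrow> real" and A C :: real and M \<alpha> \<beta> :: int
  defines "f \<equiv> \<lambda>Q y. max 0 (U Q y - L Q y)"
  assumes mono: "\<And>Q y z. 1 \<le> y \<Longrightarrow> y \<le> z \<Longrightarrow> z \<le> int Q \<Longrightarrow> f Q y \<le> f Q z"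
    and bound: "\<And>Q. f Q (int Q) \<le> C * Q"
    and lim: "(\<lambda>Q. (\<Sum>y\<in>{1..int Q}. f Q y) / (real Q)\<^sup>2) \<longlonglongrightarrow> A"
    and M: "M > 0"
  shows "(\<lambda>Q. real (card {(x, y). (1 \<le> y \<and> y \<le> int Q \<and> L Q y < x \<and> x \<le> U Q y) \<and>
            [x = \<alpha>] (mod M) \<and> [y = \<beta>] (mod M)}) / (real Q)\<^sup>2) \<longlonglongrightarrow> A / (real_of_int M)\<^sup>2"
proof -
  let ?c = "\<lambda>Q. real (card {(x, y). (1 \<le> y \<and> y \<le> int Q \<and> L Q y < x \<and> x \<le> U Q y) \<and>
            [x = \<alpha>] (mod M) \<and> [y = \<beta>] (mod M)})"
  let ?s = "\<lambda>Q. (\<Sum>y\<in>{1..int Q}. f Q y)"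
  have M1: "real_of_int M \<ge> 1" using M by simp
  have key: "\<bar>?c Q - ?s Q / (real_of_int M)\<^sup>2\<bar> \<le> (1 + \<bar>C\<bar>) * Q" if "Q \<ge> 1" for Q
  proof -
    define Y where "Y = {y. 1 \<le> y \<and> y \<le> int Q \<and> [y = \<beta>] (mod M)}"
    define X where "X y = {x::int. L Q y < x \<and> x \<le> U Q y \<and> [x = \<alpha>] (mod M)}" for y
    have Y_sub: "Y \<subseteq> {1..int Q}" by (auto simp: Y_def)
    then have finY: "finite Y" by (rule finite_subset) simp
    have finX: "finite (X y)" for y unfolding X_def by (rule card_cong_interval_bound(1)[OF M])
    have "{(x, y). (1 \<le> y \<and> y \<le> int Q \<and> L Q y < x \<and> x \<le> U Q y) \<and> [x = \<alpha>] (mod M) \<and> [y = \<beta>] (mod M)}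
        = prod.swap ` (SIGMA y:Y. X y)"
      by (auto simp: Y_def X_def image_iff)
    then have c: "?c Q = (\<Sum>y\<in>Y. real (card (X y)))"
      using finX finY by (simp add: card_image)
    have "\<bar>?c Q - (\<Sum>y\<in>Y. f Q y) / M\<bar> \<le> (\<Sum>y\<in>Y. \<bar>real (card (X y)) - f Q y / M\<bar>)"
      unfolding c sum_divide_distrib sum_subtractf[symmetric] by (rule sum_abs)
    also have "\<dots> \<le> (\<Sum>y\<in>Y. 1)"
      unfolding X_def f_def by (intro sum_mono card_cong_interval_bound(2)[OF M])
    also have "\<dots> \<le> real Q"
      using card_mono[of "{1..int Q}" Y] Y_sub by simp
    finally have 1: "\<bar>?c Q - (\<Sum>y\<in>Y. f Q y) / M\<bar> \<le> real Q" .
    have "\<bar>(\<Sum>y\<in>Y. f Q y) - ?s Q / M\<bar> \<le> f Q (int Q)"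
      unfolding Y_def using that by (intro sum_residue_class_mono_bound M mono) (auto simp: f_def)
    also have "\<dots> \<le> \<bar>C\<bar> * Q"
      using bound[of Q] by (smt (verit) mult_right_mono of_nat_0_le_iff)
    finally have "\<bar>(\<Sum>y\<in>Y. f Q y) - ?s Q / M\<bar> / M \<le> \<bar>C\<bar> * Q / 1"
      using M1 by (intro frac_le) auto
    also have "\<bar>(\<Sum>y\<in>Y. f Q y) - ?s Q / M\<bar> / M = \<bar>(\<Sum>y\<in>Y. f Q y) / M - ?s Q / (real_of_int M)\<^sup>2\<bar>"
    proof -
      have "(\<Sum>y\<in>Y. f Q y) / M - ?s Q / (real_of_int M)\<^sup>2 = ((\<Sum>y\<in>Y. f Q y) - ?s Q / M) / M"
        by (simp add: diff_divide_distrib power2_eq_square)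
      then show ?thesis using M1 by (simp add: abs_divide)
    qed
    finally show ?thesis using 1 by (simp add: algebra_simps)
  qed
  have "(\<lambda>Q. ?c Q / (real Q)\<^sup>2 - ?s Q / (real Q)\<^sup>2 / (real_of_int M)\<^sup>2) \<longlonglongrightarrow> 0"
  proof (rule Lim_null_comparison)
    show "\<forall>\<^sub>F Q in sequentially. norm (?c Q / (real Q)\<^sup>2 - ?s Q / (real Q)\<^sup>2 / (real_of_int M)\<^sup>2) \<le> (1 + \<bar>C\<bar>) / Q"
      using eventually_ge_at_top[of 1]
    proof eventually_elim
      case (elim Q)
      have "?c Q / (real Q)\<^sup>2 - ?s Q / (real Q)\<^sup>2 / (real_of_int M)\<^sup>2
        = (?c Q - ?s Q / (real_of_int M)\<^sup>2) / (real Q)\<^sup>2"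
        by (simp add: diff_divide_distrib mult.commute)
      then have "norm (?c Q / (real Q)\<^sup>2 - ?s Q / (real Q)\<^sup>2 / (real_of_int M)\<^sup>2)
        = \<bar>?c Q - ?s Q / (real_of_int M)\<^sup>2\<bar> / (real Q)\<^sup>2"
        by (simp only: real_norm_def abs_divide abs_power2)
      also have "\<dots> \<le> (1 + \<bar>C\<bar>) * Q / (real Q)\<^sup>2" by (intro divide_right_mono key elim) auto
      finally show ?case using elim by (simp add: power2_eq_square)
    qed
    show "(\<lambda>Q. (1 + \<bar>C\<bar>) / real Q) \<longlonglongrightarrow> 0"
      by (rule LIMSEQ_const_over_nat)
  qed
  from tendsto_add[OF this tendsto_divide[OF lim tendsto_const, of "(real_of_int M)\<^sup>2"]] M
  show ?thesis by simp
qed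

section \<open>A lattice point sieve\<close>

text \<open>Points of \<open>B\<close> that coincide modulo \<open>p\<close> count once; this is how
  the local density comes to depend on \<open>r\<close> and \<open>k\<close>.\<close>

definition residue_count :: "(int \<times> int) set \<Rightarrow> nat \<Rightarrow> nat" where
  "residue_count B p = card ((\<lambda>(a, b). (a mod int p, b mod int p)) ` B)"

lemma residue_count_le: "finite B \<Longrightarrow> residue_count B p \<le> card B"
  unfolding residue_count_def by (rule card_image_le)

lemma chinese_residue_class:
  fixes M N u v :: int
  assumes cop: "coprime M N"
  shows "\<exists>w. \<forall>x. [x = w] (mod (M * N)) \<longleftrightarrow> [x = u] (mod M) \<and> [x = v] (mod N)"
proof -
  obtain w where w: "[w = u] (mod M)" "[w = v] (mod N)"
    using binary_chinese_remainder_int[OF cop, of u v] by auto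
  have "[x = w] (mod (M * N)) \<longleftrightarrow> [x = u] (mod M) \<and> [x = v] (mod N)" for x
  proof
    assume "[x = w] (mod (M * N))"
    then have "[x = w] (mod M)" "[x = w] (mod N)"
      using cong_dvd_modulus[of x w "M * N"] by auto
    then show "[x = u] (mod M) \<and> [x = v] (mod N)" using w by (auto intro: cong_trans)
  next
    assume "[x = u] (mod M) \<and> [x = v] (mod N)"
    then have "[x = w] (mod M)" "[x = w] (mod N)"
      using w by (auto intro: cong_trans cong_sym)
    then show "[x = w] (mod (M * N))" by (rule coprime_cong_mult[OF _ _ cop])
  qed
  then show ?thesis by blast
qed

lemma card_Diff_disjoint_Union:
  assumes "finite X" "finite I" "\<And>i. i \<in> I \<Longrightarrow> Y i \<subseteq> X"
    and "\<And>i j. i \<in> I \<Longrightarrow> j \<in> I \<Longrightarrow> i \<noteq> j \<Longrightarrow> Y i \<inter> Y j = {}"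
  shows "real (card (X - (\<Union>i\<in>I. Y i))) = real (card X) - (\<Sum>i\<in>I. real (card (Y i)))"
proof -
  have sub: "(\<Union>i\<in>I. Y i) \<subseteq> X" using assms(3) by blast
  have "card (\<Union>i\<in>I. Y i) = (\<Sum>i\<in>I. card (Y i))"
    using assms by (intro card_UN_disjoint) (auto intro: finite_subset)
  then show ?thesis
    using card_Diff_subset[OF finite_subset[OF sub assms(1)] sub] card_mono[OF assms(1) sub]
    by (simp add: of_nat_diff)
qed

text \<open>By the Chinese remainder theorem, forbidding the classes of \<open>B\<close> modulo one
  more prime \<open>p\<close> removes disjoint pieces of the same kind with modulus
  \<open>M * p\<close>, each of relative density \<open>1 / p^2\<close>. The congruence class modulo
  \<open>M\<close> in the statement is what the induction over the primes runs on.\<close>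

lemma sieve_finitely_many_primes:
  fixes S :: "nat \<Rightarrow> (int \<times> int) set" and A :: real
  assumes fin: "\<And>Q. finite (S Q)" and B: "finite B"
    and equi: "\<And>M \<alpha> \<beta>. M > 0 \<Longrightarrow>
      (\<lambda>Q. real (card {(x, y). (x, y) \<in> S Q \<and> [x = \<alpha>] (mod M) \<and> [y = \<beta>] (mod M)}) / (real Q)\<^sup>2)
        \<longlonglongrightarrow> A / (real_of_int M)\<^sup>2"
    and "finite T" and "\<And>p. p \<in> T \<Longrightarrow> prime p"
    and "M > 0" and "\<And>p. p \<in> T \<Longrightarrow> coprime M (int p)"
  shows "(\<lambda>Q. real (card {(x, y). (x, y) \<in> S Q \<and> [x = \<alpha>] (mod M) \<and> [y = \<beta>] (mod M) \<and>
            (\<forall>p\<in>T. \<forall>(a, b)\<in>B. \<not> (int p dvd x - a \<and> int p dvd y - b))}) / (real Q)\<^sup>2)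
         \<longlonglongrightarrow> A / (real_of_int M)\<^sup>2 * (\<Prod>p\<in>T. 1 - residue_count B p / (real p)\<^sup>2)"
  using assms(4-)
proof (induction T arbitrary: M \<alpha> \<beta> rule: finite_induct)
  case empty
  then show ?case using equi by simp
next
  case (insert p T)
  let ?ok = "\<lambda>x y. \<forall>p\<in>T. \<forall>(a, b)\<in>B. \<not> (int p dvd x - a \<and> int p dvd y - b)"
  let ?X = "\<lambda>M \<alpha> \<beta> Q. {(x, y). (x, y) \<in> S Q \<and> [x = \<alpha>] (mod M) \<and> [y = \<beta>] (mod M) \<and> ?ok x y}"
  let ?\<Pi> = "\<Prod>p\<in>T. 1 - residue_count B p / (real p)\<^sup>2"
  \<comment> \<open>Reduced representatives, so that distinct elements of \<open>Bp\<close> are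
    distinct classes and the removed pieces are disjoint.\<close>
  define Bp where "Bp = (\<lambda>(a, b). (a mod int p, b mod int p)) ` B"
  have p: "prime p" "int p > 0" "coprime M (int p)"
    using insert.prems by (auto simp: prime_gt_0_nat)
  have cop: "coprime (M * int p) (int q)" if "q \<in> T" for q
    using that insert.prems insert.hyps(2) primes_coprime[of p q] by auto
  have "\<exists>w. \<forall>x. [x = w] (mod (M * int p)) \<longleftrightarrow> [x = u] (mod M) \<and> [x = v] (mod int p)" for u v
    by (rule chinese_residue_class[OF p(3)])
  then obtain w where w: "\<And>u v x. [x = w u v] (mod (M * int p)) \<longleftrightarrow> [x = u] (mod M) \<and> [x = v] (mod int p)"
    by metis
  have bad: "(\<exists>(a, b)\<in>B. int p dvd x - a \<and> int p dvd y - b) \<longleftrightarrow> (\<exists>(a, b)\<in>Bp. [x = a] (mod int p) \<and> [y = b] (mod int p))" for x y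
    unfolding Bp_def by (auto simp: cong_iff_dvd_diff[symmetric] cong_def split: prod.splits)
  have finX: "finite (?X M \<alpha> \<beta> Q)" for M \<alpha> \<beta> Q
    by (rule finite_subset[OF _ fin[of Q]]) auto
  have eq: "real (card {(x, y). (x, y) \<in> S Q \<and> [x = \<alpha>] (mod M) \<and> [y = \<beta>] (mod M) \<and>
            (\<forall>p\<in>insert p T. \<forall>(a, b)\<in>B. \<not> (int p dvd x - a \<and> int p dvd y - b))})
      = real (card (?X M \<alpha> \<beta> Q)) - (\<Sum>c\<in>Bp. real (card (?X (M * int p) (w \<alpha> (fst c)) (w \<beta> (snd c)) Q)))" for Q
  proof -
    let ?Y = "\<lambda>c. ?X (M * int p) (w \<alpha> (fst c)) (w \<beta> (snd c)) Q"
    have "{(x, y). (x, y) \<in> S Q \<and> [x = \<alpha>] (mod M) \<and> [y = \<beta>] (mod M) \<and>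
            (\<forall>p\<in>insert p T. \<forall>(a, b)\<in>B. \<not> (int p dvd x - a \<and> int p dvd y - b))}
          = ?X M \<alpha> \<beta> Q - (\<Union>c\<in>Bp. ?Y c)"
      using bad by (fastforce simp: w)
    moreover have "real (card (?X M \<alpha> \<beta> Q - (\<Union>c\<in>Bp. ?Y c))) = real (card (?X M \<alpha> \<beta> Q)) - (\<Sum>c\<in>Bp. real (card (?Y c)))"
    proof (rule card_Diff_disjoint_Union)
      show "finite (?X M \<alpha> \<beta> Q)" by (rule finX)
      show "finite Bp" using B by (simp add: Bp_def)
      show "?Y c \<subseteq> ?X M \<alpha> \<beta> Q" for c by (auto simp: w)
      show "?Y i \<inter> ?Y j = {}" if "i \<in> Bp" "j \<in> Bp" "i \<noteq> j" for i j
        using that by (auto simp: w Bp_def; metis cong_def mod_mod_trivial)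
    qed
    ultimately show ?thesis by (simp only:)
  qed
  have "(\<lambda>Q. real (card (?X M \<alpha> \<beta> Q)) / (real Q)\<^sup>2 - (\<Sum>c\<in>Bp. real (card (?X (M * int p) (w \<alpha> (fst c)) (w \<beta> (snd c)) Q)) / (real Q)\<^sup>2))
     \<longlonglongrightarrow> A / (real_of_int M)\<^sup>2 * ?\<Pi> - (\<Sum>c\<in>Bp. A / (real_of_int (M * int p))\<^sup>2 * ?\<Pi>)"
    using insert.prems p cop by (intro tendsto_diff tendsto_sum insert.IH) auto
  also have "A / (real_of_int M)\<^sup>2 * ?\<Pi> - (\<Sum>c\<in>Bp. A / (real_of_int (M * int p))\<^sup>2 * ?\<Pi>)
     = A / (real_of_int M)\<^sup>2 * (\<Prod>p\<in>insert p T. 1 - residue_count B p / (real p)\<^sup>2)"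
    using insert.hyps by (simp add: residue_count_def Bp_def power_mult_distrib algebra_simps)
  finally show ?case by (simp only: eq diff_divide_distrib sum_divide_distrib)
qed

lemma sum_inverse_squares_tail: 
  assumes "z \<ge> 1" shows "(\<Sum>n\<in>{z<..N}. 1 / (real n)\<^sup>2) \<le> 1 / real z"
proof -
  have "(\<Sum>n\<in>{z<..N}. 1 / (real n)\<^sup>2) \<le> 1 / real z - 1 / real N" if "z \<le> N"
    using that
  proof (induction N rule: dec_induct)
    case (step n)
    have "{z<..Suc n} = insert (Suc n) {z<..n}" using step by auto
    moreover have "1 / (real (Suc n))\<^sup>2 \<le> 1 / real n - 1 / real (Suc n)"
    proof -
      have "1 / real n - 1 / real (Suc n) = 1 / (real n * real (Suc n))"
        using step assms by (simp add: field_simps)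
      then show ?thesis using step assms by (auto simp: power2_eq_square intro!: frac_le mult_right_mono)
    qed
    ultimately show ?case using step by simp
  qed simp
  then show ?thesis by (cases "z \<le> N") (force intro: order_trans)+
qed

text \<open>If \<open>e\<close> and \<open>f\<close> are nonzero, a common divisor
  \<open>p > z\<close> is at most \<open>X\<close>, and it divides at most
  \<open>(2 X / p)^2\<close> such pairs; summing over all integers \<open>p > z\<close> costs
  \<open>4 X^2 / z\<close>. Zero is divisible by every \<open>p\<close>, so the two axes are counted
  apart and give \<open>2 (2 X + 1)\<close>.\<close>

lemma card_large_common_prime_factor:
  fixes X z :: nat
  assumes "z \<ge> 1"
  shows "finite {(e, f). \<bar>e\<bar> \<le> int X \<and> \<bar>f\<bar> \<le> int X \<and> (\<exists>p>z. int p dvd e \<and> int p dvd f)}" (is "finite ?S")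
    and "real (card {(e, f). \<bar>e\<bar> \<le> int X \<and> \<bar>f\<bar> \<le> int X \<and> (\<exists>p>z. int p dvd e \<and> int p dvd f)})
      \<le> 2 * (2 * real X + 1) + 4 * (real X)\<^sup>2 / z"
proof -
  let ?I = "{- int X..int X}"
  define D where "D n = {e. e \<noteq> 0 \<and> \<bar>e\<bar> \<le> int X \<and> int n dvd e}" for n :: nat
  have D: "finite (D n)" "real (card (D n)) \<le> 2 * real X / real n" if "n \<ge> 1" for n
  proof -
    let ?K = "{- int (X div n)..-1} \<union> {1..int (X div n)}"
    have "D n \<subseteq> (\<lambda>j. int n * j) ` ?K"
    proof
      fix e assume "e \<in> D n"
      then obtain j where j: "e = int n * j" "j \<noteq> 0" "\<bar>int n * j\<bar> \<le> int X" by (auto simp: D_def)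
      then have "int n * \<bar>j\<bar> \<le> int X" by (simp add: abs_mult)
      then have "n * nat \<bar>j\<bar> \<le> X" by (metis abs_ge_zero int_nat_eq of_nat_le_iff of_nat_mult)
      then have "nat \<bar>j\<bar> \<le> X div n" using that by (simp add: less_eq_div_iff_mult_less_eq mult.commute)
      then have "\<bar>j\<bar> \<le> int (X div n)" by linarith
      then have "j \<in> ?K" using j(2) by (auto simp del: of_nat_div)
      then show "e \<in> (\<lambda>j. int n * j) ` ?K" using j by blast
    qed
    moreover have "card ?K = 2 * (X div n)" by (subst card_Un_disjoint) auto
    ultimately have "card (D n) \<le> 2 * (X div n)" "finite (D n)"
      using card_image_le[of ?K "\<lambda>j. int n * j"] card_mono[of "(\<lambda>j. int n * j) ` ?K" "D n"]
      by (auto simp: finite_subset)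
    moreover have "real (X div n) \<le> real X / real n" by (simp add: of_nat_div_le_of_nat)
    ultimately show "finite (D n)" "real (card (D n)) \<le> 2 * real X / real n" by linarith+
  qed
  let ?V = "{0::int} \<times> ?I \<union> ?I \<times> {0::int} \<union> (\<Union>n\<in>{z<..X}. D n \<times> D n)"
  have sub: "?S \<subseteq> ?V"
  proof
    fix v assume "v \<in> ?S"
    then obtain e f p where v: "v = (e, f)" "\<bar>e\<bar> \<le> int X" "\<bar>f\<bar> \<le> int X" "p > z" "int p dvd e" "int p dvd f"
      by auto
    have "p \<le> X" if "e \<noteq> 0" using v(2) dvd_imp_le_int[OF that v(5)] by simp
    then show "v \<in> ?V" using v by (cases "e = 0 \<or> f = 0") (auto simp: D_def)
  qed
  have finV: "finite ?V" using D(1) assms by auto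
  from finite_subset[OF sub this] show "finite ?S" .
  have "card ?S \<le> card ?V" by (rule card_mono[OF finV sub])
  also have "\<dots> \<le> card ({0::int} \<times> ?I) + card (?I \<times> {0::int}) + card (\<Union>n\<in>{z<..X}. D n \<times> D n)"
    using card_Un_le[of "{0::int} \<times> ?I \<union> ?I \<times> {0::int}" "\<Union>n\<in>{z<..X}. D n \<times> D n"] card_Un_le[of "{0::int} \<times> ?I" "?I \<times> {0::int}"]
    by linarith
  also have "\<dots> \<le> (2 * X + 1) + (2 * X + 1) + (\<Sum>n\<in>{z<..X}. card (D n \<times> D n))"
    by (intro add_mono card_UN_le) (auto simp: card_cartesian_product)
  finally have "real (card ?S) \<le> real ((2 * X + 1) + (2 * X + 1) + (\<Sum>n\<in>{z<..X}. card (D n \<times> D n)))"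
    by (rule of_nat_mono)
  also have "real ((2 * X + 1) + (2 * X + 1) + (\<Sum>n\<in>{z<..X}. card (D n \<times> D n)))
     = 2 * (2 * real X + 1) + (\<Sum>n\<in>{z<..X}. real (card (D n)) * real (card (D n)))"
    by (simp add: card_cartesian_product)
  also have "(\<Sum>n\<in>{z<..X}. real (card (D n)) * real (card (D n))) \<le> (\<Sum>n\<in>{z<..X}. (2 * real X / real n) * (2 * real X / real n))"
    using assms by (intro sum_mono mult_mono D(2)) auto
  also have "\<dots> = 4 * (real X)\<^sup>2 * (\<Sum>n\<in>{z<..X}. 1 / (real n)\<^sup>2)"
    by (simp add: sum_distrib_left power2_eq_square)
  also have "\<dots> \<le> 4 * (real X)\<^sup>2 * (1 / real z)"
    by (intro mult_left_mono sum_inverse_squares_tail assms) auto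
  finally show "real (card ?S) \<le> 2 * (2 * real X + 1) + 4 * (real X)\<^sup>2 / z" by simp
qed

text \<open>The two limits may be interchanged because \<open>z\<close> can be fixed before
  \<open>n\<close>: the part of the error that depends on \<open>z\<close> is uniform in
  \<open>n\<close>.\<close>

lemma LIMSEQ_of_uniform_approximation:
  fixes f :: "nat \<Rightarrow> real" and g :: "nat \<Rightarrow> nat \<Rightarrow> real"
  assumes g: "\<And>z. g z \<longlonglongrightarrow> l z" and l: "l \<longlonglongrightarrow> L"
    and bound: "\<And>z n. z \<ge> 1 \<Longrightarrow> n \<ge> 1 \<Longrightarrow> \<bar>f n - g z n\<bar> \<le> K / real z + K / real n"
  shows "f \<longlonglongrightarrow> L"
proof (rule LIMSEQ_I)
  fix e :: real assume "e > 0"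
  have K: "(\<lambda>n. K / real n) \<longlonglongrightarrow> 0"
    by (rule LIMSEQ_const_over_nat)
  have e4: "e / 4 > 0" using \<open>e > 0\<close> by simp
  have "\<forall>\<^sub>F z in sequentially. dist (K / real z) 0 < e / 4 \<and> dist (l z) L < e / 4 \<and> z \<ge> 1"
    using tendstoD[OF K e4] tendstoD[OF l e4] eventually_ge_at_top by (intro eventually_conj)
  then obtain z where z: "dist (K / real z) 0 < e / 4" "dist (l z) L < e / 4" "z \<ge> 1"
    using eventually_happens'[OF sequentially_bot] by blast
  have "\<forall>\<^sub>F n in sequentially. norm (f n - L) < e"
    using tendstoD[OF K e4] tendstoD[OF g[of z] e4] eventually_ge_at_top[of 1]
  proof eventually_elim
    case (elim n)
    then show ?case using bound[of z n] z unfolding dist_real_def real_norm_def by linarith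
  qed
  then show "\<exists>no. \<forall>n\<ge>no. norm (f n - L) < e" by (simp add: eventually_sequentially)
qed

text \<open>The primes up to \<open>z\<close> are sieved exactly. A point that survives them but
  fails some coprimality condition has, after a shift by a point of \<open>B\<close>, coordinates
  with a common prime factor beyond \<open>z\<close>. There are \<open>O(Q + Q^2 / z)\<close> such
  points, uniformly in \<open>Q\<close>.\<close>

lemma sieve_lattice_points:
  fixes S :: "nat \<Rightarrow> (int \<times> int) set" and A :: real and C :: nat
  assumes box: "\<And>Q x y. (x, y) \<in> S Q \<Longrightarrow> \<bar>x\<bar> \<le> int (C * Q) \<and> \<bar>y\<bar> \<le> int (C * Q)" and B: "finite B"
    and equi: "\<And>M \<alpha> \<beta>. M > 0 \<Longrightarrow>
      (\<lambda>Q. real (card {(x, y). (x, y) \<in> S Q \<and> [x = \<alpha>] (mod M) \<and> [y = \<beta>] (mod M)}) / (real Q)\<^sup>2)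
        \<longlonglongrightarrow> A / (real_of_int M)\<^sup>2"
    and prod: "(\<lambda>z. \<Prod>p | prime p \<and> p \<le> z. 1 - residue_count B p / (real p)\<^sup>2) \<longlonglongrightarrow> \<sigma>"
  shows "(\<lambda>Q. real (card {(x, y). (x, y) \<in> S Q \<and> (\<forall>(a, b)\<in>B. coprime (x - a) (y - b))}) / (real Q)\<^sup>2) \<longlonglongrightarrow> A * \<sigma>"
proof -
  have fin: "finite (S Q)" for Q
  proof (rule finite_subset)
    show "S Q \<subseteq> {- int (C * Q)..int (C * Q)} \<times> {- int (C * Q)..int (C * Q)}"
    proof
      fix v assume "v \<in> S Q"
      then show "v \<in> {- int (C * Q)..int (C * Q)} \<times> {- int (C * Q)..int (C * Q)}"
        using box[of "fst v" "snd v" Q] by (cases v) (auto simp: abs_le_iff)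
    qed
  qed auto
  define c where "c Q = real (card {(x, y). (x, y) \<in> S Q \<and> (\<forall>(a, b)\<in>B. coprime (x - a) (y - b))})" for Q
  define G where "G z Q = {(x, y). (x, y) \<in> S Q \<and>
            (\<forall>p\<in>{p. prime p \<and> p \<le> z}. \<forall>(a, b)\<in>B. \<not> (int p dvd x - a \<and> int p dvd y - b))}" for z Q
  \<comment> \<open>\<open>K\<close> bounds the shifts, so that for \<open>Q \<ge> 1\<close> the
    shifted points lie in the box of half-width \<open>(C + K) * Q\<close>.\<close>
  obtain K :: nat where K: "\<And>a b. (a, b) \<in> B \<Longrightarrow> \<bar>a\<bar> \<le> int K \<and> \<bar>b\<bar> \<le> int K"
  proof
    fix a b assume ab: "(a, b) \<in> B"
    have "nat (\<bar>fst (a, b)\<bar> + \<bar>snd (a, b)\<bar>) \<le> (\<Sum>v\<in>B. nat (\<bar>fst v\<bar> + \<bar>snd v\<bar>))"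
      by (rule member_le_sum[OF ab _ B]) auto
    then show "\<bar>a\<bar> \<le> int (\<Sum>v\<in>B. nat (\<bar>fst v\<bar> + \<bar>snd v\<bar>)) \<and> \<bar>b\<bar> \<le> int (\<Sum>v\<in>B. nat (\<bar>fst v\<bar> + \<bar>snd v\<bar>))"
      unfolding fst_conv snd_conv by linarith
  qed
  define D where "D = C + K"
  define E where "E = real (card B) * (4 * real D + 2 + 4 * (real D)\<^sup>2)"
  show ?thesis unfolding c_def[symmetric]
  proof (rule LIMSEQ_of_uniform_approximation)
    show "(\<lambda>Q. real (card (G z Q)) / (real Q)\<^sup>2) \<longlonglongrightarrow> A * (\<Prod>p | prime p \<and> p \<le> z. 1 - residue_count B p / (real p)\<^sup>2)" for z
    proof -
      have "(\<lambda>Q. real (card {(x, y). (x, y) \<in> S Q \<and> [x = 0] (mod 1) \<and> [y = 0] (mod 1) \<and>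
            (\<forall>p\<in>{p. prime p \<and> p \<le> z}. \<forall>(a, b)\<in>B. \<not> (int p dvd x - a \<and> int p dvd y - b))}) / (real Q)\<^sup>2)
         \<longlonglongrightarrow> A / (real_of_int 1)\<^sup>2 * (\<Prod>p\<in>{p. prime p \<and> p \<le> z}. 1 - residue_count B p / (real p)\<^sup>2)"
      proof (rule sieve_finitely_many_primes)
        show "finite (S Q)" for Q by (rule fin)
        show "(\<lambda>Q. real (card {(x, y). (x, y) \<in> S Q \<and> [x = \<alpha>] (mod M) \<and> [y = \<beta>] (mod M)}) / (real Q)\<^sup>2)
          \<longlonglongrightarrow> A / (real_of_int M)\<^sup>2" if "M > 0" for M \<alpha> \<beta> using that by (rule equi)
      qed (use B in auto)
      moreover have "[u = 0] (mod 1)" for u :: int by (simp add: cong_def)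
      ultimately show ?thesis by (simp only: G_def simp_thms of_int_1 power_one div_by_1)
    qed
    show "(\<lambda>z. A * (\<Prod>p | prime p \<and> p \<le> z. 1 - residue_count B p / (real p)\<^sup>2)) \<longlonglongrightarrow> A * \<sigma>"
      by (intro tendsto_intros prod)
    fix z Q :: nat assume z: "z \<ge> 1" and Q: "Q \<ge> 1"
    let ?c = "{(x, y). (x, y) \<in> S Q \<and> (\<forall>(a, b)\<in>B. coprime (x - a) (y - b))}"
    let ?X = "D * Q"
    let ?V = "{(e, f). \<bar>e\<bar> \<le> int ?X \<and> \<bar>f\<bar> \<le> int ?X \<and> (\<exists>p>z. int p dvd e \<and> int p dvd f)}"
    have finG: "finite (G z Q)" by (rule finite_subset[OF _ fin[of Q]]) (auto simp: G_def)
    have sub1: "?c \<subseteq> G z Q"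
    proof (clarsimp simp: G_def, goal_cases)
      case (1 x y p a b)
      then have "coprime (x - a) (y - b)" by auto
      then have "int p dvd 1" using 1 by (meson coprime_common_divisor)
      then show False using \<open>prime p\<close> by auto
    qed
    have sub2: "G z Q - ?c \<subseteq> (\<Union>v\<in>B. (\<lambda>(e, f). (e + fst v, f + snd v)) ` ?V)"
    proof
      fix v assume v: "v \<in> G z Q - ?c"
      obtain x y where xy: "v = (x, y)" by (cases v)
      with v have S: "(x, y) \<in> S Q" by (auto simp: G_def)
      from v xy obtain a b where ab: "(a, b) \<in> B" "\<not> coprime (x - a) (y - b)"
        by (auto simp: G_def)
      then have "gcd (x - a) (y - b) \<noteq> 1" by (simp add: coprime_iff_gcd_eq_1)
      then have "nat (gcd (x - a) (y - b)) \<noteq> 1" by (simp add: nat_eq_iff)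
      then obtain p where p: "prime p" "p dvd nat (gcd (x - a) (y - b))"
        using prime_factor_nat by blast
      then have "int p dvd gcd (x - a) (y - b)" by (simp add: int_dvd_int_iff[symmetric])
      then have d: "int p dvd x - a" "int p dvd y - b" by (auto intro: dvd_trans)
      have ok: "\<forall>p\<in>{p. prime p \<and> p \<le> z}. \<forall>(a, b)\<in>B. \<not> (int p dvd x - a \<and> int p dvd y - b)"
        using v xy by (simp add: G_def)
      have "p > z"
      proof (rule ccontr)
        assume "\<not> p > z"
        then have "p \<in> {p. prime p \<and> p \<le> z}" using p by simp
        from bspec[OF bspec[OF ok this] ab(1)] d show False by simp
      qed
      moreover have "\<bar>x - a\<bar> \<le> int ?X" "\<bar>y - b\<bar> \<le> int ?X"
      proof -
        have "int K * 1 \<le> int K * int Q" using Q by (intro mult_left_mono) auto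
        then show "\<bar>x - a\<bar> \<le> int ?X" "\<bar>y - b\<bar> \<le> int ?X"
          using box[OF S] K[OF ab(1)] by (auto simp: D_def algebra_simps)
      qed
      ultimately have "(x - a, y - b) \<in> ?V" using d by auto
      then show "v \<in> (\<Union>v\<in>B. (\<lambda>(e, f). (e + fst v, f + snd v)) ` ?V)"
        using ab xy by (force intro!: bexI[of _ "(a, b)"] image_eqI[of _ _ "(x - a, y - b)"])
    qed
    have V: "finite ?V" "real (card ?V) \<le> 2 * (2 * real ?X + 1) + 4 * (real ?X)\<^sup>2 / z"
      by (rule card_large_common_prime_factor[OF z])+
    have "card (G z Q - ?c) \<le> card (\<Union>v\<in>B. (\<lambda>(e, f). (e + fst v, f + snd v)) ` ?V)"
      by (rule card_mono[OF _ sub2]) (use B V in auto)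
    also have "\<dots> \<le> (\<Sum>v\<in>B. card ((\<lambda>(e, f). (e + fst v, f + snd v)) ` ?V))"
      by (rule card_UN_le[OF B])
    also have "\<dots> \<le> (\<Sum>v\<in>B. card ?V)"
      by (intro sum_mono card_image_le V)
    finally have "real (card (G z Q - ?c)) \<le> real (card B) * real (card ?V)"
      by (simp add: of_nat_mult[symmetric] del: of_nat_mult)
    also have "\<dots> \<le> real (card B) * (2 * (2 * real ?X + 1) + 4 * (real ?X)\<^sup>2 / z)"
      by (intro mult_left_mono V) auto
    finally have le: "real (card (G z Q - ?c)) \<le> real (card B) * (2 * (2 * real ?X + 1) + 4 * (real ?X)\<^sup>2 / z)" .
    have "real (card (G z Q)) = c Q + real (card (G z Q - ?c))"
      using card_mono[OF finG sub1] finite_subset[OF sub1 finG] sub1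
      by (simp add: c_def card_Diff_subset of_nat_diff)
    then have "\<bar>c Q / (real Q)\<^sup>2 - real (card (G z Q)) / (real Q)\<^sup>2\<bar> = real (card (G z Q - ?c)) / (real Q)\<^sup>2"
      by (simp add: add_divide_distrib)
    also have "\<dots> \<le> real (card B) * (2 * (2 * real ?X + 1) + 4 * (real ?X)\<^sup>2 / z) / (real Q)\<^sup>2"
      by (intro divide_right_mono le) auto
    also have "\<dots> = real (card B) * (4 * real D + 2 / real Q) / real Q + real (card B) * (4 * (real D)\<^sup>2) / z"
    proof -
      have "2 * (2 * real ?X + 1) / (real Q)\<^sup>2 = (4 * real D + 2 / real Q) / real Q"
        using Q by (simp add: power2_eq_square add_divide_distrib)
      moreover have "4 * (real ?X)\<^sup>2 / z / (real Q)\<^sup>2 = 4 * (real D)\<^sup>2 / z"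
        using Q by (simp add: power_mult_distrib)
      ultimately have "(2 * (2 * real ?X + 1) + 4 * (real ?X)\<^sup>2 / z) / (real Q)\<^sup>2
          = (4 * real D + 2 / real Q) / real Q + 4 * (real D)\<^sup>2 / z"
        by (simp only: add_divide_distrib)
      moreover have "b * u / w = b * v / q + b * v' / q'" if "u / w = v / q + v' / q'" for b u w v q v' q' :: real
        using arg_cong[OF that, of "\<lambda>t. b * t"] by (simp add: distrib_left)
      ultimately show ?thesis by blast
    qed
    also have "\<dots> \<le> E / real Q + E / real z"
    proof (intro add_mono divide_right_mono)
      show "real (card B) * (4 * real D + 2 / real Q) \<le> E"
      proof -
        have "2 / real Q \<le> 2" using Q by (simp add: divide_le_eq)
        then have "4 * real D + 2 / real Q \<le> 4 * real D + 2 + 4 * (real D)\<^sup>2"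
          using zero_le_power2[of "real D"] by linarith
        then show ?thesis unfolding E_def by (intro mult_left_mono) auto
      qed
      show "real (card B) * (4 * (real D)\<^sup>2) \<le> E"
        unfolding E_def by (intro mult_left_mono) auto
    qed auto
    finally show "\<bar>c Q / (real Q)\<^sup>2 - real (card (G z Q)) / (real Q)\<^sup>2\<bar> \<le> E / real z + E / real Q"
      by simp
  qed
qed

section \<open>Lattice points in the triangle and above the hyperbola\<close>

text \<open>The area of \<open>{(s, t) \<in> [0, 1]\<^sup>2. s t > u}\<close>.\<close>

definition hyperbola_area :: "real \<Rightarrow> real" where
  "hyperbola_area u = (if u < 1 then 1 - u + u * ln u else 0)"

text \<open>For \<open>y \<le> T / Q\<close> the summand vanishes. Beyond
  \<open>n = \<lfloor>T / Q\<rfloor>\<close> the sum is \<open>Q (Q - n) - T (H_Q - H_n)\<close>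
  with harmonic numbers, where \<open>n / Q\<close> tends to \<open>u\<close> and
  \<open>H_Q - H_n\<close> to \<open>- ln u\<close>. If \<open>u \<ge> 1\<close>, every summand is
  at most the last one, and \<open>Q\<close> times that is \<open>o(Q^2)\<close>.\<close>

lemma hyperbola_sum_limit:
  fixes T :: "nat \<Rightarrow> real"
  assumes T: "(\<lambda>Q. T Q / (real Q)\<^sup>2) \<longlonglongrightarrow> u" and u: "u > 0"
  shows "(\<lambda>Q. (\<Sum>y\<in>{1..Q}. max 0 (real Q - T Q / real y)) / (real Q)\<^sup>2) \<longlonglongrightarrow> hyperbola_area u"
proof (cases "u < 1")
  case False
  have "(\<lambda>Q. max 0 (1 - T Q / (real Q)\<^sup>2)) \<longlonglongrightarrow> max 0 (1 - u)"
    by (intro tendsto_intros T)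
  then have lim: "(\<lambda>Q. max 0 (1 - T Q / (real Q)\<^sup>2)) \<longlonglongrightarrow> 0" using False by simp
  have "(\<lambda>Q. (\<Sum>y\<in>{1..Q}. max 0 (real Q - T Q / real y)) / (real Q)\<^sup>2) \<longlonglongrightarrow> 0"
  proof (rule tendsto_sandwich[OF _ _ tendsto_const lim])
    show "\<forall>\<^sub>F Q in sequentially. 0 \<le> (\<Sum>y\<in>{1..Q}. max 0 (real Q - T Q / real y)) / (real Q)\<^sup>2"
      by (intro always_eventually allI divide_nonneg_nonneg sum_nonneg) auto
    show "\<forall>\<^sub>F Q in sequentially. (\<Sum>y\<in>{1..Q}. max 0 (real Q - T Q / real y)) / (real Q)\<^sup>2 \<le> max 0 (1 - T Q / (real Q)\<^sup>2)"
      using order_tendstoD(1)[OF T u] eventually_ge_at_top[of 1]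
    proof eventually_elim
      case (elim Q)
      then have TQ: "T Q > 0" by (simp add: zero_less_divide_iff)
      have "(\<Sum>y\<in>{1..Q}. max 0 (real Q - T Q / real y)) \<le> (\<Sum>y\<in>{1..Q}. max 0 (real Q - T Q / real Q))"
        using TQ by (intro sum_mono max.mono diff_mono divide_left_mono) auto
      also have "\<dots> = (real Q)\<^sup>2 * max 0 (1 - T Q / (real Q)\<^sup>2)"
        using elim by (auto simp: max_def power2_eq_square field_simps)
      finally show ?case using elim by (simp add: divide_le_eq mult.commute)
    qed
  qed
  then show ?thesis using False by (simp add: hyperbola_area_def)
next
  case True
  define n where "n Q = nat \<lfloor>T Q / real Q\<rfloor>" for Q
  have ev: "\<forall>\<^sub>F Q in sequentially. 0 < T Q \<and> T Q < (real Q)\<^sup>2 \<and> Q \<ge> 1"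
    using order_tendstoD(1)[OF T u] order_tendstoD(2)[OF T True] eventually_ge_at_top[of 1]
    by eventually_elim (auto simp: zero_less_divide_iff divide_less_eq)
  have nQ: "(\<lambda>Q. real (n Q) / real Q) \<longlonglongrightarrow> u"
  proof -
    have "(\<lambda>Q. real (n Q) / real Q - T Q / (real Q)\<^sup>2) \<longlonglongrightarrow> 0"
    proof (rule Lim_null_comparison[OF _ LIMSEQ_const_over_nat[of 1]])
      show "\<forall>\<^sub>F Q in sequentially. norm (real (n Q) / real Q - T Q / (real Q)\<^sup>2) \<le> 1 / real Q"
        using ev
      proof eventually_elim
        case (elim Q)
        have "real (n Q) = real_of_int \<lfloor>T Q / real Q\<rfloor>" using elim by (simp add: n_def)
        then have "\<bar>real (n Q) - T Q / real Q\<bar> \<le> 1" by linarith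
        then have "\<bar>real (n Q) - T Q / real Q\<bar> / real Q \<le> 1 / real Q" by (intro divide_right_mono) auto
        moreover have "real (n Q) / real Q - T Q / (real Q)\<^sup>2 = (real (n Q) - T Q / real Q) / real Q"
          by (simp add: diff_divide_distrib power2_eq_square)
        ultimately show ?case by (simp add: abs_divide)
      qed
    qed
    from tendsto_add[OF this T] show ?thesis by simp
  qed
  have n_top: "filterlim n at_top sequentially"
  proof -
    have "filterlim (\<lambda>Q. real (n Q) / real Q * real Q) at_top sequentially"
      by (rule filterlim_tendsto_pos_mult_at_top[OF nQ u filterlim_real_sequentially])
    moreover have "\<forall>\<^sub>F Q in sequentially. real (n Q) / real Q * real Q = real (n Q)"
      using eventually_ge_at_top[of 1] by eventually_elim simp
    ultimately have "filterlim (\<lambda>Q. real (n Q)) at_top sequentially"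
      by (simp cong: filterlim_cong add: filterlim_cong[OF refl refl])
    then show ?thesis by (simp add: filterlim_sequentially_iff_filterlim_real)
  qed
  \<comment> \<open>The two Euler-Mascheroni constants cancel; the second limit is available because
    \<open>n\<close> tends to infinity, which rests on \<open>u > 0\<close>.\<close>
  have harm: "(\<lambda>Q. (harm Q :: real) - harm (n Q)) \<longlonglongrightarrow> - ln u"
  proof -
    have "(\<lambda>Q. (harm Q - ln (real Q)) - (harm (n Q) - ln (real (n Q))) - ln (real (n Q) / real Q))
        \<longlonglongrightarrow> euler_mascheroni - euler_mascheroni - ln u"
      using u by (intro tendsto_intros euler_mascheroni_LIMSEQ nQ
          filterlim_compose[OF euler_mascheroni_LIMSEQ n_top]) auto
    moreover have "\<forall>\<^sub>F Q in sequentially. (harm Q - ln (real Q)) - (harm (n Q) - ln (real (n Q))) - ln (real (n Q) / real Q)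
        = (harm Q :: real) - harm (n Q)"
      using eventually_ge_at_top[of 1] n_top[unfolded filterlim_at_top, rule_format, of 1]
      by eventually_elim (simp add: ln_div)
    ultimately show ?thesis by (simp add: tendsto_cong)
  qed
  have "(\<lambda>Q. 1 - real (n Q) / real Q - T Q / (real Q)\<^sup>2 * (harm Q - harm (n Q))) \<longlonglongrightarrow> 1 - u - u * (- ln u)"
    by (intro tendsto_intros nQ T harm)
  moreover have "\<forall>\<^sub>F Q in sequentially. 1 - real (n Q) / real Q - T Q / (real Q)\<^sup>2 * (harm Q - harm (n Q))
      = (\<Sum>y\<in>{1..Q}. max 0 (real Q - T Q / real y)) / (real Q)\<^sup>2"
    using ev
  proof eventually_elim
    case (elim Q)
    have Q0: "real Q > 0" using elim by simp
    have n: "n Q < y \<longleftrightarrow> T Q < real Q * real y" for y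
    proof -
      have "0 \<le> T Q / real Q" using elim by simp
      then have "n Q < y \<longleftrightarrow> \<lfloor>T Q / real Q\<rfloor> < int y" unfolding n_def by (simp add: nat_less_iff)
      also have "\<dots> \<longleftrightarrow> T Q / real Q < real y" by (simp add: floor_less_iff)
      finally show ?thesis using Q0 by (simp add: divide_less_eq mult.commute)
    qed
    have "n Q < Q" using elim n[of Q] by (simp add: power2_eq_square)
    have "(\<Sum>y\<in>{1..Q}. max 0 (real Q - T Q / real y)) = (\<Sum>y\<in>{n Q<..Q}. real Q - T Q / real y)"
    proof (rule sum.mono_neutral_cong_right)
      show "\<forall>y\<in>{1..Q} - {n Q<..Q}. max 0 (real Q - T Q / real y) = 0"
      proof
        fix y assume y: "y \<in> {1..Q} - {n Q<..Q}"
        then have "\<not> n Q < y" by auto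
        then have "real Q * real y \<le> T Q" unfolding n by simp
        then have "real Q \<le> T Q / real y" using y by (simp add: le_divide_eq)
        then show "max 0 (real Q - T Q / real y) = 0" by simp
      qed
      show "max 0 (real Q - T Q / real y) = real Q - T Q / real y" if "y \<in> {n Q<..Q}" for y
      proof -
        have "n Q < y" "real y > 0" using that by auto
        then have "T Q / real y < real Q" unfolding n by (simp add: divide_less_eq)
        then show ?thesis by simp
      qed
    qed auto
    also have "\<dots> = real Q * (real Q - real (n Q)) - T Q * (\<Sum>y\<in>{n Q<..Q}. 1 / real y)"
      using \<open>n Q < Q\<close> by (simp add: sum_subtractf sum_distrib_left of_nat_diff)
    also have "(\<Sum>y\<in>{n Q<..Q}. 1 / real y) = harm Q - harm (n Q)"
    proof -
      have U: "{1..Q} = {1..n Q} \<union> {n Q<..Q}" using \<open>n Q < Q\<close> by auto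
      have "(harm Q :: real) = harm (n Q) + (\<Sum>y\<in>{n Q<..Q}. inverse (real y))"
        unfolding harm_def U by (rule sum.union_disjoint) auto
      then show ?thesis by (simp add: inverse_eq_divide)
    qed
    finally have "(\<Sum>y\<in>{1..Q}. max 0 (real Q - T Q / real y)) / (real Q)\<^sup>2
        = real Q * (real Q - real (n Q)) / (real Q)\<^sup>2 - T Q * (harm Q - harm (n Q)) / (real Q)\<^sup>2"
      by (simp only: diff_divide_distrib)
    also have "real Q * (real Q - real (n Q)) / (real Q)\<^sup>2 = 1 - real (n Q) / real Q"
      using Q0 by (simp add: power2_eq_square diff_divide_distrib)
    finally show ?case by simp
  qed
  ultimately show ?thesis using True by (simp add: hyperbola_area_def tendsto_cong)
qed

lemma sum_int_interval_eq_nat: "(\<Sum>y\<in>{1..int Q}. f y) = (\<Sum>y\<in>{1..Q}. f (int y))"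
  by (rule sum.reindex_bij_witness[of _ int nat]) auto

text \<open>With \<open>q = r * x + k * y\<close> the region is \<open>T / y < q \<le> Q\<close>, so
  for fixed \<open>y\<close> the number \<open>x\<close> runs through an interval of length
  \<open>(Q - T / y) / r\<close> if this is positive; it grows with \<open>y\<close>, and
  \<open>1 / r\<close> becomes the factor in the limit. The coprimality conditions forbid the points
  \<open>(0, 0)\<close>, \<open>(1, 0)\<close> and \<open>(k, - r)\<close> modulo every
  prime.\<close>

lemma card_hyperbola_coprime_limit:
  fixes T :: "nat \<Rightarrow> real" and r k :: int
  assumes r: "r \<ge> 1" and k: "0 \<le> k" "k < r"
    and T: "(\<lambda>Q. T Q / (real Q)\<^sup>2) \<longlonglongrightarrow> u" "u > 0" "\<And>Q. T Q \<ge> 0"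
    and prod: "(\<lambda>z. \<Prod>p | prime p \<and> p \<le> z. 1 - residue_count {(0, 0), (1, 0), (k, - r)} p / (real p)\<^sup>2) \<longlonglongrightarrow> \<sigma>"
  shows "(\<lambda>Q. real (card {(x, y). 1 \<le> y \<and> y \<le> int Q \<and> r * x + k * y \<le> int Q \<and>
            T Q < real_of_int ((r * x + k * y) * y) \<and>
            coprime x y \<and> coprime (x - 1) y \<and> coprime (x - k) (y + r)}) / (real Q)\<^sup>2)
         \<longlonglongrightarrow> hyperbola_area u / real_of_int r * \<sigma>"
proof -
  define L U where "L Q y = (T Q / real_of_int y - k * y) / r"
    and "U Q y = (real Q - k * y) / r" for Q and y :: int
  define S where "S Q = {(x, y). 1 \<le> y \<and> y \<le> int Q \<and> L Q y < real_of_int x \<and> real_of_int x \<le> U Q y}" for Q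
  have r0: "real_of_int r > 0" using r by simp
  have S: "(x, y) \<in> S Q \<longleftrightarrow> 1 \<le> y \<and> y \<le> int Q \<and> r * x + k * y \<le> int Q \<and> T Q < real_of_int ((r * x + k * y) * y)" for x y Q
  proof (cases "y \<ge> 1")
    case True
    then have y0: "real_of_int y > 0" by simp
    have "L Q y < real_of_int x \<longleftrightarrow> T Q / real_of_int y < real_of_int (r * x + k * y)"
      unfolding L_def using r0 by (simp add: divide_less_eq algebra_simps)
    also have "\<dots> \<longleftrightarrow> T Q < real_of_int ((r * x + k * y) * y)"
      using y0 by (simp add: divide_less_eq)
    finally have 1: "L Q y < real_of_int x \<longleftrightarrow> T Q < real_of_int ((r * x + k * y) * y)" .
    have "real_of_int x \<le> U Q y \<longleftrightarrow> real_of_int (r * x + k * y) \<le> real_of_int (int Q)"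
      unfolding U_def using r0 by (simp add: le_divide_eq algebra_simps)
    also have "\<dots> \<longleftrightarrow> r * x + k * y \<le> int Q" by (simp only: of_int_le_iff)
    finally show ?thesis using 1 by (auto simp: S_def)
  qed (auto simp: S_def)
  have f: "max 0 (U Q y - L Q y) = max 0 (real Q - T Q / real_of_int y) / r" for Q y
  proof -
    have "U Q y - L Q y = (real Q - T Q / real_of_int y) / r"
      unfolding U_def L_def by (simp add: diff_divide_distrib)
    then show ?thesis using r0 by (simp add: max_divide_distrib_right)
  qed
  let ?B = "{(0, 0), (1, 0), (k, - r)}"
  have "(\<lambda>Q. real (card {(x, y). (x, y) \<in> S Q \<and> (\<forall>(a, b)\<in>?B. coprime (x - a) (y - b))}) / (real Q)\<^sup>2)
     \<longlonglongrightarrow> hyperbola_area u / r * \<sigma>"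
  proof (rule sieve_lattice_points[OF _ _ _ prod])
    fix Q x y assume xy: "(x, y) \<in> S Q"
    then have y: "1 \<le> y" "y \<le> int Q" "r * x + k * y \<le> int Q" and t: "T Q < real_of_int ((r * x + k * y) * y)"
      by (auto simp: S)
    have "0 < real_of_int ((r * x + k * y) * y)" using t T(3)[of Q] by linarith
    then have "0 < (r * x + k * y) * y" by linarith
    \<comment> \<open>From \<open>0 < r * x + k * y \<le> Q\<close>, \<open>0 \<le> k < r\<close>
      and \<open>1 \<le> y \<le> Q\<close> it follows that \<open>\<bar>x\<bar> \<le> Q\<close>, so
      the box constant is 1.\<close>
    then have pos: "0 < r * x + k * y" using y by (simp add: zero_less_mult_iff)
    have ky: "k * y \<le> r * int Q" using y k by (intro mult_mono) auto
    have "r * x \<le> r * int Q"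
    proof -
      have "r * x \<le> int Q" using y k mult_nonneg_nonneg[of k y] by linarith
      also have "int Q \<le> r * int Q" using r mult_right_mono[of 1 r "int Q"] by simp
      finally show ?thesis .
    qed
    then have x1: "x \<le> int Q" using r by simp
    have "r * (- x) \<le> r * int Q" using pos ky by simp
    then have x2: "- x \<le> int Q" using r by (simp only: mult_le_cancel_left_pos)
    show "\<bar>x\<bar> \<le> int (1 * Q) \<and> \<bar>y\<bar> \<le> int (1 * Q)" using x1 x2 y by auto
  next
    fix M \<alpha> \<beta> :: int assume M: "M > 0"
    have "(\<lambda>Q. real (card {(x, y). (1 \<le> y \<and> y \<le> int Q \<and> L Q y < real_of_int x \<and> real_of_int x \<le> U Q y) \<and>
            [x = \<alpha>] (mod M) \<and> [y = \<beta>] (mod M)}) / (real Q)\<^sup>2) \<longlonglongrightarrow> hyperbola_area u / r / (real_of_int M)\<^sup>2"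
    proof (rule fibred_region_equidistributed[OF _ _ _ M, of _ _ 1])
      show "max 0 (U Q y - L Q y) \<le> max 0 (U Q z - L Q z)" if "1 \<le> y" "y \<le> z" for Q y z
        unfolding f using that r0 T(3)[of Q] by (intro divide_right_mono max.mono diff_mono divide_left_mono) auto
      show "max 0 (U Q (int Q) - L Q (int Q)) \<le> 1 * real Q" for Q
      proof -
        have "max 0 (real Q - T Q / real_of_int (int Q)) \<le> real Q" using T(3)[of Q] by simp
        then have "max 0 (real Q - T Q / real_of_int (int Q)) / r \<le> real Q / 1" using r by (intro frac_le) auto
        then show ?thesis unfolding f by simp
      qed
      have "(\<lambda>Q. (\<Sum>y\<in>{1..Q}. max 0 (real Q - T Q / real y)) / (real Q)\<^sup>2 / r) \<longlonglongrightarrow> hyperbola_area u / r"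
        using r0 by (intro tendsto_intros hyperbola_sum_limit T) auto
      then show "(\<lambda>Q. (\<Sum>y\<in>{1..int Q}. max 0 (U Q y - L Q y)) / (real Q)\<^sup>2) \<longlonglongrightarrow> hyperbola_area u / r"
        unfolding f sum_int_interval_eq_nat by (simp add: sum_divide_distrib[symmetric] mult.commute)
    qed
    then show "(\<lambda>Q. real (card {(x, y). (x, y) \<in> S Q \<and> [x = \<alpha>] (mod M) \<and> [y = \<beta>] (mod M)}) / (real Q)\<^sup>2)
       \<longlonglongrightarrow> hyperbola_area u / r / (real_of_int M)\<^sup>2"
      by (simp add: S_def)
  qed auto
  moreover have "{(x, y). (x, y) \<in> S Q \<and> (\<forall>(a, b)\<in>?B. coprime (x - a) (y - b))}
     = {(x, y). 1 \<le> y \<and> y \<le> int Q \<and> r * x + k * y \<le> int Q \<and> T Q < real_of_int ((r * x + k * y) * y) \<and>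
            coprime x y \<and> coprime (x - 1) y \<and> coprime (x - k) (y + r)}" for Q
    unfolding S by auto
  ultimately show ?thesis by (simp only:)
qed

text \<open>The \<open>1 / 2\<close> is the area of the triangle
  \<open>0 < a \<le> q \<le> 1\<close> after scaling by \<open>Q\<close>; the two coprimality
  conditions forbid \<open>(0, 0)\<close> and \<open>(- 1, 0)\<close> modulo every prime.\<close>

lemma card_triangle_coprime_limit:
  assumes prod: "(\<lambda>z. \<Prod>p | prime p \<and> p \<le> z. 1 - residue_count {(0, 0), (- 1, 0)} p / (real p)\<^sup>2) \<longlonglongrightarrow> \<sigma>"
  shows "(\<lambda>Q. real (card {(a, q). 1 \<le> q \<and> q \<le> int Q \<and> 0 < a \<and> a \<le> q \<and> coprime a q \<and> coprime (a + 1) q}) / (real Q)\<^sup>2)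
    \<longlonglongrightarrow> 1 / 2 * \<sigma>"
proof -
  let ?B = "{(0, 0), (- 1 :: int, 0 :: int)}"
  define S where "S Q = {(a, q). 1 \<le> q \<and> q \<le> int Q \<and> 0 < real_of_int a \<and> real_of_int a \<le> real_of_int q}" for Q
  have "(\<lambda>Q. real (card {(x, y). (x, y) \<in> S Q \<and> (\<forall>(a, b)\<in>?B. coprime (x - a) (y - b))}) / (real Q)\<^sup>2)
     \<longlonglongrightarrow> 1 / 2 * \<sigma>"
  proof (rule sieve_lattice_points[OF _ _ _ prod])
    show "\<bar>x\<bar> \<le> int (1 * Q) \<and> \<bar>y\<bar> \<le> int (1 * Q)" if "(x, y) \<in> S Q" for x y Q
      using that by (auto simp: S_def)
    fix M \<alpha> \<beta> :: int assume M: "M > 0"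
    have "(\<lambda>Q. real (card {(x, y). (1 \<le> y \<and> y \<le> int Q \<and> 0 < real_of_int x \<and> real_of_int x \<le> real_of_int y) \<and>
            [x = \<alpha>] (mod M) \<and> [y = \<beta>] (mod M)}) / (real Q)\<^sup>2) \<longlonglongrightarrow> 1 / 2 / (real_of_int M)\<^sup>2"
    proof (rule fibred_region_equidistributed[OF _ _ _ M, of _ _ 1])
      have eq: "(\<Sum>y\<in>{1..int Q}. max 0 (real_of_int y - 0)) = real Q * (real Q + 1) / 2" for Q
      proof -
        have "(\<Sum>y\<in>{1..int Q}. max 0 (real_of_int y - 0)) = real (\<Sum>{1..Q})"
          unfolding sum_int_interval_eq_nat by simp
        also have "2 * \<Sum>{1..Q} = Q * (Q + 1)" by (induction Q) auto
        then have "real (\<Sum>{1..Q}) = real Q * (real Q + 1) / 2"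
          by (metis (mono_tags, lifting) nonzero_mult_div_cancel_left of_nat_1 of_nat_add of_nat_mult of_nat_numeral zero_neq_numeral)
        finally show ?thesis .
      qed
      have "(\<lambda>Q. 1 / 2 + (1 / 2) / real Q) \<longlonglongrightarrow> 1 / 2 + 0"
        by (intro tendsto_intros LIMSEQ_const_over_nat)
      moreover have "\<forall>\<^sub>F Q in sequentially. 1 / 2 + (1 / 2) / real Q = (\<Sum>y\<in>{1..int Q}. max 0 (real_of_int y - 0)) / (real Q)\<^sup>2"
        unfolding eq using eventually_ge_at_top[of 1] by eventually_elim (simp add: field_simps power2_eq_square)
      ultimately show "(\<lambda>Q. (\<Sum>y\<in>{1..int Q}. max 0 (real_of_int y - 0)) / (real Q)\<^sup>2) \<longlonglongrightarrow> 1 / 2"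
        by (simp add: tendsto_cong)
    qed auto
    then show "(\<lambda>Q. real (card {(x, y). (x, y) \<in> S Q \<and> [x = \<alpha>] (mod M) \<and> [y = \<beta>] (mod M)}) / (real Q)\<^sup>2)
       \<longlonglongrightarrow> 1 / 2 / (real_of_int M)\<^sup>2"
      by (simp add: S_def)
  qed auto
  moreover have "{(x, y). (x, y) \<in> S Q \<and> (\<forall>(a, b)\<in>?B. coprime (x - a) (y - b))}
     = {(a, q). 1 \<le> q \<and> q \<le> int Q \<and> 0 < a \<and> a \<le> q \<and> coprime a q \<and> coprime (a + 1) q}" for Q
    unfolding S_def by auto
  ultimately show ?thesis by (simp only:)
qed

section \<open>Close pairs of fractions as lattice points\<close>

text \<open>A common divisor of \<open>a\<close> and \<open>b\<close> divides every integral
  combination of them. This one-sided statement, applied in each direction, carries coprimality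
  across the unimodular changes of coordinates below.\<close>

lemma coprime_of_combinations:
  fixes a b :: int
  assumes "coprime (s * a + t * b) (u * a + v * b)"
  shows "coprime a b"
  using assms by (intro coprimeI) (meson assms coprime_common_divisor dvd_add dvd_mult)

lemma reduced_fraction_unique:
  fixes a b q s :: int
  assumes "real_of_int a / q = real_of_int b / s" "coprime a q" "coprime b s" "q > 0" "s > 0"
  shows "a = b \<and> q = s"
proof -
  have "real_of_int (a * s) = real_of_int (b * q)" using assms by (simp add: field_simps)
  then have *: "a * s = b * q" by linarith
  then have "q dvd a * s" "s dvd b * q" by (metis dvd_triv_right)+
  then have "q dvd s" "s dvd q" using assms by (auto simp: coprime_dvd_mult_right_iff coprime_commute)
  then have "q = s" using assms by (simp add: zdvd_antisym_nonneg)
  then show ?thesis using * assms by simp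
qed

text \<open>Coprimality of \<open>a\<close> and \<open>q\<close> makes them functions of the
  fraction, so fractions can be counted as integer pairs.\<close>

definition int_farey :: "nat \<Rightarrow> real set" where
  "int_farey Q = {real_of_int a / real_of_int q | a q. 1 \<le> a \<and> a \<le> q \<and> q \<le> int Q \<and> coprime a q \<and> coprime (a + 1) q}"

lemma poly_farey_eq_int_farey: "poly_farey ([:0, 1:] * [:1, 1:]) Q = int_farey Q"
proof -
  have *: "gcd (poly ([:0, 1:] * [:1, 1:]) a) q = 1 \<longleftrightarrow> coprime a q \<and> coprime (a + 1) q" for a q :: int
  proof -
    have "poly ([:0, 1:] * [:1, 1:]) a = a * (a + 1)" by (simp add: algebra_simps)
    then show ?thesis by (simp only: coprime_iff_gcd_eq_1[symmetric] coprime_mult_left_iff)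
  qed
  show ?thesis unfolding poly_farey_def int_farey_def *
  proof (intro equalityI subsetI; clarify)
    fix a q :: nat
    assume "1 \<le> a" "a \<le> q" "q \<le> Q" "coprime (int a) (int q)" "coprime (int a + 1) (int q)"
    then show "\<exists>b s. real a / real q = real_of_int b / real_of_int s \<and> 1 \<le> b \<and> b \<le> s \<and> s \<le> int Q \<and> coprime b s \<and> coprime (b + 1) s"
      by (intro exI[of _ "int a"] exI[of _ "int q"]) simp
  next
    fix a q :: int
    assume "1 \<le> a" "a \<le> q" "q \<le> int Q" "coprime a q" "coprime (a + 1) q"
    then show "\<exists>b s. real_of_int a / real_of_int q = real b / real s \<and> 1 \<le> b \<and> b \<le> s \<and> s \<le> Q \<and> coprime (int b) (int s) \<and> coprime (int b + 1) (int s)"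
      by (intro exI[of _ "nat a"] exI[of _ "nat q"]) auto
  qed
qed

lemma card_int_farey:
  "card (int_farey Q) = card {(a, q). 1 \<le> q \<and> q \<le> int Q \<and> 0 < a \<and> a \<le> q \<and> coprime a q \<and> coprime (a + 1) q}"
proof -
  have "int_farey Q = (\<lambda>(a, q). real_of_int a / real_of_int q) `
      {(a, q). 1 \<le> q \<and> q \<le> int Q \<and> 0 < a \<and> a \<le> q \<and> coprime a q \<and> coprime (a + 1) q}"
    unfolding int_farey_def by force
  moreover have "inj_on (\<lambda>(a, q). real_of_int a / real_of_int q)
      {(a, q). 1 \<le> q \<and> q \<le> int Q \<and> 0 < a \<and> a \<le> q \<and> coprime a q \<and> coprime (a + 1) q}"
    by (rule inj_onI, clarify) (rule conjI; use reduced_fraction_unique in force)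
  ultimately show ?thesis by (simp add: card_image)
qed

lemma finite_int_farey: "finite (int_farey Q)"
proof -
  have "int_farey Q \<subseteq> (\<lambda>(a, q). real_of_int a / real_of_int q) ` ({1..int Q} \<times> {1..int Q})"
    unfolding int_farey_def by force
  then show ?thesis by (rule finite_subset) auto
qed

definition close_pairs :: "real set \<Rightarrow> real \<Rightarrow> (real \<times> real) set" where
  "close_pairs F \<Lambda> = {(\<gamma>1, \<gamma>2). \<gamma>1 \<in> F \<and> \<gamma>2 \<in> F \<and> \<gamma>1 \<noteq> \<gamma>2 \<and>
       (\<exists>x\<in>{0<..<\<Lambda>}. \<exists>k::int. \<gamma>1 - \<gamma>2 = 1 / real (card F) * x + of_int k)}"

text \<open>Here \<open>y\<close> is the denominator of the second fraction and
  \<open>q = r * x + k * y\<close> that of the first; the inequality with \<open>N\<close> says that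
  their difference modulo 1, which is \<open>r / (q y)\<close>, is less than
  \<open>\<Lambda> / N\<close>. The numerators are absent because the tuple determines them up to
  integer translations of the fractions.\<close>

definition lattice_tuples :: "real \<Rightarrow> real \<Rightarrow> nat \<Rightarrow> (int \<times> int \<times> int \<times> int) set" where
  "lattice_tuples N \<Lambda> Q = {(r, k, x, y). 1 \<le> r \<and> 0 \<le> k \<and> k < r \<and> coprime k r \<and> 1 \<le> y \<and> y \<le> int Q \<and>
     r * x + k * y \<le> int Q \<and> real_of_int r * N < \<Lambda> * real_of_int ((r * x + k * y) * y) \<and>
     coprime x y \<and> coprime (x - 1) y \<and> coprime (x - k) (y + r)}"

text \<open>For given \<open>(x, y)\<close> the column \<open>(c, b)\<close> of determinant 1 is
  unique up to multiples of \<open>(x, y)\<close>. The range of \<open>b\<close> selects one column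
  and makes \<open>b / y\<close> a fraction in \<open>(0, 1]\<close>.\<close>

definition bezout_tuples :: "real \<Rightarrow> real \<Rightarrow> nat \<Rightarrow> (int \<times> int \<times> int \<times> int \<times> int \<times> int) set" where
  "bezout_tuples N \<Lambda> Q = {(r, k, x, y, c, b). (r, k, x, y) \<in> lattice_tuples N \<Lambda> Q \<and> c * y - b * x = 1 \<and> 1 \<le> b \<and> b \<le> y}"

lemma image_bezout_tuples:
  "(\<lambda>(r, k, x, y, c, b). (r, k, x, y)) ` bezout_tuples N \<Lambda> Q = lattice_tuples N \<Lambda> Q"
  proof (intro equalityI subsetI)
    fix v assume v: "v \<in> lattice_tuples N \<Lambda> Q"
    obtain r k x y where [simp]: "v = (r, k, x, y)" by (metis prod.exhaust)
    have xy: "coprime x y" "y \<ge> 1" using v by (auto simp: lattice_tuples_def)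
    obtain s t where st: "s * x + t * y = 1"
      using xy bezout_int[of x y] by (auto simp: coprime_iff_gcd_eq_1)
    \<comment> \<open>The representative of \<open>- s\<close> modulo \<open>y\<close> in
      \<open>{1..y}\<close>: shifting by one before and after \<open>mod\<close> moves the range up
      from \<open>{0..<y}\<close>.\<close>
    define b where "b = (- s - 1) mod y + 1"
    define c where "c = t - ((- s - 1) div y) * x"
    have b: "b = - s - y * ((- s - 1) div y)"
      unfolding b_def using mult_div_mod_eq[of y "- s - 1"] by linarith
    have "c * y - b * x = 1" unfolding b c_def using st by (simp add: algebra_simps)
    moreover have "1 \<le> b" "b \<le> y" unfolding b_def using xy by (auto simp: add1_zle_eq)
    ultimately have "(r, k, x, y, c, b) \<in> bezout_tuples N \<Lambda> Q" using v by (simp add: bezout_tuples_def)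
    then show "v \<in> (\<lambda>(r, k, x, y, c, b). (r, k, x, y)) ` bezout_tuples N \<Lambda> Q" by force
  qed (auto simp: bezout_tuples_def)

lemma card_bezout_tuples: "card (bezout_tuples N \<Lambda> Q) = card (lattice_tuples N \<Lambda> Q)"
proof (rule bij_betw_same_card[of "\<lambda>(r, k, x, y, c, b). (r, k, x, y)"], unfold bij_betw_def, intro conjI)
  show "inj_on (\<lambda>(r, k, x, y, c, b). (r, k, x, y)) (bezout_tuples N \<Lambda> Q)"
  proof (rule inj_onI, clarsimp simp: bezout_tuples_def)
    fix r k x y c b c' b' :: int
    assume T: "(r, k, x, y) \<in> lattice_tuples N \<Lambda> Q" and 1: "c * y - b * x = 1" "1 \<le> b" "b \<le> y"
      and 2: "c' * y - b' * x = 1" "1 \<le> b'" "b' \<le> y"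
    have xy: "coprime x y" "y \<ge> 1" using T by (auto simp: lattice_tuples_def)
    have "(c - c') * y = (b - b') * x" using 1 2 by (simp add: algebra_simps)
    then have "y dvd (b - b') * x" by (metis dvd_triv_right)
    then have "y dvd b - b'" using xy by (simp add: coprime_dvd_mult_left_iff coprime_commute)
    moreover have "\<bar>b - b'\<bar> < y" using 1 2 by linarith
    ultimately have "b - b' = 0" by (meson dvd_imp_le_int not_less abs_le_D1 order_trans abs_ge_self)
    then have "b = b'" by simp
    moreover from this have "c * y = c' * y" using 1(1) 2(1) by (simp add: algebra_simps)
    ultimately show "c = c' \<and> b = b'" using xy by simp
  qed
qed (rule image_bezout_tuples)

text \<open>The map \<open>\<Phi>\<close> is a bijection from the matrices with their
  \<open>r\<close> and \<open>k\<close> onto the close pairs. The hypothesis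
  \<open>\<Lambda> \<le> N\<close> forces \<open>0 < r < q y\<close>, so the difference lies
  strictly between 0 and 1: the fractions are distinct modulo 1, and the integer by which
  \<open>a / q\<close> is translated is determined by the pair.\<close>

lemma card_close_pairs:
  fixes \<Lambda> :: real and Q :: nat
  defines "N \<equiv> real (card (int_farey Q))"
  assumes \<Lambda>: "\<Lambda> > 0" "\<Lambda> \<le> N"
  shows "finite (lattice_tuples N \<Lambda> Q)"
    and "card (close_pairs (int_farey Q) \<Lambda>) = card (lattice_tuples N \<Lambda> Q)"
proof -
  have N: "N > 0" using \<Lambda> by linarith
  \<comment> \<open>The number \<open>a\<close> may lie outside \<open>{1..q}\<close>; subtracting
    \<open>(a - 1) div q\<close> moves \<open>a / q\<close> into \<open>(0, 1]\<close>, where the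
    sequence lives.\<close>
  define \<Phi> where "\<Phi> = (\<lambda>(r::int, k::int, x::int, y::int, c::int, b::int).
     (real_of_int (r * c + k * b) / real_of_int (r * x + k * y) - real_of_int ((r * c + k * b - 1) div (r * x + k * y)),
      real_of_int b / real_of_int y))"
  \<comment> \<open>Inverting the matrix gives \<open>a y - q b = r\<close> and
    \<open>q c - a x = k\<close>. Each coprimality claim then follows from a condition on the tuple
    by integral combinations such as \<open>x (a + 1) - c q = x - k\<close>,
    \<open>y (a + 1) - b q = y + r\<close> and \<open>x (b + 1) - c y = x - 1\<close>.\<close>
  have tuple: "1 \<le> q \<and> q \<le> int Q \<and> 1 \<le> y \<and> y \<le> int Q \<and> a * y - q * b = r \<and> q * c - a * x = k \<and> coprime a q \<and> coprime (a + 1) q \<and>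
      coprime b y \<and> coprime (b + 1) y \<and> 0 < r \<and> r < q * y \<and> r * N < \<Lambda> * (q * y) \<and> 0 \<le> k \<and> k < r \<and> c * y - b * x = 1 \<and> 1 \<le> b \<and> b \<le> y"
    if T: "(r, k, x, y, c, b) \<in> bezout_tuples N \<Lambda> Q" and a: "a = r * c + k * b" and q: "q = r * x + k * y" for r k x y c b a q
  proof -
    have t: "1 \<le> r" "0 \<le> k" "k < r" "coprime k r" "1 \<le> y" "y \<le> int Q" "q \<le> int Q" "r * N < \<Lambda> * (q * y)"
     "coprime x y" "coprime (x - 1) y" "coprime (x - k) (y + r)" "c * y - b * x = 1" "1 \<le> b" "b \<le> y"
      using T by (auto simp: bezout_tuples_def lattice_tuples_def q)
    have "0 < r * N" using t N by simp
    then have "0 < \<Lambda> * (q * y)" using t by linarith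
    then have "0 < real_of_int (q * y)" using \<Lambda> by (simp add: zero_less_mult_iff)
    then have qy: "0 < q * y" by linarith
    then have q0: "q > 0" using t by (simp add: zero_less_mult_iff)
    have "r * N < N * (q * y)"
      using t(8) mult_right_mono[OF \<Lambda>(2), of "real_of_int (q * y)"] qy by linarith
    then have "real_of_int r < real_of_int (q * y)" using N by simp
    then have rq: "r < q * y" by linarith
    have det: "c * y = 1 + b * x" using t by simp
    have r: "a * y - q * b = r"
    proof -
      have "a * y - q * b = r * (c * y - b * x)" by (simp add: a q algebra_simps)
      then show ?thesis using t by simp
    qed
    have k: "q * c - a * x = k"
    proof -
      have "q * c - a * x = k * (c * y - b * x)" by (simp add: a q algebra_simps)
      then show ?thesis using t by simp
    qed
    have "coprime (c * q + (- x) * a) ((- b) * q + y * a)" using t(4) r k by (simp add: algebra_simps)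
    then have "coprime q a" by (rule coprime_of_combinations)
    moreover have "coprime (x * (a + 1) + (- c) * q) (y * (a + 1) + (- b) * q)"
      using t(11) r k by (simp add: algebra_simps)
    then have "coprime (a + 1) q" by (rule coprime_of_combinations)
    moreover have "coprime (c * y + (- x) * b) (0 * y + 0 * b)" using t(12) by (simp add: algebra_simps)
    then have "coprime y b" by (rule coprime_of_combinations)
    moreover have "coprime (x * (b + 1) + (- c) * y) (0 * (b + 1) + 1 * y)"
      using t(10,12) by (simp add: algebra_simps)
    then have "coprime (b + 1) y" by (rule coprime_of_combinations)
    ultimately show ?thesis using t q0 rq r k by (auto simp: coprime_commute)
  qed
  have inj: "inj_on \<Phi> (bezout_tuples N \<Lambda> Q)"
  proof (rule inj_onI)
    fix v v' assume v: "v \<in> bezout_tuples N \<Lambda> Q" and v': "v' \<in> bezout_tuples N \<Lambda> Q" and eq: "\<Phi> v = \<Phi> v'"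
    obtain r k x y c b where V: "v = (r, k, x, y, c, b)" by (metis prod.exhaust)
    obtain r' k' x' y' c' b' where V': "v' = (r', k', x', y', c', b')" by (metis prod.exhaust)
    define a q m where "a = r * c + k * b" and "q = r * x + k * y" and "m = (a - 1) div q"
    define a' q' m' where "a' = r' * c' + k' * b'" and "q' = r' * x' + k' * y'" and "m' = (a' - 1) div q'"
    note t = tuple[OF v[unfolded V] a_def q_def] and t' = tuple[OF v'[unfolded V'] a'_def q'_def]
    have e1: "real_of_int a / q - m = real_of_int a' / q' - m'" and e2: "real_of_int b / y = real_of_int b' / y'"
      using eq unfolding V V' \<Phi>_def a_def q_def a'_def q'_def m_def m'_def by simp_all
    have b_y: "b = b'" "y = y'" using reduced_fraction_unique[OF e2] t t' by auto
    have "real_of_int (a - q * m) / q = real_of_int (a' - q' * m') / q'"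
      using e1 t t' by (simp add: field_simps)
    moreover have "coprime (a - q * m) q" "coprime (a' - q' * m') q'"
      using t t' coprime_of_combinations[of 1 "a - q * m" m q 0 1] coprime_of_combinations[of 1 "a' - q' * m'" m' q' 0 1]
      by (auto simp: mult.commute)
    ultimately have qa: "q = q'" "a - q * m = a' - q' * m'"
      using reduced_fraction_unique[of "a - q * m" q "a' - q' * m'" q'] t t' by auto
    \<comment> \<open>With \<open>b\<close>, \<open>y\<close> and \<open>q\<close> already equal,
      \<open>r\<close> is known modulo \<open>q y\<close>, and it lies strictly between 0 and
      \<open>q y\<close>.\<close>
    have "r - r' = (a - a') * y"
      using t t' by (auto simp: qa b_y algebra_simps)
    also have "a - a' = q * (m - m')" using qa by (simp add: algebra_simps)
    finally have "q * y dvd r - r'" by simp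
    moreover have "\<bar>r - r'\<bar> < q * y" using t t' qa b_y by auto
    ultimately have "r - r' = 0" by (meson dvd_imp_le_int not_less abs_le_D1 order_trans abs_ge_self)
    then have rr: "r = r'" by simp
    \<comment> \<open>Since \<open>b\<close> determines \<open>x\<close> modulo \<open>y\<close>,
      the only freedom left is to add \<open>j y\<close> to \<open>x\<close>, which shifts
      \<open>k\<close> by \<open>- r j\<close>; the range of \<open>k\<close> forces
      \<open>j = 0\<close>.\<close>
    have "(c - c') * y = b * (x - x')" using t t' b_y by (simp add: algebra_simps)
    then have "y dvd b * (x - x')" by (metis dvd_triv_right)
    then have "y dvd x - x'" using t by (simp add: coprime_dvd_mult_right_iff coprime_commute)
    then obtain j where j: "x = x' + y * j" by (metis add.commute diff_add_cancel dvdE)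
    have "r * x + k * y = r * x' + k' * y" using qa(1) by (simp add: q_def q'_def rr b_y)
    then have "(r * j + k) * y = k' * y" by (simp add: j algebra_simps)
    then have "r * j + k = k'" using t by simp
    then have "k' - k = r * j" by simp
    moreover have "\<bar>k' - k\<bar> < r" using t t' rr by auto
    ultimately have "k' - k = 0" by (metis dvd_imp_le_int dvd_triv_left not_less abs_of_pos t)
    then have "k = k'" "j = 0" using \<open>k' - k = r * j\<close> t by auto
    then have x: "x = x'" using j by simp
    have "c * y = 1 + b * x" "c' * y' = 1 + b' * x'" using t t' by linarith+
    then have "c * y = c' * y" using x b_y by simp
    then have "c = c'" using t by simp
    then show "v = v'" using V V' rr x b_y \<open>k = k'\<close> by simp
  qed
  have img: "\<Phi> ` bezout_tuples N \<Lambda> Q = close_pairs (int_farey Q) \<Lambda>"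
  proof (intro equalityI subsetI)
    fix w assume "w \<in> \<Phi> ` bezout_tuples N \<Lambda> Q"
    then obtain r k x y c b where v: "(r, k, x, y, c, b) \<in> bezout_tuples N \<Lambda> Q" and w: "w = \<Phi> (r, k, x, y, c, b)"
      by (metis (no_types, lifting) imageE prod.exhaust)
    define a q m where "a = r * c + k * b" and "q = r * x + k * y" and "m = (a - 1) div q"
    note t = tuple[OF v a_def q_def]
    define a1 where "a1 = a - q * m"
    have a1: "a1 = (a - 1) mod q + 1" unfolding a1_def m_def using mult_div_mod_eq[of q "a - 1"] by linarith
    have w': "w = (real_of_int a / q - m, real_of_int b / y)" unfolding w \<Phi>_def by (simp add: a_def q_def m_def)
    have fst: "real_of_int a / q - m = real_of_int a1 / q" unfolding a1_def using t by (simp add: field_simps)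
    have "1 \<le> a1" "a1 \<le> q" unfolding a1 using t by (auto simp: add1_zle_eq)
    moreover have "coprime a1 q"
      using t coprime_of_combinations[of 1 a1 m q 0 1] by (auto simp: mult.commute a1_def)
    moreover have "coprime (a1 + 1) q"
      using t coprime_of_combinations[of 1 "a1 + 1" m q 0 1] by (auto simp: mult.commute a1_def algebra_simps)
    ultimately have F1: "real_of_int a1 / q \<in> int_farey Q" unfolding int_farey_def using t by blast
    have F2: "real_of_int b / y \<in> int_farey Q" unfolding int_farey_def using t by blast
    have qy: "real_of_int q * real_of_int y > 0" using t by simp
    define \<xi> where "\<xi> = N * (r / (q * y))"
    have "real_of_int a * y - real_of_int q * b = r"
      using t by (metis of_int_diff of_int_mult)
    then have diff: "real_of_int a / q - real_of_int b / y = r / (q * y)"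
      using t by (simp add: field_simps)
    have \<xi>: "0 < \<xi>" "\<xi> < \<Lambda>" unfolding \<xi>_def using t qy N by (auto simp: field_simps)
    have d: "real_of_int a1 / q - real_of_int b / y = 1 / N * \<xi> + of_int (- m)"
      unfolding fst[symmetric] \<xi>_def using diff N by simp
    \<comment> \<open>Equality would make \<open>r / (q y)\<close> an integer, against
      \<open>0 < r < q y\<close>.\<close>
    have "real_of_int a1 / q \<noteq> real_of_int b / y"
    proof
      assume "real_of_int a1 / q = real_of_int b / y"
      then have "real_of_int r / (q * y) = m" using d N by (simp add: \<xi>_def)
      then have "real_of_int r = real_of_int (m * (q * y))" using t by (auto simp: divide_eq_eq)
      then have "r = m * (q * y)" by linarith
      then have "q * y dvd r" by simp
      then show False using t zdvd_not_zless by blast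
    qed
    moreover have "\<exists>x\<in>{0<..<\<Lambda>}. \<exists>k::int. real_of_int a1 / q - real_of_int b / y = 1 / real (card (int_farey Q)) * x + of_int k"
      using \<xi> d unfolding N_def by (intro bexI[of _ \<xi>] exI[of _ "- m"]) auto
    ultimately show "w \<in> close_pairs (int_farey Q) \<Lambda>"
      unfolding close_pairs_def w' fst using F1 F2 by simp
  next
    fix w assume "w \<in> close_pairs (int_farey Q) \<Lambda>"
    then obtain \<gamma>1 \<gamma>2 \<xi> and m :: int where w: "w = (\<gamma>1, \<gamma>2)" and F: "\<gamma>1 \<in> int_farey Q" "\<gamma>2 \<in> int_farey Q"
      and \<xi>: "0 < \<xi>" "\<xi> < \<Lambda>" and d: "\<gamma>1 - \<gamma>2 = 1 / N * \<xi> + m"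
      by (auto simp: close_pairs_def N_def)
    from F(1) obtain a1 q where g1: "\<gamma>1 = real_of_int a1 / real_of_int q" "1 \<le> a1" "a1 \<le> q" "q \<le> int Q" "coprime a1 q" "coprime (a1 + 1) q"
      by (auto simp: int_farey_def)
    from F(2) obtain b y where g2: "\<gamma>2 = real_of_int b / real_of_int y" "1 \<le> b" "b \<le> y" "y \<le> int Q" "coprime b y" "coprime (b + 1) y"
      by (auto simp: int_farey_def)
    define a where "a = a1 - q * m"
    define r where "r = a * y - q * b"
    have qy: "real_of_int q * real_of_int y > 0" using g1 g2 by simp
    have "real_of_int a / q - real_of_int b / y = \<xi> / N"
      using d g1 g2 by (simp add: a_def field_simps)
    then have r\<xi>: "real_of_int r = \<xi> / N * (q * y)"
      using g1 g2 by (simp add: r_def field_simps)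
    then have "real_of_int r > 0" using \<xi> N qy by simp
    then have r: "r \<ge> 1" by linarith
    have rN: "r * N < \<Lambda> * (q * y)" using r\<xi> \<xi> N qy by (simp add: mult_less_cancel_right)
    obtain s t where st: "s * y + t * b = 1"
      using g2 bezout_int[of y b] by (auto simp: coprime_iff_gcd_eq_1 gcd.commute)
    define k0 where "k0 = q * s + a * t"
    \<comment> \<open>Adding \<open>j\<close> times the row \<open>(b, y)\<close> to the other row
      keeps the determinant and changes \<open>k\<close> by \<open>- r j\<close>; the quotient
      \<open>k0 div r\<close> is the one that brings \<open>k\<close> into
      \<open>{0..<r}\<close>.\<close>
    define k j where "k = k0 mod r" and "j = k0 div r"
    have k0: "k0 = k + r * j" by (simp add: k_def j_def)
    define x c where "x = - t + j * y" and "c = s + j * b"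
    have det: "c * y - b * x = 1" using st by (simp add: x_def c_def algebra_simps)
    have q: "q = r * x + k * y"
    proof -
      have "r * x + k * y = k0 * y - r * t" by (simp add: x_def k0 algebra_simps)
      also have "\<dots> = q * (s * y + t * b)" by (simp add: k0_def r_def algebra_simps)
      finally show ?thesis using st by simp
    qed
    have a: "a = r * c + k * b"
    proof -
      have "r * c + k * b = k0 * b + r * s" by (simp add: c_def k0 algebra_simps)
      also have "\<dots> = a * (s * y + t * b)" by (simp add: k0_def r_def algebra_simps)
      finally show ?thesis using st by simp
    qed
    have k: "q * c - a * x = k"
    proof -
      have "q * c - a * x = k * (c * y - b * x)" by (simp add: a q algebra_simps)
      then show ?thesis using det by simp
    qed
    have "coprime (1 * a + m * q) (0 * a + 1 * q)" using g1 by (simp add: a_def algebra_simps)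
    then have "coprime a q" by (rule coprime_of_combinations)
    then have "coprime (b * k + c * r) (y * k + x * r)" by (simp add: a q algebra_simps)
    then have kr: "coprime k r" by (rule coprime_of_combinations)
    have "coprime (1 * (a + 1) + m * q) (0 * (a + 1) + 1 * q)" using g1 by (simp add: a_def algebra_simps)
    then have "coprime (a + 1) q" by (rule coprime_of_combinations)
    moreover have "a + 1 = (- b) * (x - k) + c * (y + r)" "q = (- y) * (x - k) + x * (y + r)"
      using det by (simp_all add: a q algebra_simps)
    ultimately have "coprime ((- b) * (x - k) + c * (y + r)) ((- y) * (x - k) + x * (y + r))" by simp
    then have c3: "coprime (x - k) (y + r)" by (rule coprime_of_combinations)
    have "coprime ((- b) * (x - 1) + c * y) (0 * (x - 1) + 1 * y)" using det g2 by (simp add: algebra_simps)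
    then have c2: "coprime (x - 1) y" by (rule coprime_of_combinations)
    have "coprime ((- b) * x + c * y) (0 * x + 0 * y)" using det by (simp add: algebra_simps)
    then have c1: "coprime x y" by (rule coprime_of_combinations)
    have "0 \<le> k" "k < r" using r by (auto simp: k_def)
    then have T: "(r, k, x, y, c, b) \<in> bezout_tuples N \<Lambda> Q"
      unfolding bezout_tuples_def lattice_tuples_def using r kr g1 g2 rN c1 c2 c3 det q by auto
    \<comment> \<open>Because \<open>0 \<le> a1 - 1 < q\<close>, the map \<open>\<Phi>\<close>
      undoes exactly the translation by \<open>m\<close>.\<close>
    have "(a - 1) div q = - m"
    proof -
      have "a - 1 = (a1 - 1) + q * (- m)" by (simp add: a_def)
      moreover have "((a1 - 1) + q * (- m)) div q = (- m) + (a1 - 1) div q" using g1 by (intro div_mult_self2) auto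
      moreover have "(a1 - 1) div q = 0" using g1 by simp
      ultimately show ?thesis by (simp only: add_0_right)
    qed
    then have "\<Phi> (r, k, x, y, c, b) = (real_of_int a / q - real_of_int (- m), real_of_int b / y)"
      unfolding \<Phi>_def prod.case a[symmetric] q[symmetric] by simp
    also have "\<dots> = w" unfolding w g1 g2 using g1 by (simp add: a_def field_simps)
    finally show "w \<in> \<Phi> ` bezout_tuples N \<Lambda> Q" using T by (metis imageI)
  qed
  show "card (close_pairs (int_farey Q) \<Lambda>) = card (lattice_tuples N \<Lambda> Q)"
    using card_image[OF inj] by (simp add: img card_bezout_tuples)
  have "finite (close_pairs (int_farey Q) \<Lambda>)"
    by (rule finite_subset[OF _ finite_cartesian_product[OF finite_int_farey[of Q] finite_int_farey[of Q]]])
       (auto simp: close_pairs_def)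
  then have "finite (bezout_tuples N \<Lambda> Q)" using inj by (simp add: img[symmetric] finite_image_iff)
  then have "finite ((\<lambda>(r, k, x, y, c, b). (r, k, x, y)) ` bezout_tuples N \<Lambda> Q)" by simp
  moreover have "lattice_tuples N \<Lambda> Q = (\<lambda>(r, k, x, y, c, b). (r, k, x, y)) ` bezout_tuples N \<Lambda> Q"
    using image_bezout_tuples by simp
  ultimately show "finite (lattice_tuples N \<Lambda> Q)" by simp
qed

section \<open>Euler factors of the coefficients\<close>

lemma coprime_prime_prod_primes:
  assumes "finite X" "\<And>p. p \<in> X \<Longrightarrow> prime p" "prime q" "q \<notin> X"
  shows "coprime (q::nat) (\<Prod>X)"
  using assms by (intro prod_coprime_right) (metis primes_coprime)

lemma prod_primes_nonzero:
  assumes "finite X" "\<And>p. p \<in> X \<Longrightarrow> prime (p::nat)"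
  shows "\<Prod>X \<noteq> 0"
proof
  assume "\<Prod>X = 0"
  then have "0 \<in> X" using assms(1) by (simp add: prod_zero_iff)
  then show False using assms(2)[of 0] by simp
qed

lemma prime_factors_prod_primes:
  assumes "finite X" "\<And>p. p \<in> X \<Longrightarrow> prime (p::nat)"
  shows "prime_factors (\<Prod>X) = X"
  using assms
proof (induction X rule: finite_induct)
  case (insert q X)
  have "\<Prod>X \<noteq> 0" using insert by (intro prod_primes_nonzero) auto
  moreover have "prime q" using insert by auto
  moreover from this have "q \<noteq> 0" by auto
  ultimately show ?case using insert
    by (simp add: prime_factors_product prime_factorization_prime)
qed simp

lemma squarefree_prod_primes:
  assumes "finite X" "\<And>p. p \<in> X \<Longrightarrow> prime (p::nat)"
  shows "squarefree (\<Prod>X)"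
  using assms
proof (induction X rule: finite_induct)
  case (insert q X)
  then show ?case
    using coprime_prime_prod_primes[of X q] by (simp add: squarefree_mult_coprime squarefree_prime)
qed simp

lemma moebius_prod_primes:
  assumes "finite X" "\<And>p. p \<in> X \<Longrightarrow> prime (p::nat)"
  shows "moebius (\<Prod>X) = (-1) ^ card X"
  unfolding moebius_def using assms by (simp add: prime_factors_prod_primes squarefree_prod_primes)

lemma totient_prod_primes:
  assumes "finite X" "\<And>p. p \<in> X \<Longrightarrow> prime (p::nat)"
  shows "real (totient (\<Prod>X)) = (\<Prod>p\<in>X. real p - 1)"
  using assms
proof (induction X rule: finite_induct)
  case (insert q X)
  have "prime q" using insert by auto
  then have "real (totient q) = real q - 1"
    using prime_ge_1_nat[of q] by (simp add: totient_prime of_nat_diff)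
  then show ?case using insert coprime_prime_prod_primes[of X q] by (simp add: totient_mult_coprime)
qed simp

lemma prod_split:
  fixes X :: "nat set"
  assumes "finite X"
  shows "\<Prod>X = \<Prod>{p\<in>X. P p} * \<Prod>{p\<in>X. \<not> P p}"
proof -
  have "X = {p\<in>X. P p} \<union> {p\<in>X. \<not> P p}" by auto
  then have "\<Prod>X = \<Prod>({p\<in>X. P p} \<union> {p\<in>X. \<not> P p})" by simp
  also have "\<dots> = \<Prod>{p\<in>X. P p} * \<Prod>{p\<in>X. \<not> P p}"
    using assms by (intro prod.union_disjoint) auto
  finally show ?thesis .
qed

lemma prod_primes_dvd:
  assumes "finite X" "\<And>p. p \<in> X \<Longrightarrow> prime (p::nat)" "\<And>p. p \<in> X \<Longrightarrow> p dvd a"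
  shows "\<Prod>X dvd a"
  using assms
proof (induction X rule: finite_induct)
  case (insert q X)
  then show ?case using coprime_prime_prod_primes[of X q] by (simp add: divides_mult)
qed simp

lemma gcd_prod_primes:
  assumes "finite X" "\<And>p. p \<in> X \<Longrightarrow> prime (p::nat)"
  shows "gcd a (\<Prod>X) = \<Prod>{p\<in>X. p dvd a}"
proof (rule dvd_antisym)
  have split: "\<Prod>X = \<Prod>{p\<in>X. p dvd a} * \<Prod>{p\<in>X. \<not> p dvd a}"
    by (rule prod_split[OF assms(1)])
  have "\<Prod>{p\<in>X. p dvd a} dvd a" using assms by (intro prod_primes_dvd) auto
  then show "\<Prod>{p\<in>X. p dvd a} dvd gcd a (\<Prod>X)" using split by simp
  have "coprime a (\<Prod>{p\<in>X. \<not> p dvd a})"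
  proof (rule prod_coprime_right)
    fix p assume "p \<in> {p\<in>X. \<not> p dvd a}"
    then show "coprime a p" using prime_imp_coprime[of p a] assms by (auto simp: coprime_commute)
  qed
  then have "coprime (gcd a (\<Prod>X)) (\<Prod>{p\<in>X. \<not> p dvd a})"
    by (meson coprime_divisors dvd_refl gcd_dvd1)
  moreover have "gcd a (\<Prod>X) dvd \<Prod>{p\<in>X. p dvd a} * \<Prod>{p\<in>X. \<not> p dvd a}"
    by (subst split[symmetric]) simp
  ultimately show "gcd a (\<Prod>X) dvd \<Prod>{p\<in>X. p dvd a}"
    by (simp add: coprime_dvd_mult_left_iff)
qed

lemma prod_primes_div:
  assumes "finite X" "\<And>p. p \<in> X \<Longrightarrow> prime (p::nat)"
  shows "\<Prod>X div \<Prod>{p\<in>X. P p} = \<Prod>{p\<in>X. \<not> P p}"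
proof -
  have "\<Prod>{p\<in>X. P p} \<noteq> 0" using assms by (intro prod_primes_nonzero) auto
  then show ?thesis using prod_split[OF assms(1), of P] by simp
qed

text \<open>For squarefree \<open>d\<close> the iterated gcds in the definition of \<open>h_fun\<close> collapse: \<open>gcd d1 d * G1 = gcd (d1 * \<delta>) d\<close>.\<close>

lemma iterated_gcd_prod_primes:
  assumes "finite X" "\<And>p. p \<in> X \<Longrightarrow> prime (p::nat)"
  shows "gcd e (\<Prod>X) * gcd \<delta> (\<Prod>X div gcd e (\<Prod>X)) = \<Prod>{p\<in>X. p dvd e * \<delta>}"
proof -
  let ?E = "{p\<in>X. \<not> p dvd e}"
  have "gcd e (\<Prod>X) * gcd \<delta> (\<Prod>X div gcd e (\<Prod>X)) = \<Prod>{p\<in>X. p dvd e} * gcd \<delta> (\<Prod>?E)"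
    by (simp only: gcd_prod_primes[OF assms] prod_primes_div[OF assms])
  also have "gcd \<delta> (\<Prod>?E) = \<Prod>{p\<in>?E. p dvd \<delta>}"
    using assms by (intro gcd_prod_primes) auto
  also have "\<Prod>{p\<in>X. p dvd e} * \<Prod>{p\<in>?E. p dvd \<delta>} = \<Prod>({p\<in>X. p dvd e} \<union> {p\<in>?E. p dvd \<delta>})"
    using assms by (intro prod.union_disjoint[symmetric]) auto
  also have "{p\<in>X. p dvd e} \<union> {p\<in>?E. p dvd \<delta>} = {p\<in>X. p dvd e * \<delta>}"
    using assms by (auto simp: prime_dvd_mult_iff)
  finally show ?thesis .
qed

section \<open>Factorization of the weights over the primes\<close>

definition factorizations4 :: "nat \<Rightarrow> (nat \<times> nat \<times> nat \<times> nat) set" where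
  "factorizations4 m = {(n, \<delta>, d1, d3). n \<ge> 1 \<and> \<delta> \<ge> 1 \<and> d1 \<ge> 1 \<and> d3 \<ge> 1 \<and> n * \<delta> * d1 * d3 = m}"

lemma factorizations4_le:
  assumes "(n, \<delta>, d1, d3) \<in> factorizations4 m"
  shows "n \<le> m \<and> \<delta> \<le> m \<and> d1 \<le> m \<and> d3 \<le> m"
proof -
  have m: "m \<ge> 1" "n * \<delta> * d1 * d3 = m" using assms by (auto simp: factorizations4_def Suc_le_eq)
  then have "n dvd m" "\<delta> dvd m" "d1 dvd m" "d3 dvd m" by auto
  then show ?thesis using m(1) by (auto intro!: dvd_imp_le)
qed

lemma finite_factorizations4: "finite (factorizations4 m)"
proof (rule finite_subset)
  show "factorizations4 m \<subseteq> {..m} \<times> {..m} \<times> {..m} \<times> {..m}"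
    using factorizations4_le by fastforce
qed simp

text \<open>The gcd condition is folded in as the value 0, so that the sum for \<open>h_fun\<close>
  runs over an index set independent of \<open>d2\<close> and \<open>d4\<close> and can be exchanged
  with the sum over them.\<close>

definition h_weight :: "nat \<Rightarrow> nat \<Rightarrow> nat \<Rightarrow> nat \<Rightarrow> nat \<Rightarrow> real" where
  "h_weight d2 d4 \<delta> d1 d3 =
     (let d = gcd d1 d2; D = gcd d3 d4; G1 = gcd \<delta> (d2 div d); G2 = gcd \<delta> (d4 div D)
      in if gcd (d2 div (d * G1)) (d4 div (D * G2)) = 1
         then real (d * D * G1 * G2) *
           (\<Prod>p \<in> prime_factors ((d2 * d4) div (d * D * G1 * G2)). inverse (1 + 1 / real p))
         else 0)"

lemma h_fun_eq:
  "h_fun d2 d4 m = (\<Sum>(n, \<delta>, d1, d3)\<in>factorizations4 m.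
     real n * of_int (moebius d1) * of_int (moebius d3) * h_weight d2 d4 \<delta> d1 d3)"
proof -
  let ?c = "\<lambda>(n::nat, \<delta>, d1, d3). let d = gcd d1 d2; D = gcd d3 d4; G1 = gcd \<delta> (d2 div d); G2 = gcd \<delta> (d4 div D)
           in gcd (d2 div (d * G1)) (d4 div (D * G2)) = 1"
  have "{(n, \<delta>, d1, d3). n \<ge> 1 \<and> \<delta> \<ge> 1 \<and> d1 \<ge> 1 \<and> d3 \<ge> 1 \<and> n * \<delta> * d1 * d3 = m \<and> ?c (n, \<delta>, d1, d3)}
     = {v \<in> factorizations4 m. ?c v}"
    by (auto simp: factorizations4_def)
  then show ?thesis
    unfolding h_fun_def prod.case
    by (simp only: sum.inter_filter[OF finite_factorizations4])
       (rule sum.cong; simp add: h_weight_def Let_def mult.assoc split: prod.split)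
qed

text \<open>Here \<open>x\<close>, \<open>y\<close>, \<open>A\<close>, \<open>B\<close> say whether \<open>p\<close> divides \<open>d2\<close>, \<open>d4\<close>, \<open>d1 \<delta>\<close>, \<open>d3 \<delta>\<close>.\<close>

definition euler_term :: "nat \<Rightarrow> bool \<Rightarrow> bool \<Rightarrow> bool \<Rightarrow> bool \<Rightarrow> real" where
  "euler_term p x y A B =
     (if x then (if A then real p else inverse (1 + 1 / real p)) * (- 1 / (real p * (real p - 1))) else 1) *
     (if y then (if B then real p else inverse (1 + 1 / real p)) * (- 1 / (real p * (real p - 1))) else 1) *
     (if x \<and> \<not> A \<and> y \<and> \<not> B then 0 else 1)"

definition g2_coeff :: "nat \<Rightarrow> nat \<Rightarrow> real" where
  "g2_coeff d2 d4 = of_int (moebius d2) * of_int (moebius d4) /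
     (real d2 * real d4 * real (totient d2) * real (totient d4))"

text \<open>Squarefreeness makes every ingredient local: a prime of \<open>d2\<close> contributes
  \<open>- 1 / (p (p - 1))\<close> from the Moebius and totient factors, times \<open>p\<close> if
  it divides \<open>d1 * \<delta>\<close> and \<open>1 / (1 + 1 / p)\<close> otherwise, and likewise
  for \<open>d4\<close>. The gcd condition says that no prime is of the second kind on both sides,
  which is the last factor of \<open>euler_term\<close>; it makes \<open>X0\<close> and
  \<open>Y0\<close> disjoint, so the product over their union splits.\<close>

lemma g2_coeff_h_weight_prod_primes:
  assumes S: "finite S" "\<And>p. p \<in> S \<Longrightarrow> prime p" and X: "X \<subseteq> S" and Y: "Y \<subseteq> S"
  shows "g2_coeff (\<Prod>X) (\<Prod>Y) * h_weight (\<Prod>X) (\<Prod>Y) \<delta> d1 d3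
    = (\<Prod>p\<in>S. euler_term p (p \<in> X) (p \<in> Y) (p dvd d1 * \<delta>) (p dvd d3 * \<delta>))"
proof -
  have fX: "finite X" "\<And>p. p \<in> X \<Longrightarrow> prime p" and fY: "finite Y" "\<And>p. p \<in> Y \<Longrightarrow> prime p"
    using S X Y by (auto intro: finite_subset)
  define X0 X1 where "X0 = {p\<in>X. \<not> p dvd d1 * \<delta>}" and "X1 = {p\<in>X. p dvd d1 * \<delta>}"
  define Y0 Y1 where "Y0 = {p\<in>Y. \<not> p dvd d3 * \<delta>}" and "Y1 = {p\<in>Y. p dvd d3 * \<delta>}"
  let ?d = "gcd d1 (\<Prod>X)" and ?D = "gcd d3 (\<Prod>Y)"
  let ?G1 = "gcd \<delta> (\<Prod>X div ?d)" and ?G2 = "gcd \<delta> (\<Prod>Y div ?D)"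
  let ?c = "\<lambda>p. - 1 / (real p * (real p - 1))"
  have dG: "?d * ?G1 = \<Prod>X1" "?D * ?G2 = \<Prod>Y1"
    unfolding X1_def Y1_def by (rule iterated_gcd_prod_primes; use fX fY in blast)+
  have dD: "?d * ?D * ?G1 * ?G2 = \<Prod>X1 * \<Prod>Y1"
    unfolding dG[symmetric] by (simp only: mult_ac)
  have q: "\<Prod>X div \<Prod>X1 = \<Prod>X0" "\<Prod>Y div \<Prod>Y1 = \<Prod>Y0"
    unfolding X0_def X1_def Y0_def Y1_def by (rule prod_primes_div; use fX fY in blast)+
  have f0: "finite X0" "\<And>p. p \<in> X0 \<Longrightarrow> prime p" "finite Y0" "\<And>p. p \<in> Y0 \<Longrightarrow> prime p"
    "finite X1" "\<And>p. p \<in> X1 \<Longrightarrow> prime p" "finite Y1" "\<And>p. p \<in> Y1 \<Longrightarrow> prime p"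
    using fX fY by (auto simp: X0_def Y0_def X1_def Y1_def)
  have nz: "\<Prod>X0 \<noteq> 0" "\<Prod>X1 \<noteq> 0" "\<Prod>Y0 \<noteq> 0" "\<Prod>Y1 \<noteq> 0"
    using f0 prod_primes_nonzero by blast+
  have spl: "\<Prod>X = \<Prod>X1 * \<Prod>X0" "\<Prod>Y = \<Prod>Y1 * \<Prod>Y0"
    unfolding X0_def X1_def Y0_def Y1_def by (rule prod_split; use fX fY in blast)+
  have qq: "(\<Prod>X * \<Prod>Y) div (\<Prod>X1 * \<Prod>Y1) = \<Prod>X0 * \<Prod>Y0"
  proof -
    have "\<Prod>X * \<Prod>Y = (\<Prod>X0 * \<Prod>Y0) * (\<Prod>X1 * \<Prod>Y1)" unfolding spl by (simp only: mult_ac)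
    then show ?thesis using nz by simp
  qed
  have pf: "prime_factors (\<Prod>X0 * \<Prod>Y0) = X0 \<union> Y0"
    using nz f0 by (simp add: prime_factors_product prime_factors_prod_primes)
  have cond: "gcd (\<Prod>X0) (\<Prod>Y0) = 1 \<longleftrightarrow> X0 \<inter> Y0 = {}"
  proof
    assume g: "gcd (\<Prod>X0) (\<Prod>Y0) = 1"
    show "X0 \<inter> Y0 = {}"
    proof (rule ccontr)
      assume "X0 \<inter> Y0 \<noteq> {}"
      then obtain p where p: "p \<in> X0" "p \<in> Y0" by auto
      then have "p dvd \<Prod>X0" "p dvd \<Prod>Y0" using f0 by (auto intro: dvd_prodI)
      then have "p dvd 1" using g by (metis gcd_greatest)
      then show False using f0(2)[OF p(1)] by auto
    qed
  next
    assume "X0 \<inter> Y0 = {}"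
    then have "coprime (\<Prod>X0) (\<Prod>Y0)"
      using f0 by (intro prod_coprime_left coprime_prime_prod_primes) auto
    then show "gcd (\<Prod>X0) (\<Prod>Y0) = 1" by (rule coprime_imp_gcd_eq_1)
  qed
  have w: "h_weight (\<Prod>X) (\<Prod>Y) \<delta> d1 d3 = (if X0 \<inter> Y0 = {} then real (\<Prod>X1 * \<Prod>Y1) * (\<Prod>p\<in>X0 \<union> Y0. inverse (1 + 1 / real p)) else 0)"
    unfolding h_weight_def Let_def dD unfolding dG q qq pf cond ..
  have part: "(\<Prod>p\<in>S. if p \<in> Z then g p else (1::real)) = (\<Prod>p\<in>Z. g p)" if "Z \<subseteq> S" for Z g
    using S(1) that by (rule prod.mono_neutral_cong_right) auto
  show ?thesis
  proof (cases "X0 \<inter> Y0 = {}")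
    case False
    then obtain p where p: "p \<in> X" "p \<in> Y" "\<not> p dvd d1 * \<delta>" "\<not> p dvd d3 * \<delta>" by (auto simp: X0_def Y0_def)
    then have "euler_term p (p \<in> X) (p \<in> Y) (p dvd d1 * \<delta>) (p dvd d3 * \<delta>) = 0" by (simp add: euler_term_def)
    then have "(\<Prod>p\<in>S. euler_term p (p \<in> X) (p \<in> Y) (p dvd d1 * \<delta>) (p dvd d3 * \<delta>)) = 0"
      using p(1) X S(1) by (intro prod_zero[OF S(1)] bexI[of _ p]) auto
    then show ?thesis using False by (simp add: w)
  next
    case True
    have coef: "of_int (moebius (\<Prod>Z)) / (real (\<Prod>Z) * real (totient (\<Prod>Z))) = (\<Prod>p\<in>Z. ?c p)"
      if Z: "finite Z" "\<And>p. p \<in> Z \<Longrightarrow> prime p" for Z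
      by (simp only: moebius_prod_primes[OF Z] totient_prod_primes[OF Z] prod_dividef prod.distrib prod_constant
          of_nat_prod of_int_power of_int_minus of_int_1)
    have half: "real (\<Prod>{p\<in>Z. p dvd a}) * (\<Prod>p\<in>{p\<in>Z. \<not> p dvd a}. inverse (1 + 1 / real p)) * (\<Prod>p\<in>Z. ?c p)
       = (\<Prod>p\<in>Z. (if p dvd a then real p else inverse (1 + 1 / real p)) * ?c p)" if "finite Z" for Z a
    proof -
      have "(\<Prod>p\<in>Z. if p dvd a then real p else inverse (1 + 1 / real p))
          = real (\<Prod>{p\<in>Z. p dvd a}) * (\<Prod>p\<in>{p\<in>Z. \<not> p dvd a}. inverse (1 + 1 / real p))"
        using that by (simp add: prod.If_cases Int_def)
      then show ?thesis by (simp only: prod.distrib)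
    qed
    have "g2_coeff (\<Prod>X) (\<Prod>Y) = (of_int (moebius (\<Prod>X)) / (real (\<Prod>X) * real (totient (\<Prod>X))))
       * (of_int (moebius (\<Prod>Y)) / (real (\<Prod>Y) * real (totient (\<Prod>Y))))"
      unfolding g2_coeff_def by (simp add: mult_ac)
    also have "\<dots> = (\<Prod>p\<in>X. ?c p) * (\<Prod>p\<in>Y. ?c p)" using coef fX fY by (simp only: coef)
    finally have "g2_coeff (\<Prod>X) (\<Prod>Y) * h_weight (\<Prod>X) (\<Prod>Y) \<delta> d1 d3
       = (real (\<Prod>X1) * (\<Prod>p\<in>X0. inverse (1 + 1 / real p)) * (\<Prod>p\<in>X. ?c p))
        * (real (\<Prod>Y1) * (\<Prod>p\<in>Y0. inverse (1 + 1 / real p)) * (\<Prod>p\<in>Y. ?c p))"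
      using True f0 by (simp add: w prod.union_disjoint mult_ac)
    also have "\<dots> = (\<Prod>p\<in>X. (if p dvd d1 * \<delta> then real p else inverse (1 + 1 / real p)) * ?c p)
       * (\<Prod>p\<in>Y. (if p dvd d3 * \<delta> then real p else inverse (1 + 1 / real p)) * ?c p)"
      unfolding X0_def X1_def Y0_def Y1_def by (simp only: half[OF fX(1)] half[OF fY(1)])
    also have "\<dots> = (\<Prod>p\<in>S. euler_term p (p \<in> X) (p \<in> Y) (p dvd d1 * \<delta>) (p dvd d3 * \<delta>))"
      unfolding part[OF X, symmetric] part[OF Y, symmetric] prod.distrib[symmetric]
    proof (rule prod.cong)
      fix p assume "p \<in> S"
      have "\<not> (p \<in> X \<and> \<not> p dvd d1 * \<delta> \<and> p \<in> Y \<and> \<not> p dvd d3 * \<delta>)"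
        using True by (auto simp: X0_def Y0_def)
      then show "(if p \<in> X then (if p dvd d1 * \<delta> then real p else inverse (1 + 1 / real p)) * ?c p else 1) *
         (if p \<in> Y then (if p dvd d3 * \<delta> then real p else inverse (1 + 1 / real p)) * ?c p else 1)
         = euler_term p (p \<in> X) (p \<in> Y) (p dvd d1 * \<delta>) (p dvd d3 * \<delta>)"
        unfolding euler_term_def by (simp only: if_False mult_1_right)
    qed simp
    finally show ?thesis .
  qed
qed

text \<open>Multiplying out the right side, one chooses for each \<open>p\<close> whether it belongs
  to \<open>X\<close> and whether it belongs to \<open>Y\<close>.\<close>

lemma sum_Pow_Pow_prod:
  fixes t :: "'a \<Rightarrow> bool \<Rightarrow> bool \<Rightarrow> real"
  assumes "finite S"
  shows "(\<Sum>X\<in>Pow S. \<Sum>Y\<in>Pow S. \<Prod>p\<in>S. t p (p \<in> X) (p \<in> Y))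
    = (\<Prod>p\<in>S. t p False False + t p False True + t p True False + t p True True)"
  using assms
proof (induction S rule: finite_induct)
  case (insert q S)
  have dis: "Pow S \<inter> insert q ` Pow S = {}" using insert by auto
  have inj: "inj_on (insert q) (Pow S)" using insert by (auto simp: inj_on_def)
  have split: "(\<Sum>X\<in>Pow (insert q S). f X) = (\<Sum>X\<in>Pow S. f X + f (insert q X))" for f :: "'a set \<Rightarrow> real"
  proof -
    have "(\<Sum>X\<in>Pow (insert q S). f X) = (\<Sum>X\<in>Pow S. f X) + (\<Sum>X\<in>insert q ` Pow S. f X)"
      unfolding Pow_insert using insert(1) dis by (intro sum.union_disjoint) auto
    also have "(\<Sum>X\<in>insert q ` Pow S. f X) = (\<Sum>X\<in>Pow S. f (insert q X))"
      by (simp only: sum.reindex[OF inj] o_def)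
    finally show ?thesis by (simp only: sum.distrib)
  qed
  have cong: "(\<Prod>p\<in>insert q S. t p (p \<in> X') (p \<in> Y')) = t q (q \<in> X') (q \<in> Y') * (\<Prod>p\<in>S. t p (p \<in> X) (p \<in> Y))"
    if "X' - {q} = X" "Y' - {q} = Y" "q \<notin> X" "q \<notin> Y" for X X' Y Y'
  proof -
    have "(\<Prod>p\<in>S. t p (p \<in> X') (p \<in> Y')) = (\<Prod>p\<in>S. t p (p \<in> X) (p \<in> Y))"
    proof (intro prod.cong refl)
      fix p assume "p \<in> S"
      then have "p \<noteq> q" using insert by auto
      then have "p \<in> X' \<longleftrightarrow> p \<in> X" "p \<in> Y' \<longleftrightarrow> p \<in> Y" using that(1,2) by auto
      then show "t p (p \<in> X') (p \<in> Y') = t p (p \<in> X) (p \<in> Y)" by (simp only:)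
    qed
    then show ?thesis using insert by simp
  qed
  have "(\<Sum>X\<in>Pow (insert q S). \<Sum>Y\<in>Pow (insert q S). \<Prod>p\<in>insert q S. t p (p \<in> X) (p \<in> Y))
      = (\<Sum>X\<in>Pow S. \<Sum>Y\<in>Pow S. (t q False False + t q False True + t q True False + t q True True) * (\<Prod>p\<in>S. t p (p \<in> X) (p \<in> Y)))"
    unfolding split sum.distrib[symmetric]
  proof (intro sum.cong refl)
    fix X Y assume XY: "X \<in> Pow S" "Y \<in> Pow S"
    then have q: "q \<notin> X" "q \<notin> Y" using insert by auto
    show "(\<Prod>p\<in>insert q S. t p (p \<in> X) (p \<in> Y)) + (\<Prod>p\<in>insert q S. t p (p \<in> X) (p \<in> insert q Y)) +
       ((\<Prod>p\<in>insert q S. t p (p \<in> insert q X) (p \<in> Y)) + (\<Prod>p\<in>insert q S. t p (p \<in> insert q X) (p \<in> insert q Y)))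
       = (t q False False + t q False True + t q True False + t q True True) * (\<Prod>p\<in>S. t p (p \<in> X) (p \<in> Y))"
      using q by (subst (1 2 3 4) cong[of _ X _ Y]) (auto simp: algebra_simps)
  qed
  then show ?case using insert by (simp add: sum_distrib_left[symmetric])
qed simp

section \<open>Sums over factorizations of \<open>m\<close>, one prime at a time\<close>

lemma moebius_prime_power_mult:
  assumes p: "prime p" "\<not> p dvd d" and d: "d \<ge> 1"
  shows "moebius (p ^ e * d) = (if e = 0 then 1 else if e = 1 then - 1 else 0) * moebius d"
proof -
  consider "e = 0" | "e = 1" | "e \<ge> 2" by linarith
  then show ?thesis
  proof cases
    case 2
    have cop: "coprime p d" using p by (rule prime_imp_coprime)
    have "squarefree (p * d) \<longleftrightarrow> squarefree d"
      using cop p by (auto simp: squarefree_prime intro: squarefree_mult_coprime dest: squarefree_multD)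
    moreover have "prime_factors (p * d) = insert p (prime_factors d)"
      using p d by (subst prime_factors_product) (auto simp: prime_factorization_prime)
    moreover have "p \<notin> prime_factors d" using p by auto
    ultimately show ?thesis using 2 by (simp add: moebius_def)
  next
    case 3
    have "p\<^sup>2 dvd p ^ e * d" using 3 by (simp add: le_imp_power_dvd)
    then have "\<not> squarefree (p ^ e * d)" using p by (auto simp: squarefree_def)
    then show ?thesis using 3 by (simp add: moebius_def)
  qed simp
qed

lemma prime_power_mult_unique:
  fixes p x y :: nat
  assumes "p > 0" "\<not> p dvd x" "\<not> p dvd y" "p ^ i * x = p ^ j * y"
  shows "i = j \<and> x = y"
proof -
  have *: False if "i < j" "\<not> p dvd x" "p ^ i * x = p ^ j * y" for i j x y
  proof -
    have "p ^ i * x = p ^ i * (p ^ (j - i) * y)" using that by (simp add: power_add[symmetric] mult.assoc[symmetric])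
    then have "x = p ^ (j - i) * y" using assms(1) by simp
    moreover have "p dvd p ^ (j - i)" using that by (simp add: dvd_power)
    ultimately show False using that by (simp add: dvd_mult2)
  qed
  have "i = j" using *[of i j x y] *[of j i y x] assms by (metis linorder_neqE_nat)
  then show ?thesis using assms by simp
qed

text \<open>The exponents of one prime in \<open>n\<close>, \<open>\<delta>\<close>,
  \<open>d1\<close>, \<open>d3\<close> when its exponent in \<open>m\<close> is
  \<open>v\<close>.\<close>

definition compositions4 :: "nat \<Rightarrow> (nat \<times> nat \<times> nat \<times> nat) set" where
  "compositions4 v = {(a, b, e, f). a + b + e + f = v}"

lemma finite_compositions4: "finite (compositions4 v)"
  by (rule finite_subset[of _ "{..v} \<times> {..v} \<times> {..v} \<times> {..v}"]) (auto simp: compositions4_def)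

text \<open>Only \<open>e, f \<le> 1\<close> contribute, which leaves four families indexed by
  \<open>a\<close>. For \<open>a + 2 \<le> v\<close> all of them carry \<open>E True True\<close>,
  with signs \<open>1 - 1 - 1 + 1\<close>, so only \<open>a = v\<close> and \<open>a = v - 1\<close>
  survive.\<close>

lemma sum_compositions4:
  fixes P :: real and E :: "bool \<Rightarrow> bool \<Rightarrow> real"
  defines "\<mu> \<equiv> \<lambda>e::nat. if e = 0 then 1 else if e = 1 then - 1 else (0::real)"
  shows "(\<Sum>(a, b, e, f)\<in>compositions4 v. P ^ a * \<mu> e * \<mu> f * E (b + e > 0) (b + f > 0))
    = P ^ v * E False False + (if v = 0 then 0 else P ^ (v - 1) * (E True True - E True False - E False True))"
proof -
  let ?g = "\<lambda>(a, b, e, f). P ^ a * \<mu> e * \<mu> f * E (b + e > 0) (b + f > 0)"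
  define A00 where "A00 = (\<lambda>a. (a, v - a, 0::nat, 0::nat)) ` {..v}"
  define A10 where "A10 = (\<lambda>a. (a, v - 1 - a, 1::nat, 0::nat)) ` {..<v}"
  define A01 where "A01 = (\<lambda>a. (a, v - 1 - a, 0::nat, 1::nat)) ` {..<v}"
  define A11 where "A11 = (\<lambda>a. (a, v - 2 - a, 1::nat, 1::nat)) ` {..<v - 1}"
  have "sum ?g (compositions4 v) = sum ?g (A00 \<union> A10 \<union> (A01 \<union> A11))"
  proof (rule sum.mono_neutral_right[OF finite_compositions4])
    show "A00 \<union> A10 \<union> (A01 \<union> A11) \<subseteq> compositions4 v"
      by (auto simp: compositions4_def A00_def A10_def A01_def A11_def)
    show "\<forall>i\<in>compositions4 v - (A00 \<union> A10 \<union> (A01 \<union> A11)). ?g i = 0"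
    proof
      fix i assume i: "i \<in> compositions4 v - (A00 \<union> A10 \<union> (A01 \<union> A11))"
      obtain a b e f where [simp]: "i = (a, b, e, f)" by (metis prod.exhaust)
      have s: "a + b + e + f = v" using i by (simp add: compositions4_def)
      have "i \<in> A00" if "e = 0" "f = 0" using s that by (auto simp: A00_def image_iff)
      moreover have "i \<in> A10" if "e = 1" "f = 0" using s that by (auto simp: A10_def image_iff)
      moreover have "i \<in> A01" if "e = 0" "f = 1" using s that by (auto simp: A01_def image_iff)
      moreover have "i \<in> A11" if "e = 1" "f = 1" using s that by (auto simp: A11_def image_iff)
      ultimately have "e \<ge> 2 \<or> f \<ge> 2" using i by (metis DiffE UnCI less_2_cases not_less One_nat_def)
      then show "?g i = 0" by (auto simp: \<mu>_def)
    qed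
  qed
  also have "\<dots> = (sum ?g A00 + sum ?g A10) + (sum ?g A01 + sum ?g A11)"
  proof -
    have fin: "finite A00" "finite A10" "finite A01" "finite A11"
      by (simp_all add: A00_def A10_def A01_def A11_def)
    have "A00 \<inter> A10 = {}" "A01 \<inter> A11 = {}" "(A00 \<union> A10) \<inter> (A01 \<union> A11) = {}"
      by (auto simp: A00_def A10_def A01_def A11_def)
    then show ?thesis using fin by (simp only: sum.union_disjoint finite_Un simp_thms)
  qed
  also have "sum ?g A00 = (\<Sum>a\<le>v. P ^ a * E (a < v) (a < v))"
    unfolding A00_def by (subst sum.reindex) (auto simp: inj_on_def \<mu>_def intro!: sum.cong)
  also have "sum ?g A10 = (\<Sum>a<v. - (P ^ a * E True (a < v - 1)))"
    unfolding A10_def by (subst sum.reindex) (auto simp: inj_on_def \<mu>_def less_diff_conv intro!: sum.cong)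
  also have "sum ?g A01 = (\<Sum>a<v. - (P ^ a * E (a < v - 1) True))"
    unfolding A01_def by (subst sum.reindex) (auto simp: inj_on_def \<mu>_def less_diff_conv intro!: sum.cong)
  also have "sum ?g A11 = (\<Sum>a<v - 1. P ^ a * E True True)"
    unfolding A11_def by (subst sum.reindex) (auto simp: inj_on_def \<mu>_def intro!: sum.cong)
  also have "(\<Sum>a\<le>v. P ^ a * E (a < v) (a < v)) + (\<Sum>a<v. - (P ^ a * E True (a < v - 1))) +
      ((\<Sum>a<v. - (P ^ a * E (a < v - 1) True)) + (\<Sum>a<v - 1. P ^ a * E True True))
    = P ^ v * E False False + (if v = 0 then 0 else P ^ (v - 1) * (E True True - E True False - E False True))"
  proof (cases v)
    case (Suc w)
    have 1: "(\<Sum>a\<le>v. P ^ a * E (a < v) (a < v)) = (\<Sum>a<v. P ^ a * E True True) + P ^ v * E False False"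
      by (simp add: lessThan_Suc_atMost[symmetric])
    have 2: "(\<Sum>a<Suc w. - (P ^ a * F (a < w))) = - (\<Sum>a<w. P ^ a * F True) - P ^ w * F False" for F :: "bool \<Rightarrow> real"
      by (simp add: sum_negf)
    have 3: "(\<Sum>a<Suc w. P ^ a * E True True) = (\<Sum>a<w. P ^ a * E True True) + P ^ w * E True True" by simp
    show ?thesis
      using 1 2[of "E True"] 2[of "\<lambda>x. E x True"] 3 unfolding Suc by (simp add: algebra_simps)
  qed simp
  finally show ?thesis .
qed

lemma sum_factorizations4_prime_power:
  fixes g :: "nat \<times> nat \<times> nat \<times> nat \<Rightarrow> real"
  assumes p: "prime p" "\<not> p dvd m"
  shows "(\<Sum>u\<in>factorizations4 (p ^ v * m). g u)
    = (\<Sum>((a, b, e, f), (n, \<delta>, d1, d3))\<in>compositions4 v \<times> factorizations4 m.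
        g (p ^ a * n, p ^ b * \<delta>, p ^ e * d1, p ^ f * d3))"
proof -
  let ?\<phi> = "\<lambda>((a, b, e, f), (n, \<delta>, d1, d3)). (p ^ a * n, p ^ b * \<delta>, p ^ e * d1, p ^ f * d3)"
  have p0: "p > 0" using p by (simp add: prime_gt_0_nat)
  have m0: "m \<ge> 1" using p by (cases m) auto
  have ndvd: "\<not> p dvd n \<and> \<not> p dvd \<delta> \<and> \<not> p dvd d1 \<and> \<not> p dvd d3" if "(n, \<delta>, d1, d3) \<in> factorizations4 m" for n \<delta> d1 d3
  proof -
    have "n * \<delta> * d1 * d3 = m" using that by (simp add: factorizations4_def)
    then show ?thesis using p(2) by (auto intro: dvd_mult dvd_mult2)
  qed
  have inj: "inj_on ?\<phi> (compositions4 v \<times> factorizations4 m)"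
  proof (rule inj_onI, clarsimp, goal_cases)
    case (1 a b e f n \<delta> d1 d3 a' b' e' f' n' \<delta>' d1' d3')
    then show ?case
      using ndvd[of n \<delta> d1 d3] ndvd[of n' \<delta>' d1' d3'] prime_power_mult_unique[OF p0] by metis
  qed
  have img: "?\<phi> ` (compositions4 v \<times> factorizations4 m) = factorizations4 (p ^ v * m)"
  proof (intro equalityI subsetI)
    fix u assume "u \<in> ?\<phi> ` (compositions4 v \<times> factorizations4 m)"
    then obtain a b e f n \<delta> d1 d3 where u: "u = (p ^ a * n, p ^ b * \<delta>, p ^ e * d1, p ^ f * d3)"
      and s: "a + b + e + f = v" and q: "(n, \<delta>, d1, d3) \<in> factorizations4 m"
      by (auto simp: compositions4_def)
    have "p ^ a * n * (p ^ b * \<delta>) * (p ^ e * d1) * (p ^ f * d3) = p ^ (a + b + e + f) * (n * \<delta> * d1 * d3)"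
      by (simp only: power_add mult_ac)
    then show "u \<in> factorizations4 (p ^ v * m)" using u s q p0 by (auto simp: factorizations4_def Suc_le_eq)
  next
    fix u assume "u \<in> factorizations4 (p ^ v * m)"
    then obtain N \<Delta> D1 D3 where u: "u = (N, \<Delta>, D1, D3)" "N \<ge> 1" "\<Delta> \<ge> 1" "D1 \<ge> 1" "D3 \<ge> 1"
      and prd: "N * \<Delta> * D1 * D3 = p ^ v * m" by (auto simp: factorizations4_def)
    have dec: "\<exists>i x. k = p ^ i * x \<and> \<not> p dvd x" if "k \<ge> 1" for k
    proof -
      have "k \<noteq> 0" "\<not> is_unit p" using that p(1) by auto
      then obtain x where "k = p ^ multiplicity p k * x" "\<not> p dvd x" by (rule multiplicity_decompose')
      then show ?thesis by blast
    qed
    obtain a n where n: "N = p ^ a * n" "\<not> p dvd n" using dec[OF u(2)] by blast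
    obtain b \<delta> where \<delta>: "\<Delta> = p ^ b * \<delta>" "\<not> p dvd \<delta>" using dec[OF u(3)] by blast
    obtain e d1 where d1: "D1 = p ^ e * d1" "\<not> p dvd d1" using dec[OF u(4)] by blast
    obtain f d3 where d3: "D3 = p ^ f * d3" "\<not> p dvd d3" using dec[OF u(5)] by blast
    have "p ^ (a + b + e + f) * (n * \<delta> * d1 * d3) = N * \<Delta> * D1 * D3"
      unfolding n(1) \<delta>(1) d1(1) d3(1) by (simp only: power_add mult_ac)
    also have "\<dots> = p ^ v * m" by (rule prd)
    finally have eq: "p ^ (a + b + e + f) * (n * \<delta> * d1 * d3) = p ^ v * m" .
    have "\<not> p dvd n * \<delta> * d1 * d3" using n \<delta> d1 d3 p by (simp add: prime_dvd_mult_iff)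
    with eq p have "a + b + e + f = v \<and> n * \<delta> * d1 * d3 = m"
      by (intro prime_power_mult_unique[OF p0]) auto
    moreover have "n \<ge> 1" "\<delta> \<ge> 1" "d1 \<ge> 1" "d3 \<ge> 1" using n \<delta> d1 d3 by (auto simp: Suc_le_eq intro!: Nat.gr0I)
    ultimately have "((a, b, e, f), (n, \<delta>, d1, d3)) \<in> compositions4 v \<times> factorizations4 m"
      by (auto simp: compositions4_def factorizations4_def)
    moreover have "u = ?\<phi> ((a, b, e, f), (n, \<delta>, d1, d3))" using u n \<delta> d1 d3 by simp
    ultimately show "u \<in> ?\<phi> ` (compositions4 v \<times> factorizations4 m)" by (metis (no_types, lifting) imageI)
  qed
  show ?thesis unfolding img[symmetric]
    by (subst sum.reindex[OF inj]) (auto intro!: sum.cong)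
qed

text \<open>The value found in \<open>sum_compositions4\<close> for \<open>P = p\<close>: the Euler
  factor at a prime of exponent \<open>v\<close> in \<open>m\<close>.\<close>

definition local_sum :: "(nat \<Rightarrow> bool \<Rightarrow> bool \<Rightarrow> real) \<Rightarrow> nat \<Rightarrow> nat \<Rightarrow> real" where
  "local_sum E p v = real p ^ v * E p False False +
     (if v = 0 then 0 else real p ^ (v - 1) * (E p True True - E p True False - E p False True))"

text \<open>Splitting off the powers of one prime \<open>q\<close> of \<open>S\<close> leaves a sum
  of the same kind for the part of \<open>m\<close> prime to \<open>q\<close>: the factor at
  \<open>q\<close> sees only the exponents of \<open>q\<close>, and the other factors do not see
  them. A prime of \<open>S\<close> that does not divide \<open>m\<close> contributes
  \<open>E p False False\<close>.\<close>

lemma sum_factorizations4_euler: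
  fixes E :: "nat \<Rightarrow> bool \<Rightarrow> bool \<Rightarrow> real"
  assumes "finite S" "\<And>p. p \<in> S \<Longrightarrow> prime p" "m \<ge> 1" "prime_factors m \<subseteq> S"
  shows "(\<Sum>(n, \<delta>, d1, d3)\<in>factorizations4 m. real n * of_int (moebius d1) * of_int (moebius d3) *
            (\<Prod>p\<in>S. E p (p dvd d1 * \<delta>) (p dvd d3 * \<delta>)))
       = (\<Prod>p\<in>S. local_sum E p (multiplicity p m))"
  using assms
proof (induction S arbitrary: m rule: finite_induct)
  case empty
  have "m = 1"
  proof (rule ccontr)
    assume "m \<noteq> 1"
    then obtain p where "prime p" "p dvd m" using prime_factor_nat by blast
    moreover have "m \<noteq> 0" using empty.prems(2) by simp
    ultimately have "p \<in> prime_factors m" by (simp add: in_prime_factors_iff)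
    then show False using empty.prems(3) by blast
  qed
  moreover have "factorizations4 1 = {(1, 1, 1, 1)}" by (auto simp: factorizations4_def)
  ultimately show ?case by (simp add: moebius_def)
next
  case (insert q S)
  let ?\<mu> = "\<lambda>e::nat. if e = 0 then 1 else if e = 1 then - 1 else (0::real)"
  define v where "v = multiplicity q m"
  have q: "prime q" using insert by auto
  have "m \<noteq> 0" "\<not> is_unit q" using insert(5) q by auto
  then obtain m' where m': "m = q ^ v * m'" "\<not> q dvd m'"
    unfolding v_def by (rule multiplicity_decompose')
  have m'1: "m' \<ge> 1" using m' by (cases m') auto
  have pf: "prime_factors m' \<subseteq> S"
  proof
    fix p assume p: "p \<in> prime_factors m'"
    then have "p \<in> prime_factors m" using m'(1) \<open>m \<noteq> 0\<close> by (simp add: in_prime_factors_iff)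
    then show "p \<in> S" using insert(6) p m'(2) by auto
  qed
  have mult: "multiplicity p m = multiplicity p m'" if "p \<in> S" for p
  proof -
    have p: "prime p" "p \<noteq> q" using that insert by auto
    have "multiplicity p m = multiplicity p (q ^ v) + multiplicity p m'"
      unfolding m'(1) using p q m'1 by (intro prime_elem_multiplicity_mult_distrib) auto
    then show ?thesis using p q by (simp add: prime_multiplicity_other prime_elem_multiplicity_power_distrib)
  qed
  have IH: "(\<Sum>(n, \<delta>, d1, d3)\<in>factorizations4 m'. real n * of_int (moebius d1) * of_int (moebius d3) *
            (\<Prod>p\<in>S. E p (p dvd d1 * \<delta>) (p dvd d3 * \<delta>))) = (\<Prod>p\<in>S. local_sum E p (multiplicity p m'))"
    using insert m'1 pf by auto
  let ?G = "\<lambda>(a, b, e, f). real q ^ a * ?\<mu> e * ?\<mu> f * E q (b + e > 0) (b + f > 0)"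
  let ?H = "\<lambda>(n, \<delta>, d1, d3). real n * of_int (moebius d1) * of_int (moebius d3) * (\<Prod>p\<in>S. E p (p dvd d1 * \<delta>) (p dvd d3 * \<delta>))"
  have term_eq: "real (q ^ a * n) * of_int (moebius (q ^ e * d1)) * of_int (moebius (q ^ f * d3)) *
            (\<Prod>p\<in>insert q S. E p (p dvd (q ^ e * d1) * (q ^ b * \<delta>)) (p dvd (q ^ f * d3) * (q ^ b * \<delta>)))
       = ?G (a, b, e, f) * ?H (n, \<delta>, d1, d3)"
    if t: "(n, \<delta>, d1, d3) \<in> factorizations4 m'" for a b e f n \<delta> d1 d3
  proof -
    have eqm: "n * \<delta> * d1 * d3 = m'" "d1 \<ge> 1" "d3 \<ge> 1" using t by (auto simp: factorizations4_def)
    then have nd: "\<not> q dvd \<delta>" "\<not> q dvd d1" "\<not> q dvd d3" using m'(2) by (auto intro: dvd_mult dvd_mult2)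
    have qd: "q dvd (q ^ e * d1) * (q ^ b * \<delta>) \<longleftrightarrow> b + e > 0" "q dvd (q ^ f * d3) * (q ^ b * \<delta>) \<longleftrightarrow> b + f > 0"
    proof -
      have "q dvd q ^ i \<longleftrightarrow> i > 0" for i using q by (cases i) auto
      then show "q dvd (q ^ e * d1) * (q ^ b * \<delta>) \<longleftrightarrow> b + e > 0" "q dvd (q ^ f * d3) * (q ^ b * \<delta>) \<longleftrightarrow> b + f > 0"
        using nd q by (auto simp: prime_dvd_mult_iff)
    qed
    have pd: "p dvd (q ^ e * c) * (q ^ b * \<delta>) \<longleftrightarrow> p dvd c * \<delta>" if "p \<in> S" for p c e
    proof -
      have p: "prime p" "p \<noteq> q" using that insert by auto
      then have "\<not> p dvd q ^ i" for i using q by (metis prime_dvd_power primes_dvd_imp_eq)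
      then show ?thesis using p by (simp add: prime_dvd_mult_iff)
    qed
    have "(\<Prod>p\<in>insert q S. E p (p dvd (q ^ e * d1) * (q ^ b * \<delta>)) (p dvd (q ^ f * d3) * (q ^ b * \<delta>)))
       = E q (b + e > 0) (b + f > 0) * (\<Prod>p\<in>S. E p (p dvd d1 * \<delta>) (p dvd d3 * \<delta>))"
      by (simp only: prod.insert[OF insert(1,2)] qd) (simp add: pd cong: prod.cong)
    then show ?thesis
      by (simp only: moebius_prime_power_mult[OF q nd(2) eqm(2)] moebius_prime_power_mult[OF q nd(3) eqm(3)] prod.case)
        (simp add: mult_ac)
  qed
  have "(\<Sum>(n, \<delta>, d1, d3)\<in>factorizations4 m. real n * of_int (moebius d1) * of_int (moebius d3) *
            (\<Prod>p\<in>insert q S. E p (p dvd d1 * \<delta>) (p dvd d3 * \<delta>)))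
     = (\<Sum>(s, t)\<in>compositions4 v \<times> factorizations4 m'. ?G s * ?H t)"
    unfolding m'(1) sum_factorizations4_prime_power[OF q m'(2)]
    by (intro sum.cong refl) (use term_eq in auto)
  also have "\<dots> = sum ?G (compositions4 v) * sum ?H (factorizations4 m')"
    by (simp only: sum_product sum.cartesian_product)
  also have "sum ?G (compositions4 v) = local_sum E q v"
    unfolding local_sum_def by (rule sum_compositions4)
  also have "sum ?H (factorizations4 m') = (\<Prod>p\<in>S. local_sum E p (multiplicity p m'))" by (rule IH)
  finally show ?case using insert(1,2) mult by (simp add: v_def)
qed

section \<open>The sum over the residues \<open>k\<close> as an Euler product\<close>

lemma card_residue_class:
  fixes r D a :: int
  assumes "r > 0" "D > 0" "D dvd r"
  shows "finite {k. 0 \<le> k \<and> k < r \<and> [k = a] (mod D)}"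
    and "real (card {k. 0 \<le> k \<and> k < r \<and> [k = a] (mod D)}) = real_of_int r / real_of_int D"
proof -
  obtain s where s: "r = D * s" using assms by blast
  have s0: "s > 0" using assms s by (simp add: zero_less_mult_iff)
  have eq: "{k. 0 \<le> k \<and> k < r \<and> [k = a] (mod D)} = (\<lambda>j. a mod D + D * j) ` {0..<s}"
  proof (intro equalityI subsetI)
    fix k assume k: "k \<in> {k. 0 \<le> k \<and> k < r \<and> [k = a] (mod D)}"
    have "k = a mod D + D * (k div D)" using k by (simp add: cong_def) (metis mod_mult_div_eq)
    moreover have "0 \<le> k div D" using k assms by (simp add: pos_imp_zdiv_nonneg_iff)
    moreover have "k div D < s"
    proof (rule ccontr)
      assume "\<not> k div D < s"
      then have "D * s \<le> D * (k div D)" using assms by (intro mult_left_mono) auto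
      also have "\<dots> \<le> k" using mult_div_mod_eq[of D k] pos_mod_sign[OF assms(2), of k] by linarith
      finally show False using k s by simp
    qed
    ultimately show "k \<in> (\<lambda>j. a mod D + D * j) ` {0..<s}" by auto
  next
    fix k assume "k \<in> (\<lambda>j. a mod D + D * j) ` {0..<s}"
    then obtain j where j: "k = a mod D + D * j" "0 \<le> j" "j < s"
      by (metis (no_types, lifting) atLeastLessThan_iff imageE)
    have "D * j \<le> D * (s - 1)" using j assms by (intro mult_left_mono) auto
    moreover have "a mod D < D" "0 \<le> a mod D" "0 \<le> D * j" using assms j by auto
    moreover have "D * (s - 1) = D * s - D" by (simp add: algebra_simps)
    ultimately have "k < r" "0 \<le> k" using j(1) s by linarith+
    then show "k \<in> {k. 0 \<le> k \<and> k < r \<and> [k = a] (mod D)}" using j by (simp add: cong_def)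
  qed
  show "finite {k. 0 \<le> k \<and> k < r \<and> [k = a] (mod D)}" unfolding eq by simp
  have "inj_on (\<lambda>j. a mod D + D * j) {0..<s}" using assms by (auto simp: inj_on_def)
  then have "card {k. 0 \<le> k \<and> k < r \<and> [k = a] (mod D)} = nat s" by (simp add: eq card_image)
  then show "real (card {k. 0 \<le> k \<and> k < r \<and> [k = a] (mod D)}) = real_of_int r / real_of_int D"
    using s s0 assms by simp
qed

text \<open>Expanding the factor at \<open>q\<close> gives three sums: over the class itself and
  over its members congruent to 0 or to 1 modulo \<open>q\<close>. By the Chinese remainder theorem
  the last two are classes modulo \<open>D * q\<close>, to which the induction applies again and
  which are \<open>q\<close> times thinner.\<close>

lemma sum_residue_class_prod:
  fixes \<alpha> \<beta> :: "nat \<Rightarrow> real" and r D a :: int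
  assumes "finite T" "\<And>p. p \<in> T \<Longrightarrow> prime p" "\<And>p. p \<in> T \<Longrightarrow> coprime D (int p)"
    and "r > 0" "D > 0" "D * int (\<Prod>T) dvd r"
  shows "(\<Sum>k | 0 \<le> k \<and> k < r \<and> [k = a] (mod D).
            \<Prod>p\<in>T. \<alpha> p - (if int p dvd k then \<alpha> p else 0) + (if int p dvd k - 1 then \<beta> p else 0))
       = real_of_int r / real_of_int D * (\<Prod>p\<in>T. \<alpha> p - \<alpha> p / p + \<beta> p / p)"
  using assms
proof (induction T arbitrary: D a rule: finite_induct)
  case empty
  then show ?case using card_residue_class(2)[of r D a] by simp
next
  case (insert q T)
  let ?g = "\<lambda>p k. \<alpha> p - (if int p dvd k then \<alpha> p else 0) + (if int p dvd k - 1 then \<beta> p else 0)"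
  let ?K = "\<lambda>D a. {k. 0 \<le> k \<and> k < r \<and> [k = a] (mod D)}"
  let ?\<Pi> = "\<Prod>p\<in>T. \<alpha> p - \<alpha> p / p + \<beta> p / p"
  have q: "prime q" "int q > 0" "coprime D (int q)" using insert.prems by (auto simp: prime_gt_0_nat)
  have D: "D > 0" "r > 0" using insert.prems by auto
  have dvd: "D * int q * int (\<Prod>T) dvd r" using insert.prems(5) insert.hyps by (simp add: mult.assoc)
  have dvd1: "D * int (\<Prod>T) dvd r" using dvd_trans[OF _ dvd, of "D * int (\<Prod>T)"] by (simp add: mult_ac)
  have finK: "finite (?K D a)"
    by (rule finite_subset[of _ "{0..<r}"]) auto
  obtain w0 where w0: "\<And>x. [x = w0] (mod (D * int q)) \<longleftrightarrow> [x = a] (mod D) \<and> [x = 0] (mod int q)"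
    using chinese_residue_class[OF q(3), of a 0] by blast
  obtain w1 where w1: "\<And>x. [x = w1] (mod (D * int q)) \<longleftrightarrow> [x = a] (mod D) \<and> [x = 1] (mod int q)"
    using chinese_residue_class[OF q(3), of a 1] by blast
  have cop: "coprime (D * int q) (int p)" if "p \<in> T" for p
  proof -
    have "coprime q p" using that insert by (intro primes_coprime) auto
    then show ?thesis using that insert.prems by simp
  qed
  have IH: "(\<Sum>k\<in>?K D' a'. \<Prod>p\<in>T. ?g p k) = real_of_int r / real_of_int D' * ?\<Pi>"
    if "\<And>p. p \<in> T \<Longrightarrow> coprime D' (int p)" "D' > 0" "D' * int (\<Prod>T) dvd r" for D' a'
    using insert.IH[of D' a'] insert.prems that by auto
  have s0: "(\<Sum>k\<in>?K D a. if int q dvd k then \<Prod>p\<in>T. ?g p k else 0) = (\<Sum>k\<in>?K (D * int q) w0. \<Prod>p\<in>T. ?g p k)"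
  proof -
    have "{k \<in> ?K D a. int q dvd k} = ?K (D * int q) w0"
      using w0 by (auto simp: cong_0_iff)
    then show ?thesis using sum.inter_filter[OF finK, of "\<lambda>k. \<Prod>p\<in>T. ?g p k" "\<lambda>k. int q dvd k"] by simp
  qed
  have s1: "(\<Sum>k\<in>?K D a. if int q dvd k - 1 then \<Prod>p\<in>T. ?g p k else 0) = (\<Sum>k\<in>?K (D * int q) w1. \<Prod>p\<in>T. ?g p k)"
  proof -
    have "{k \<in> ?K D a. int q dvd k - 1} = ?K (D * int q) w1"
      using w1 by (auto simp: cong_iff_dvd_diff)
    then show ?thesis using sum.inter_filter[OF finK, of "\<lambda>k. \<Prod>p\<in>T. ?g p k" "\<lambda>k. int q dvd k - 1"] by simp
  qed
  have "(\<Sum>k\<in>?K D a. \<Prod>p\<in>insert q T. ?g p k)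
     = (\<Sum>k\<in>?K D a. \<alpha> q * (\<Prod>p\<in>T. ?g p k) - \<alpha> q * (if int q dvd k then \<Prod>p\<in>T. ?g p k else 0)
          + \<beta> q * (if int q dvd k - 1 then \<Prod>p\<in>T. ?g p k else 0))"
    using insert.hyps by (intro sum.cong refl) (simp add: algebra_simps)
  also have "\<dots> = \<alpha> q * (\<Sum>k\<in>?K D a. \<Prod>p\<in>T. ?g p k) - \<alpha> q * (\<Sum>k\<in>?K (D * int q) w0. \<Prod>p\<in>T. ?g p k)
      + \<beta> q * (\<Sum>k\<in>?K (D * int q) w1. \<Prod>p\<in>T. ?g p k)"
    by (simp only: sum.distrib sum_subtractf sum_distrib_left[symmetric] s0 s1)
  also have "\<dots> = \<alpha> q * (real_of_int r / real_of_int D * ?\<Pi>) - \<alpha> q * (real_of_int r / real_of_int (D * int q) * ?\<Pi>)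
      + \<beta> q * (real_of_int r / real_of_int (D * int q) * ?\<Pi>)"
  proof -
    have "D * int q > 0" using D q by simp
    then show ?thesis using IH[of D a] IH[of "D * int q" w0] IH[of "D * int q" w1] cop dvd dvd1 D insert.prems(2)
      by (simp only: insertI2)
  qed
  also have "\<dots> = real_of_int r / real_of_int D * ((\<alpha> q - \<alpha> q / q + \<beta> q / q) * ?\<Pi>)"
    by (simp add: ring_distribs diff_divide_distrib add_divide_distrib mult.left_commute)
  finally show ?case using insert.hyps by simp
qed

lemma residue_count_pair:
  assumes "prime p"
  shows "residue_count {(0, 0), (- 1, 0)} p = 2"
proof -
  have "int p > 1" using prime_gt_1_nat[OF assms] by simp
  then have "(- 1) mod int p \<noteq> 0" by (simp add: zmod_minus1)
  then show ?thesis by (simp add: residue_count_def)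
qed

text \<open>Coprimality of \<open>k\<close> and \<open>r\<close> keeps \<open>(k, - r)\<close> away
  from \<open>(0, 0)\<close> modulo \<open>p\<close>, so the only possible coincidence is with
  \<open>(1, 0)\<close>.\<close>

lemma residue_count_triple:
  fixes k r :: int
  assumes p: "prime p" and kr: "coprime k r"
  shows "real (residue_count {(0, 0), (1, 0), (k, - r)} p) = 3 - (if int p dvd r \<and> int p dvd k - 1 then 1 else 0)"
proof -
  have p1: "int p > 1" using prime_gt_1_nat[OF p] by simp
  have r0: "(- r) mod int p = 0 \<longleftrightarrow> int p dvd r" by (simp add: mod_eq_0_iff_dvd)
  have k1: "k mod int p = 1 \<longleftrightarrow> int p dvd k - 1" using p1 by (simp add: mod_eq_dvd_iff[symmetric])
  have "\<not> (int p dvd k \<and> int p dvd r)"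
    using kr p1 by (metis coprime_common_divisor_int abs_of_pos less_irrefl zero_less_one order_less_trans)
  then have k0: "(k mod int p, (- r) mod int p) \<noteq> (0, 0)" using r0 by (auto simp: mod_eq_0_iff_dvd)
  have "residue_count {(0, 0), (1, 0), (k, - r)} p = card {(0, 0), (1, 0), (k mod int p, (- r) mod int p)}"
    using p1 by (simp add: residue_count_def)
  also have "real \<dots> = 3 - (if (k mod int p, (- r) mod int p) = (1, 0) then 1 else 0)"
    using k0 by (cases "(k mod int p, (- r) mod int p) = (1, 0)") (simp_all add: card_insert_if)
  also have "(k mod int p, (- r) mod int p) = (1, 0) \<longleftrightarrow> int p dvd r \<and> int p dvd k - 1"
    using r0 k1 by auto
  finally show ?thesis .
qed

text \<open>At primes not dividing \<open>r\<close> the factor is \<open>1 - 3 / p^2\<close> for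
  every \<open>k\<close>. At primes dividing \<open>r\<close> the coprimality of \<open>k\<close>
  and \<open>r\<close> is absorbed into a factor that vanishes when \<open>p\<close> divides
  \<open>k\<close>; its average over \<open>k\<close> modulo \<open>p\<close> is
  \<open>(1 - 3 / p^2) (1 - 1 / p) + 1 / p^3\<close>. The powers of \<open>p\<close> multiply to
  \<open>r\<close>, the number of all residues \<open>k\<close>.\<close>

lemma sum_coprime_residue_products:
  fixes r :: nat
  assumes r: "r \<ge> 1" and S: "finite S" "\<And>p. p \<in> S \<Longrightarrow> prime p" "prime_factors r \<subseteq> S"
  shows "(\<Sum>k | 0 \<le> k \<and> k < int r \<and> coprime k (int r).
            \<Prod>p\<in>S. 1 - residue_count {(0, 0), (1, 0), (k, - int r)} p / (real p)\<^sup>2)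
     = (\<Prod>p\<in>S. if multiplicity p r = 0 then 1 - 3 / (real p)\<^sup>2
          else real p ^ multiplicity p r * ((1 - 3 / (real p)\<^sup>2) * (1 - 1 / real p) + 1 / real p ^ 3))"
proof -
  define T where "T = prime_factors r"
  define \<alpha> where "\<alpha> p = 1 - 3 / (real p)\<^sup>2" for p :: nat
  let ?g = "\<lambda>p k. \<alpha> p - (if int p dvd k then \<alpha> p else 0) + (if int p dvd k - 1 then 1 / (real p)\<^sup>2 else 0)"
  have T: "finite T" "\<And>p. p \<in> T \<Longrightarrow> prime p" "T \<subseteq> S" using S by (auto simp: T_def)
  have inT: "p \<in> T \<longleftrightarrow> p dvd r" if "p \<in> S" for p
    using that S(2) r by (auto simp: T_def in_prime_factors_iff)
  have mult: "multiplicity p r = 0 \<longleftrightarrow> p \<notin> T" if "p \<in> S" for p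
  proof -
    have "r \<noteq> 0" "\<not> is_unit p" using r S(2)[OF that] by auto
    then show ?thesis using inT[OF that] by (simp add: multiplicity_eq_zero_iff)
  qed
  have split: "(\<Prod>p\<in>S. f p) = (\<Prod>p\<in>S - T. f p) * (\<Prod>p\<in>T. f p)" for f :: "nat \<Rightarrow> real"
    by (rule prod.subset_diff[OF T(3) S(1)])
  have step: "(if coprime k (int r) then \<Prod>p\<in>S. 1 - residue_count {(0, 0), (1, 0), (k, - int r)} p / (real p)\<^sup>2 else 0)
     = (\<Prod>p\<in>S - T. \<alpha> p) * (\<Prod>p\<in>T. ?g p k)" for k
  proof (cases "coprime k (int r)")
    case True
    have 1: "1 - residue_count {(0, 0), (1, 0), (k, - int r)} p / (real p)\<^sup>2 = \<alpha> p" if "p \<in> S - T" for p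
    proof -
      have "\<not> int p dvd int r" using that inT by auto
      then show ?thesis using residue_count_triple[OF _ True, of p] that S(2) by (simp add: \<alpha>_def)
    qed
    have 2: "1 - residue_count {(0, 0), (1, 0), (k, - int r)} p / (real p)\<^sup>2 = ?g p k" if "p \<in> T" for p
    proof -
      have p: "int p dvd int r" "prime p" using that T inT by auto
      then have "\<not> int p dvd k"
        using True by (metis coprime_common_divisor not_prime_unit prime_nat_int_transfer)
      then show ?thesis using residue_count_triple[OF p(2) True] p by (simp add: \<alpha>_def diff_divide_distrib)
    qed
    show ?thesis using True 1 2 by (simp add: split)
  next
    case False
    then have "\<not> coprime (nat \<bar>k\<bar>) r" by (metis coprime_int_iff coprime_abs_left_iff int_nat_eq abs_ge_zero)
    then have "gcd (nat \<bar>k\<bar>) r \<noteq> 1" by (simp only: coprime_iff_gcd_eq_1 not_False_eq_True)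
    then obtain p where p: "prime p" "p dvd gcd (nat \<bar>k\<bar>) r" using prime_factor_nat by blast
    then have "p dvd nat \<bar>k\<bar>" "p dvd r" using dvd_trans gcd_dvd1 gcd_dvd2 by blast+
    then have pT: "p \<in> T" using p(1) r by (simp add: T_def in_prime_factors_iff)
    have "int p dvd int (nat \<bar>k\<bar>)" using \<open>p dvd nat \<bar>k\<bar>\<close> by (simp only: int_dvd_int_iff)
    then have pk: "int p dvd k" by simp
    have "\<not> int p dvd k - 1"
    proof
      assume "int p dvd k - 1"
      then have "int p dvd k - (k - 1)" using pk by (rule dvd_diff[rotated])
      then show False using p by simp
    qed
    then have "?g p k = 0" using pk by simp
    then have "(\<Prod>p\<in>T. ?g p k) = 0" using pT by (intro prod_zero[OF T(1)]) (rule bexI[of _ p])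
    then show ?thesis using False by simp
  qed
  have fin: "finite {k. 0 \<le> k \<and> k < int r}" by (rule finite_subset[of _ "{0..<int r}"]) auto
  have "(\<Sum>k | 0 \<le> k \<and> k < int r \<and> coprime k (int r).
            \<Prod>p\<in>S. 1 - residue_count {(0, 0), (1, 0), (k, - int r)} p / (real p)\<^sup>2)
     = (\<Sum>k\<in>{k\<in>{k. 0 \<le> k \<and> k < int r}. coprime k (int r)}. \<Prod>p\<in>S. 1 - residue_count {(0, 0), (1, 0), (k, - int r)} p / (real p)\<^sup>2)"
    by (intro sum.cong) auto
  also have "\<dots> = (\<Sum>k\<in>{k. 0 \<le> k \<and> k < int r}. (\<Prod>p\<in>S - T. \<alpha> p) * (\<Prod>p\<in>T. ?g p k))"
    by (simp only: sum.inter_filter[OF fin] step)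
  also have "\<dots> = (\<Prod>p\<in>S - T. \<alpha> p) * (\<Sum>k | 0 \<le> k \<and> k < int r \<and> [k = 0] (mod 1). \<Prod>p\<in>T. ?g p k)"
    by (simp add: sum_distrib_left)
  also have "(\<Sum>k | 0 \<le> k \<and> k < int r \<and> [k = 0] (mod 1). \<Prod>p\<in>T. ?g p k)
     = real_of_int (int r) / real_of_int 1 * (\<Prod>p\<in>T. \<alpha> p - \<alpha> p / p + (1 / (real p)\<^sup>2) / p)"
  proof (rule sum_residue_class_prod[OF T(1,2)])
    have "\<Prod>T dvd r" using T by (intro prod_primes_dvd) (auto simp: T_def)
    then show "1 * int (\<Prod>T) dvd int r" by (simp only: mult_1 int_dvd_int_iff)
  qed (use r in auto)
  also have "real_of_int (int r) / real_of_int 1 = (\<Prod>p\<in>T. real p ^ multiplicity p r)"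
  proof -
    have "r = (\<Prod>p\<in>T. p ^ multiplicity p r)"
      using r prod_prime_factors[of r] by (simp add: T_def)
    then have "real r = real (\<Prod>p\<in>T. p ^ multiplicity p r)" by (rule arg_cong)
    then show ?thesis by simp
  qed
  also have "(\<Prod>p\<in>T. real p ^ multiplicity p r) * (\<Prod>p\<in>T. \<alpha> p - \<alpha> p / p + (1 / (real p)\<^sup>2) / p)
     = (\<Prod>p\<in>T. real p ^ multiplicity p r * (\<alpha> p * (1 - 1 / real p) + 1 / real p ^ 3))"
    unfolding prod.distrib[symmetric]
    by (intro prod.cong refl) (simp add: right_diff_distrib power2_eq_square power3_eq_cube)
  also have "(\<Prod>p\<in>S - T. \<alpha> p) * (\<Prod>p\<in>T. real p ^ multiplicity p r * (\<alpha> p * (1 - 1 / real p) + 1 / real p ^ 3))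
     = (\<Prod>p\<in>S. if multiplicity p r = 0 then \<alpha> p else real p ^ multiplicity p r * (\<alpha> p * (1 - 1 / real p) + 1 / real p ^ 3))"
    unfolding split[of "\<lambda>p. if multiplicity p r = 0 then \<alpha> p else real p ^ multiplicity p r * (\<alpha> p * (1 - 1 / real p) + 1 / real p ^ 3)"]
    using mult T(3) by (intro arg_cong2[of _ _ _ _ "(*)"] prod.cong refl) auto
  finally show ?thesis by (simp only: \<alpha>_def)
qed

section \<open>Agreement of the Euler factors\<close>

definition euler_factor :: "nat \<Rightarrow> bool \<Rightarrow> bool \<Rightarrow> real" where
  "euler_factor p A B = euler_term p False False A B + euler_term p False True A B +
     euler_term p True False A B + euler_term p True True A B"

text \<open>With \<open>s = 1 / (p - 1)\<close> and \<open>t = 1 / (p^2 - 1)\<close>, the values of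
  \<open>euler_factor\<close> are \<open>(1 - s)^2\<close> (both arguments true),
  \<open>(1 - s) (1 - t)\<close> (one true) and \<open>1 - 2 t\<close> (none), the last without
  \<open>t^2\<close> because of the gcd condition. Since \<open>(1 - 1 / p^2) t = 1 / p^2\<close>,
  the left side for \<open>v \<ge> 1\<close> becomes
  \<open>p^v (1 - 3 / p^2) - p^(v - 1) (1 - 4 / p^2)\<close>, which is the right side multiplied
  out.\<close>

lemma local_sum_euler_factor:
  assumes "prime p"
  shows "(1 - 1 / (real p)\<^sup>2) * local_sum euler_factor p v =
    (if v = 0 then 1 - 3 / (real p)\<^sup>2
     else real p ^ v * ((1 - 3 / (real p)\<^sup>2) * (1 - 1 / real p) + 1 / real p ^ 3))"
proof -
  define q where "q = real p"
  have q: "q > 1" using prime_gt_1_nat[OF assms] by (simp add: q_def)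
  define s t where "s = 1 / (q - 1)" and "t = 1 / ((q + 1) * (q - 1))"
  have 1: "q * (- 1 / (q * (q - 1))) = - s" using q by (simp add: s_def)
  have inv: "inverse (1 + 1 / q) = q / (q + 1)" using q by (simp add: field_simps)
  have 2: "inverse (1 + 1 / q) * (- 1 / (q * (q - 1))) = - t" unfolding inv using q by (simp add: t_def)
  have FF: "euler_factor p False False = 1 - 2 * t"
    unfolding euler_factor_def euler_term_def q_def[symmetric] if_True if_False 2 by simp
  have TT: "euler_factor p True True = 1 - 2 * s + s * s"
    unfolding euler_factor_def euler_term_def q_def[symmetric] if_True if_False 1 by simp
  have TF: "euler_factor p True False = 1 - s - t + s * t" "euler_factor p False True = 1 - s - t + s * t"
    unfolding euler_factor_def euler_term_def q_def[symmetric] if_True if_False 1 2 by simp_all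
  have a: "(1 - 1 / q\<^sup>2) * (1 - 2 * t) = 1 - 3 / q\<^sup>2"
  proof -
    have "(1 - 1 / q\<^sup>2) * t = 1 / q\<^sup>2" unfolding t_def using q
      by (simp add: divide_simps) (simp add: algebra_simps power2_eq_square)
    moreover have "(1 - 1 / q\<^sup>2) * (1 - 2 * t) = (1 - 1 / q\<^sup>2) - 2 * ((1 - 1 / q\<^sup>2) * t)"
      by (simp only: right_diff_distrib mult_1_right mult.left_commute)
    ultimately show ?thesis by simp
  qed
  \<comment> \<open>Substituting \<open>s = (q + 1) t\<close> turns everything in the bracket but
    the constant \<open>- 1\<close> into a multiple of \<open>t\<close>, with cofactor
    \<open>s (q - 1) + 2 = 3\<close>.\<close>
  have b: "(1 - 1 / q\<^sup>2) * (1 - 2 * s + s * s - (1 - s - t + s * t) - (1 - s - t + s * t)) = - (1 - 4 / q\<^sup>2)"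
  proof -
    have st: "s = (q + 1) * t" unfolding s_def t_def using q by simp
    have t1: "(1 - 1 / q\<^sup>2) * t = 1 / q\<^sup>2" unfolding t_def using q
      by (simp add: divide_simps) (simp add: algebra_simps power2_eq_square)
    have s1: "s * (q - 1) = 1" unfolding s_def using q by simp
    have "(1 - 1 / q\<^sup>2) * (1 - 2 * s + s * s - (1 - s - t + s * t) - (1 - s - t + s * t))
       = - (1 - 1 / q\<^sup>2) + (1 - 1 / q\<^sup>2) * t * ((q + 1) * s + 2 - 2 * s)"
      by (simp add: st algebra_simps add_divide_distrib)
    also have "(q + 1) * s + 2 - 2 * s = s * (q - 1) + 2" by (simp add: algebra_simps)
    finally show ?thesis unfolding t1 s1 by (simp add: algebra_simps)
  qed
  show ?thesis
  proof (cases v)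
    case 0
    then show ?thesis using a by (simp add: local_sum_def FF q_def)
  next
    case (Suc w)
    have "(1 - 1 / q\<^sup>2) * local_sum euler_factor p v
       = q ^ v * ((1 - 1 / q\<^sup>2) * (1 - 2 * t)) + q ^ w * ((1 - 1 / q\<^sup>2) * (1 - 2 * s + s * s - (1 - s - t + s * t) - (1 - s - t + s * t)))"
      unfolding local_sum_def FF TT TF q_def[symmetric] Suc by (simp add: distrib_left mult_ac)
    also have "\<dots> = q ^ v * ((1 - 3 / q\<^sup>2) * (1 - 1 / q) + 1 / q ^ 3)"
      unfolding a b Suc using q by (simp add: field_simps power2_eq_square power3_eq_cube)
    finally show ?thesis using Suc by (simp add: q_def)
  qed
qed

lemma sum_Pow_g2_coeff_h_fun:
  assumes S: "finite S" "\<And>p. p \<in> S \<Longrightarrow> prime p" and m: "m \<ge> 1" "prime_factors m \<subseteq> S"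
  shows "(\<Sum>X\<in>Pow S. \<Sum>Y\<in>Pow S. g2_coeff (\<Prod>X) (\<Prod>Y) * h_fun (\<Prod>X) (\<Prod>Y) m)
    = (\<Prod>p\<in>S. local_sum euler_factor p (multiplicity p m))"
proof -
  let ?c = "\<lambda>(n, \<delta>, d1, d3). real n * of_int (moebius d1) * of_int (moebius d3)"
  let ?t = "\<lambda>(n, \<delta>, d1, d3) p x y. euler_term p x y (p dvd d1 * \<delta>) (p dvd d3 * \<delta>)"
  have "(\<Sum>X\<in>Pow S. \<Sum>Y\<in>Pow S. g2_coeff (\<Prod>X) (\<Prod>Y) * h_fun (\<Prod>X) (\<Prod>Y) m)
     = (\<Sum>X\<in>Pow S. \<Sum>Y\<in>Pow S. \<Sum>u\<in>factorizations4 m. ?c u * (\<Prod>p\<in>S. ?t u p (p \<in> X) (p \<in> Y)))"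
  proof (intro sum.cong refl)
    fix X Y assume XY: "X \<in> Pow S" "Y \<in> Pow S"
    have "g2_coeff (\<Prod>X) (\<Prod>Y) * h_fun (\<Prod>X) (\<Prod>Y) m = (\<Sum>(n, \<delta>, d1, d3)\<in>factorizations4 m.
        real n * of_int (moebius d1) * of_int (moebius d3) * (g2_coeff (\<Prod>X) (\<Prod>Y) * h_weight (\<Prod>X) (\<Prod>Y) \<delta> d1 d3))"
      unfolding h_fun_eq sum_distrib_left by (intro sum.cong refl) (auto simp: mult_ac)
    also have "\<dots> = (\<Sum>u\<in>factorizations4 m. ?c u * (\<Prod>p\<in>S. ?t u p (p \<in> X) (p \<in> Y)))"
      using XY by (intro sum.cong refl) (auto simp: g2_coeff_h_weight_prod_primes[OF S])
    finally show "g2_coeff (\<Prod>X) (\<Prod>Y) * h_fun (\<Prod>X) (\<Prod>Y) m = (\<Sum>u\<in>factorizations4 m. ?c u * (\<Prod>p\<in>S. ?t u p (p \<in> X) (p \<in> Y)))" .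
  qed
  also have "\<dots> = (\<Sum>u\<in>factorizations4 m. \<Sum>X\<in>Pow S. \<Sum>Y\<in>Pow S. ?c u * (\<Prod>p\<in>S. ?t u p (p \<in> X) (p \<in> Y)))"
    by (subst (2) sum.swap, subst sum.swap) (rule refl)
  also have "\<dots> = (\<Sum>u\<in>factorizations4 m. ?c u * (\<Sum>X\<in>Pow S. \<Sum>Y\<in>Pow S. \<Prod>p\<in>S. ?t u p (p \<in> X) (p \<in> Y)))"
    by (simp only: sum_distrib_left)
  also have "\<dots> = (\<Sum>(n, \<delta>, d1, d3)\<in>factorizations4 m. real n * of_int (moebius d1) * of_int (moebius d3) *
            (\<Prod>p\<in>S. euler_factor p (p dvd d1 * \<delta>) (p dvd d3 * \<delta>)))"
    unfolding sum_Pow_Pow_prod[OF S(1)] by (intro sum.cong refl) (auto simp: euler_factor_def)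
  also have "\<dots> = (\<Prod>p\<in>S. local_sum euler_factor p (multiplicity p m))"
    by (rule sum_factorizations4_euler[OF S m])
  finally show ?thesis .
qed

text \<open>Both sides have the same factor at each prime of \<open>S\<close>. The product of the
  \<open>1 - 1 / p^2\<close> is what becomes \<open>1 / zeta 2\<close> when \<open>S\<close>
  grows.\<close>

lemma truncated_singular_series_identity:
  assumes r: "r \<ge> 1" and S: "finite S" "\<And>p. p \<in> S \<Longrightarrow> prime p" "prime_factors r \<subseteq> S"
  shows "(\<Sum>k | 0 \<le> k \<and> k < int r \<and> coprime k (int r).
            \<Prod>p\<in>S. 1 - residue_count {(0, 0), (1, 0), (k, - int r)} p / (real p)\<^sup>2)
     = (\<Prod>p\<in>S. 1 - 1 / (real p)\<^sup>2) * (\<Sum>X\<in>Pow S. \<Sum>Y\<in>Pow S. g2_coeff (\<Prod>X) (\<Prod>Y) * h_fun (\<Prod>X) (\<Prod>Y) r)"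
  by (simp only: sum_coprime_residue_products[OF r S] sum_Pow_g2_coeff_h_fun[OF S(1,2) r S(3)] prod.distrib[symmetric])
     (use S(2) in \<open>intro prod.cong refl, simp add: local_sum_euler_factor\<close>)

section \<open>The constants \<open>\<beta>\<close> and \<open>\<zeta>(2)\<close>\<close>

definition small_primes :: "nat \<Rightarrow> nat set" where
  "small_primes z = {p. prime p \<and> p \<le> z}"

lemma small_primes: "finite (small_primes z)" "p \<in> small_primes z \<Longrightarrow> prime p"
  by (auto simp: small_primes_def)

lemma convergent_prod_small_primes:
  fixes f :: "nat \<Rightarrow> real"
  assumes "\<And>p. prime p \<Longrightarrow> 0 \<le> f p \<and> f p \<le> 1"
  shows "convergent (\<lambda>z. \<Prod>p\<in>small_primes z. f p)"
proof -
  have "decseq (\<lambda>z. \<Prod>p\<in>small_primes z. f p)"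
  proof (rule decseq_SucI)
    fix z
    have sub: "small_primes z \<subseteq> small_primes (Suc z)" by (auto simp: small_primes_def)
    have "(\<Prod>p\<in>small_primes (Suc z). f p) = (\<Prod>p\<in>small_primes (Suc z) - small_primes z. f p) * (\<Prod>p\<in>small_primes z. f p)"
      by (rule prod.subset_diff[OF sub small_primes(1)])
    also have "\<dots> \<le> 1 * (\<Prod>p\<in>small_primes z. f p)"
      using assms small_primes(2) by (intro mult_right_mono prod_le_1 prod_nonneg) auto
    finally show "(\<Prod>p\<in>small_primes (Suc z). f p) \<le> (\<Prod>p\<in>small_primes z. f p)" by simp
  qed
  moreover have "\<forall>z. 0 \<le> (\<Prod>p\<in>small_primes z. f p)"
    using assms small_primes(2) by (auto intro!: prod_nonneg)
  ultimately obtain L where "(\<lambda>z. \<Prod>p\<in>small_primes z. f p) \<longlonglongrightarrow> L" by (rule decseq_convergent)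
  then show ?thesis by (auto simp: convergent_def)
qed

text \<open>The roots \<open>- 1\<close> and \<open>0\<close> are represented in
  \<open>{1..p}\<close> by \<open>p - 1\<close> and \<open>p\<close>.\<close>

lemma root_count_x_x1:
  assumes "prime p"
  shows "root_count ([:0, 1:] * [:1, 1:]) p = 2"
proof -
  have p: "p \<ge> 2" using assms by (rule prime_ge_2_nat)
  have "{a::nat. 1 \<le> a \<and> a \<le> p \<and> [poly ([:0, 1:] * [:1, 1:]) (int a) = 0] (mod int p)} = {p - 1, p}"
  proof (intro equalityI subsetI)
    fix a assume a: "a \<in> {a::nat. 1 \<le> a \<and> a \<le> p \<and> [poly ([:0, 1:] * [:1, 1:]) (int a) = 0] (mod int p)}"
    then have "int p dvd int a * (1 + int a)" by (simp add: cong_0_iff)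
    moreover have "int a * (1 + int a) = int (a * (a + 1))" by (simp add: algebra_simps)
    ultimately have "int p dvd int (a * (a + 1))" by (simp only:)
    then have "p dvd a * (a + 1)" by (simp only: int_dvd_int_iff)
    then have "p dvd a \<or> p dvd a + 1" using prime_dvd_mult_iff[OF assms] by blast
    then show "a \<in> {p - 1, p}"
    proof
      assume "p dvd a"
      then have "p \<le> a" using a by (intro dvd_imp_le) auto
      then show ?thesis using a by auto
    next
      assume "p dvd a + 1"
      then have "p \<le> a + 1" by (intro dvd_imp_le) auto
      then show ?thesis using a by auto
    qed
  next
    fix a assume "a \<in> {p - 1, p}"
    then have "1 \<le> a \<and> a \<le> p" "a + 1 = p \<or> a = p" using p by auto
    from this(2) have "p dvd a * (a + 1)" by (metis dvd_triv_left dvd_triv_right)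
    then have "int p dvd int (a * (a + 1))" by (simp only: int_dvd_int_iff)
    moreover have "int (a * (a + 1)) = int a * (1 + int a)" by (simp add: algebra_simps)
    ultimately have "int p dvd int a * (1 + int a)" by (simp only:)
    then show "a \<in> {a::nat. 1 \<le> a \<and> a \<le> p \<and> [poly ([:0, 1:] * [:1, 1:]) (int a) = 0] (mod int p)}"
      using \<open>1 \<le> a \<and> a \<le> p\<close> by (simp add: cong_0_iff)
  qed
  then show ?thesis using p by (simp add: root_count_def)
qed

text \<open>The infinite product runs over all naturals with factor 1 off the primes, so its partial
  products are those over \<open>small_primes\<close>. It is positive because it converges and no
  factor vanishes, the smallest being \<open>1 - 2 / 4\<close> at \<open>p = 2\<close>.\<close>

lemma beta_x_x1:
  shows "(\<lambda>z. \<Prod>p\<in>small_primes z. 1 - 2 / (real p)\<^sup>2) \<longlonglongrightarrow> beta ([:0, 1:] * [:1, 1:])"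
    and "beta ([:0, 1:] * [:1, 1:]) > 0"
proof -
  define f where "f p = (if prime p then 1 - real (root_count ([:0, 1:] * [:1, 1:]) p) / (real p)\<^sup>2 else 1)" for p
  have f: "f p = (if prime p then 1 - 2 / (real p)\<^sup>2 else 1)" for p
    by (simp add: f_def root_count_x_x1 del: mult_pCons_left mult_pCons_right)
  have "summable (\<lambda>n. 2 * (1 / (real n)\<^sup>2))"
    using inverse_power_summable[of 2] by (intro summable_mult) (simp add: field_simps)
  then have "summable (\<lambda>n. norm (f n - 1))"
    by (rule summable_comparison_test[rotated]) (auto simp: f)
  then have conv: "convergent_prod f"
    by (intro abs_convergent_prod_imp_convergent_prod) (simp add: abs_convergent_prod_conv_summable)
  have beta: "beta ([:0, 1:] * [:1, 1:]) = prodinf f" unfolding beta_def f_def ..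
  have "(\<Prod>i\<le>z. f i) = (\<Prod>p\<in>small_primes z. 1 - 2 / (real p)\<^sup>2)" for z
    unfolding f small_primes_def by (rule prod.mono_neutral_cong_right) auto
  with convergent_prod_LIMSEQ[OF conv]
  show lim: "(\<lambda>z. \<Prod>p\<in>small_primes z. 1 - 2 / (real p)\<^sup>2) \<longlonglongrightarrow> beta ([:0, 1:] * [:1, 1:])"
    unfolding beta by simp
  have pos: "1 - 2 / (real p)\<^sup>2 > 0" if "prime p" for p
  proof -
    have "2\<^sup>2 \<le> (real p)\<^sup>2" using prime_ge_2_nat[OF that] by (intro power_mono) auto
    then show ?thesis by (simp add: divide_less_eq)
  qed
  have "beta ([:0, 1:] * [:1, 1:]) \<noteq> 0"
    unfolding beta using pos by (intro prodinf_nonzero[OF conv]) (auto simp: f less_le)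
  moreover have "beta ([:0, 1:] * [:1, 1:]) \<ge> 0"
    by (intro LIMSEQ_le_const[OF lim] exI allI impI prod_nonneg less_imp_le[OF pos] small_primes(2))
  ultimately show "beta ([:0, 1:] * [:1, 1:]) > 0" by simp
qed

lemma summable_on_inverse_squares: "(\<lambda>n. 1 / (real n)\<^sup>2) summable_on A"
proof -
  have "summable (\<lambda>n. norm (1 / (real n)\<^sup>2))"
    using inverse_power_summable[of 2] by (simp add: field_simps)
  then have "(\<lambda>n. 1 / (real n)\<^sup>2) summable_on UNIV"
    by (rule norm_summable_imp_summable_on)
  then show ?thesis by (rule summable_on_subset_banach) simp
qed

lemma zeta_2_eq_infsum: "zeta 2 = infsum (\<lambda>n. 1 / (real n)\<^sup>2) {1..}"
proof -
  have s: "summable (\<lambda>n. 1 / (real (Suc n))\<^sup>2)"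
    using inverse_power_summable[of 2] by (subst summable_Suc_iff) (simp add: field_simps)
  have "zeta 2 = (\<Sum>n. 1 / (real (Suc n))\<^sup>2)" unfolding zeta_def by (simp add: powr_numeral)
  also have "\<dots> = infsum (\<lambda>n. 1 / (real (Suc n))\<^sup>2) UNIV"
    using norm_summable_imp_has_sum[OF _ summable_sums[OF s]] s by (intro infsumI[symmetric]) auto
  also have "\<dots> = infsum (\<lambda>n. 1 / (real n)\<^sup>2) (range Suc)"
    by (subst infsum_reindex) (auto simp: o_def)
  also have "range Suc = {1..}" by (auto simp: image_iff) (metis Suc_le_D)
  finally show ?thesis .
qed

text \<open>Among the \<open>n\<close> prime to \<open>S\<close>, the multiples of a further prime
  \<open>q\<close> are exactly \<open>q\<close> times that same set, so removing them multiplies the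
  sum by \<open>1 - 1 / q^2\<close>.\<close>

lemma infsum_inverse_squares_coprime:
  assumes "finite S" "\<And>p. p \<in> S \<Longrightarrow> prime (p::nat)"
  shows "infsum (\<lambda>n. 1 / (real n)\<^sup>2) {n. n \<ge> 1 \<and> (\<forall>p\<in>S. \<not> p dvd n)} = (\<Prod>p\<in>S. 1 - 1 / (real p)\<^sup>2) * zeta 2"
  using assms
proof (induction S rule: finite_induct)
  case empty
  have "{n::nat. n \<ge> 1} = {1..}" by auto
  then show ?case by (simp add: zeta_2_eq_infsum)
next
  case (insert q S)
  let ?f = "\<lambda>n. 1 / (real n)\<^sup>2"
  let ?A = "\<lambda>S. {n::nat. n \<ge> 1 \<and> (\<forall>p\<in>S. \<not> p dvd n)}"
  have q: "prime q" "q > 0" using insert by (auto simp: prime_gt_0_nat)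
  have iff: "p dvd q * n \<longleftrightarrow> p dvd n" if "p \<in> S" for p n
  proof -
    have "prime p" "p \<noteq> q" using that insert by auto
    then show ?thesis using q by (auto simp: prime_dvd_mult_iff dest: primes_dvd_imp_eq)
  qed
  have eq: "?A (insert q S) = ?A S - (\<lambda>n. q * n) ` ?A S"
  proof (intro equalityI subsetI)
    fix n assume "n \<in> ?A S - (\<lambda>n. q * n) ` ?A S"
    then have n: "n \<ge> 1" "\<forall>p\<in>S. \<not> p dvd n" and ni: "n \<notin> (\<lambda>n. q * n) ` ?A S" by auto
    have "\<not> q dvd n"
    proof
      assume "q dvd n"
      then obtain j where j: "n = q * j" by auto
      then have "j \<in> ?A S" using n iff by auto
      then show False using ni j by blast
    qed
    then show "n \<in> ?A (insert q S)" using n by auto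
  qed auto
  have sub: "(\<lambda>n. q * n) ` ?A S \<subseteq> ?A S" using iff q by auto
  have "infsum ?f (?A (insert q S)) = infsum ?f (?A S) - infsum ?f ((\<lambda>n. q * n) ` ?A S)"
    unfolding eq by (rule infsum_Diff[OF summable_on_inverse_squares summable_on_inverse_squares sub])
  also have "infsum ?f ((\<lambda>n. q * n) ` ?A S) = infsum (\<lambda>n. 1 / (real q)\<^sup>2 * ?f n) (?A S)"
    using q by (subst infsum_reindex) (auto simp: inj_on_def o_def power_mult_distrib)
  also have "\<dots> = 1 / (real q)\<^sup>2 * infsum ?f (?A S)" by (rule infsum_cmult_right')
  also have "infsum ?f (?A S) = (\<Prod>p\<in>S. 1 - 1 / (real p)\<^sup>2) * zeta 2" using insert by auto
  finally show ?case using insert(1,2) by (simp add: algebra_simps)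
qed

text \<open>The partial product times \<open>zeta 2\<close> is the sum of \<open>1 / n^2\<close>
  over the \<open>n\<close> without prime factors up to \<open>z\<close>. These are 1 and numbers
  beyond \<open>z\<close>, so the sum lies between \<open>1\<close> and
  \<open>1 + 1 / z\<close>.\<close>

lemma euler_product_zeta_2:
  shows "zeta 2 > 0" and "(\<lambda>z. \<Prod>p\<in>small_primes z. 1 - 1 / (real p)\<^sup>2) \<longlonglongrightarrow> 1 / zeta 2"
proof -
  let ?f = "\<lambda>n. 1 / (real n)\<^sup>2"
  let ?A = "\<lambda>z. {n. n \<ge> 1 \<and> (\<forall>p\<in>small_primes z. \<not> p dvd n)}"
  have "sum ?f {1} \<le> infsum ?f {1..}"
    by (rule finite_sum_le_infsum[OF summable_on_inverse_squares]) auto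
  then show pos: "zeta 2 > 0" by (simp add: zeta_2_eq_infsum)
  have lower: "1 \<le> infsum ?f (?A z)" for z
  proof -
    have "sum ?f {1} \<le> infsum ?f (?A z)"
      by (rule finite_sum_le_infsum[OF summable_on_inverse_squares]) (auto simp: small_primes_def)
    then show ?thesis by simp
  qed
  have upper: "infsum ?f (?A z) \<le> 1 + 1 / real z" if z: "z \<ge> 1" for z
  proof (rule infsum_le_finite_sums[OF summable_on_inverse_squares])
    fix F assume F: "finite F" "F \<subseteq> ?A z"
    have "F \<subseteq> insert 1 {z<..Max F}"
    proof
      fix n assume n: "n \<in> F"
      show "n \<in> insert 1 {z<..Max F}"
      proof (cases "n = 1")
        case False
        then obtain p where p: "prime p" "p dvd n" using prime_factor_nat by blast
        have "n \<ge> 1" using n F by auto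
        then have "p \<le> n" using p by (intro dvd_imp_le) auto
        moreover have "\<not> p \<le> z" using p n F by (auto simp: small_primes_def)
        ultimately show ?thesis using n F by auto
      qed simp
    qed
    then have "sum ?f F \<le> sum ?f (insert 1 {z<..Max F})" by (intro sum_mono2) auto
    also have "\<dots> \<le> 1 + sum ?f {z<..Max F}" using z by simp
    also have "\<dots> \<le> 1 + 1 / real z" using sum_inverse_squares_tail[OF z] by simp
    finally show "sum ?f F \<le> 1 + 1 / real z" .
  qed
  have "(\<lambda>z. infsum ?f (?A z)) \<longlonglongrightarrow> 1"
  proof (rule tendsto_sandwich[OF _ _ tendsto_const])
    show "\<forall>\<^sub>F z in sequentially. 1 \<le> infsum ?f (?A z)" using lower by (intro always_eventually) blast
    show "\<forall>\<^sub>F z in sequentially. infsum ?f (?A z) \<le> 1 + 1 / real z"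
      using eventually_ge_at_top[of 1] by eventually_elim (rule upper)
    show "(\<lambda>z. 1 + 1 / real z) \<longlonglongrightarrow> 1"
      using tendsto_add[OF tendsto_const LIMSEQ_const_over_nat[of 1], of 1] by simp
  qed
  then have "(\<lambda>z. infsum ?f (?A z) / zeta 2) \<longlonglongrightarrow> 1 / zeta 2"
    using pos by (intro tendsto_intros) auto
  moreover have "infsum ?f (?A z) / zeta 2 = (\<Prod>p\<in>small_primes z. 1 - 1 / (real p)\<^sup>2)" for z
    using infsum_inverse_squares_coprime[OF small_primes(1)[of z] small_primes(2)] pos by simp
  ultimately show "(\<lambda>z. \<Prod>p\<in>small_primes z. 1 - 1 / (real p)\<^sup>2) \<longlonglongrightarrow> 1 / zeta 2" by simp
qed

section \<open>Convergence of the singular series\<close>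

text \<open>The singular series of the sieve for fixed \<open>r\<close> and \<open>k\<close>: the
  density of the points \<open>(x, y)\<close> that satisfy the three coprimality conditions.\<close>

definition singular_product :: "int \<Rightarrow> int \<Rightarrow> real" where
  "singular_product r k = lim (\<lambda>z. \<Prod>p\<in>small_primes z. 1 - residue_count {(0, 0), (1, 0), (k, - r)} p / (real p)\<^sup>2)"

lemma LIMSEQ_singular_product:
  "(\<lambda>z. \<Prod>p\<in>small_primes z. 1 - residue_count {(0, 0), (1, 0), (k, - r)} p / (real p)\<^sup>2) \<longlonglongrightarrow> singular_product r k"
proof -
  let ?B = "{(0, 0), (1, 0), (k, - r)}"
  have "convergent (\<lambda>z. \<Prod>p\<in>small_primes z. 1 - residue_count ?B p / (real p)\<^sup>2)"
  proof (rule convergent_prod_small_primes)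
    fix p :: nat assume "prime p"
    then have "4 \<le> (real p)\<^sup>2" using prime_ge_2_nat[of p] power_mono[of 2 "real p" 2] by simp
    moreover have "card ?B \<le> 3" by (simp add: card_insert_if)
    then have "residue_count ?B p \<le> 3" by (rule order_trans[OF residue_count_le, rotated]) simp
    then have "real (residue_count ?B p) \<le> 3" by simp
    ultimately have "real (residue_count ?B p) \<le> (real p)\<^sup>2" by linarith
    then have "real (residue_count ?B p) / (real p)\<^sup>2 \<le> 1" by (simp add: divide_le_eq)
    then show "0 \<le> 1 - residue_count ?B p / (real p)\<^sup>2 \<and> 1 - residue_count ?B p / (real p)\<^sup>2 \<le> 1" by simp
  qed
  then show ?thesis unfolding singular_product_def by (simp add: convergent_LIMSEQ_iff)
qed

definition singular_sum :: "nat \<Rightarrow> real" where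
  "singular_sum r = (\<Sum>k | 0 \<le> k \<and> k < int r \<and> coprime k (int r). singular_product (int r) k)"

lemma squarefree_eq_prod_prime_factors:
  assumes "squarefree (d::nat)"
  shows "d = \<Prod>(prime_factors d)"
proof -
  have d0: "d \<noteq> 0" using assms by (metis not_squarefree_0)
  have "d = (\<Prod>p\<in>prime_factors d. p ^ multiplicity p d)" using prod_prime_factors[OF d0] by simp
  also have "\<dots> = \<Prod>(prime_factors d)"
    using assms d0 by (intro prod.cong refl) (simp add: squarefree_factorial_semiring')
  finally show ?thesis .
qed

lemma inj_on_Prod_small_primes: "inj_on (\<lambda>X. \<Prod>X) (Pow (small_primes z))"
proof (rule inj_onI)
  fix X Y assume XY: "X \<in> Pow (small_primes z)" "Y \<in> Pow (small_primes z)" "\<Prod>X = \<Prod>Y"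
  have "prime_factors (\<Prod>Z) = Z" if "Z \<in> Pow (small_primes z)" for Z
    using that small_primes by (intro prime_factors_prod_primes) (auto intro: finite_subset)
  then show "X = Y" using XY by metis
qed

lemma squarefree_in_Prod_small_primes:
  assumes "squarefree d" "d \<le> z"
  shows "d \<in> (\<lambda>X. \<Prod>X) ` Pow (small_primes z)"
proof -
  have d0: "d \<noteq> 0" using assms by (metis not_squarefree_0)
  have "prime_factors d \<subseteq> small_primes z"
  proof
    fix p assume "p \<in> prime_factors d"
    then have "prime p" "p dvd d" by auto
    moreover from this have "p \<le> d" using d0 by (intro dvd_imp_le) auto
    ultimately show "p \<in> small_primes z" using assms by (simp add: small_primes_def)
  qed
  then show ?thesis using squarefree_eq_prod_prime_factors[OF assms(1)] by blast
qed

lemma sum_small_primes_le_1: "(\<Sum>p\<in>small_primes z. 1 / (real p * (real p - 1))) \<le> 1"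
proof -
  have tele: "(\<Sum>n\<in>{2..z}. 1 / (real n * (real n - 1))) \<le> 1 - 1 / real z" if "z \<ge> 1" for z
    using that
  proof (induction z rule: dec_induct)
    case (step n)
    have "{2..Suc n} = insert (Suc n) {2..n}" using step by auto
    moreover have "1 / (real (Suc n) * (real (Suc n) - 1)) = 1 / real n - 1 / real (Suc n)"
      using step by (simp add: field_simps)
    ultimately show ?case using step by simp
  qed simp
  have "(\<Sum>p\<in>small_primes z. 1 / (real p * (real p - 1))) \<le> (\<Sum>n\<in>{2..z}. 1 / (real n * (real n - 1)))"
    by (intro sum_mono2) (auto simp: small_primes_def prime_ge_2_nat)
  also have "\<dots> \<le> 1"
  proof (cases "z \<ge> 1")
    case True
    then show ?thesis using tele[OF True] by (smt (verit) divide_nonneg_nonneg of_nat_0_le_iff)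
  qed auto
  finally show ?thesis .
qed

text \<open>A majorant in one variable: \<open>\<bar>g2_coeff d2 d4\<bar>\<close> is the product of
  the weights of \<open>d2\<close> and \<open>d4\<close>.\<close>

definition moebius_weight :: "nat \<Rightarrow> real" where
  "moebius_weight d = \<bar>of_int (moebius d)\<bar> / (real d * real (totient d))"

text \<open>Over the squarefree \<open>d\<close> composed of primes up to \<open>z\<close>, the
  weights add up to the product of \<open>1 + 1 / (p (p - 1))\<close>, which is at most the
  exponential of the sum of \<open>1 / (p (p - 1))\<close>, a sum bounded by 1.\<close>

lemma sum_moebius_weight_le:
  assumes "finite F"
  shows "(\<Sum>d\<in>F. moebius_weight d) \<le> exp 1"
proof -
  \<comment> \<open>A bound for all members of \<open>F\<close>, which puts its squarefree elements
    among the products of primes up to \<open>z\<close>.\<close>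
  define z where "z = \<Sum>F"
  let ?S = "small_primes z"
  have "(\<Sum>d\<in>F. moebius_weight d) = (\<Sum>d\<in>{d\<in>F. squarefree d}. moebius_weight d)"
    using assms by (intro sum.mono_neutral_right) (auto simp: moebius_weight_def moebius_def)
  also have "\<dots> \<le> (\<Sum>d\<in>(\<lambda>X. \<Prod>X) ` Pow ?S. moebius_weight d)"
  proof (rule sum_mono2)
    show "finite ((\<lambda>X. \<Prod>X) ` Pow ?S)" using small_primes(1) by simp
    show "{d\<in>F. squarefree d} \<subseteq> (\<lambda>X. \<Prod>X) ` Pow ?S"
    proof
      fix d assume d: "d \<in> {d\<in>F. squarefree d}"
      then have "d \<le> z" unfolding z_def using assms by (intro member_le_sum) auto
      then show "d \<in> (\<lambda>X. \<Prod>X) ` Pow ?S" using d by (intro squarefree_in_Prod_small_primes) auto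
    qed
  qed (auto simp: moebius_weight_def)
  also have "\<dots> = (\<Sum>X\<in>Pow ?S. moebius_weight (\<Prod>X))"
    by (subst sum.reindex[OF inj_on_Prod_small_primes]) (simp add: o_def)
  also have "\<dots> = (\<Sum>X\<in>Pow ?S. (\<Prod>p\<in>X. 1 / (real p * (real p - 1))) * (\<Prod>p\<in>?S - X. 1))"
  proof (intro sum.cong refl)
    fix X assume "X \<in> Pow ?S"
    then have X: "finite X" "\<And>p. p \<in> X \<Longrightarrow> prime p"
      using small_primes by (auto intro: finite_subset)
    have "\<bar>real_of_int (moebius (\<Prod>X))\<bar> = 1" by (simp add: moebius_prod_primes[OF X] power_abs)
    then show "moebius_weight (\<Prod>X) = (\<Prod>p\<in>X. 1 / (real p * (real p - 1))) * (\<Prod>p\<in>?S - X. 1)"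
      by (simp add: moebius_weight_def totient_prod_primes[OF X] prod_dividef prod.distrib)
  qed
  also have "\<dots> = (\<Prod>p\<in>?S. 1 / (real p * (real p - 1)) + 1)"
    by (rule prod_add[OF small_primes(1), symmetric])
  also have "\<dots> \<le> (\<Prod>p\<in>?S. exp (1 / (real p * (real p - 1))))"
  proof (rule prod_mono)
    fix p assume "p \<in> ?S"
    then have "real p \<ge> 2" using small_primes(2) prime_ge_2_nat by fastforce
    then show "0 \<le> 1 / (real p * (real p - 1)) + 1 \<and> 1 / (real p * (real p - 1)) + 1 \<le> exp (1 / (real p * (real p - 1)))"
      using exp_ge_add_one_self[of "1 / (real p * (real p - 1))"] by (auto simp: add.commute)
  qed
  also have "\<dots> = exp (\<Sum>p\<in>?S. 1 / (real p * (real p - 1)))" by (rule exp_sum[OF small_primes(1), symmetric])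
  also have "\<dots> \<le> exp 1" using sum_small_primes_le_1 by simp
  finally show ?thesis .
qed

text \<open>The gcds are estimated through \<open>d1\<close>, \<open>d3\<close> and
  \<open>\<delta>\<close>, hence independently of \<open>d2\<close> and \<open>d4\<close>; this is
  what makes \<open>h_fun\<close> bounded in \<open>d2\<close> and \<open>d4\<close> for fixed
  \<open>m\<close>.\<close>

lemma abs_h_weight_le:
  assumes "\<delta> \<ge> 1" "d1 \<ge> 1" "d3 \<ge> 1"
  shows "\<bar>h_weight d2 d4 \<delta> d1 d3\<bar> \<le> real (d1 * d3 * \<delta> * \<delta>)"
proof -
  have g: "gcd d1 d2 \<le> d1" "gcd d3 d4 \<le> d3" "gcd \<delta> a \<le> \<delta>" for a
    using assms by (auto intro!: gcd_le1_nat)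
  have "0 \<le> (\<Prod>p\<in>A. inverse (1 + 1 / real p)) \<and> (\<Prod>p\<in>A. inverse (1 + 1 / real p)) \<le> 1" for A
    by (intro conjI prod_nonneg prod_le_1) (auto intro!: inverse_le_1_iff[THEN iffD2])
  then have "\<bar>real a * (\<Prod>p\<in>A. inverse (1 + 1 / real p))\<bar> \<le> real a" for a A
    by (simp add: abs_mult mult_left_le)
  moreover have "real (gcd d1 d2 * gcd d3 d4 * gcd \<delta> a * gcd \<delta> b) \<le> real (d1 * d3 * \<delta> * \<delta>)" for a b
    by (intro of_nat_mono mult_mono g) auto
  ultimately have "\<bar>real (gcd d1 d2 * gcd d3 d4 * gcd \<delta> a * gcd \<delta> b) * (\<Prod>p\<in>A. inverse (1 + 1 / real p))\<bar> \<le> real (d1 * d3 * \<delta> * \<delta>)" for a b A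
    using order_trans by blast
  then show ?thesis unfolding h_weight_def Let_def by (auto simp del: of_nat_mult)
qed

lemma h_fun_bounded: "\<exists>C\<ge>0. \<forall>d2 d4. \<bar>h_fun d2 d4 m\<bar> \<le> C"
proof (intro exI conjI allI)
  let ?C = "\<Sum>(n, \<delta>, d1, d3)\<in>factorizations4 m. real n * real (d1 * d3 * \<delta> * \<delta>)"
  show "0 \<le> ?C" by (intro sum_nonneg) auto
  fix d2 d4
  have "\<bar>h_fun d2 d4 m\<bar> \<le> (\<Sum>u\<in>factorizations4 m. \<bar>case u of (n, \<delta>, d1, d3) \<Rightarrow>
      real n * of_int (moebius d1) * of_int (moebius d3) * h_weight d2 d4 \<delta> d1 d3\<bar>)"
    unfolding h_fun_eq by (rule sum_abs)
  also have "\<dots> \<le> ?C"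
  proof (rule sum_mono)
    fix u assume u: "u \<in> factorizations4 m"
    obtain n \<delta> d1 d3 where [simp]: "u = (n, \<delta>, d1, d3)" by (metis prod.exhaust)
    have mu: "\<bar>real_of_int (moebius a)\<bar> \<le> 1" for a by (simp add: moebius_def power_abs)
    have "\<bar>h_weight d2 d4 \<delta> d1 d3\<bar> \<le> real (d1 * d3 * \<delta> * \<delta>)"
      using u by (intro abs_h_weight_le) (auto simp: factorizations4_def)
    then have "real n * \<bar>real_of_int (moebius d1)\<bar> * \<bar>real_of_int (moebius d3)\<bar> * \<bar>h_weight d2 d4 \<delta> d1 d3\<bar>
        \<le> real n * 1 * 1 * real (d1 * d3 * \<delta> * \<delta>)"
      using mu by (intro mult_mono) auto
    then show "\<bar>case u of (n, \<delta>, d1, d3) \<Rightarrow> real n * of_int (moebius d1) * of_int (moebius d3) * h_weight d2 d4 \<delta> d1 d3\<bar>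
        \<le> (case u of (n, \<delta>, d1, d3) \<Rightarrow> real n * real (d1 * d3 * \<delta> * \<delta>))"
      by (simp add: abs_mult)
  qed
  finally show "\<bar>h_fun d2 d4 m\<bar> \<le> ?C" .
qed

text \<open>The terms are dominated by a constant times the product of two copies of the convergent
  series of \<open>moebius_weight\<close>.\<close>

lemma summable_on_g2_coeff_h_fun:
  "(\<lambda>(d2, d4). g2_coeff d2 d4 * h_fun d2 d4 m) summable_on {1..} \<times> {1..}"
proof (rule abs_summable_summable, rule nonneg_bdd_above_summable_on)
  obtain C where C: "C \<ge> 0" "\<And>d2 d4. \<bar>h_fun d2 d4 m\<bar> \<le> C" using h_fun_bounded by blast
  show "bdd_above (sum (\<lambda>x. norm (case x of (d2, d4) \<Rightarrow> g2_coeff d2 d4 * h_fun d2 d4 m)) ` {F. F \<subseteq> {1..} \<times> {1..} \<and> finite F})"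
  proof (rule bdd_aboveI2)
    fix F :: "(nat \<times> nat) set" assume F: "F \<in> {F. F \<subseteq> {1..} \<times> {1..} \<and> finite F}"
    let ?w = moebius_weight
    have w0: "?w d \<ge> 0" for d by (simp add: moebius_weight_def)
    have sub: "F \<subseteq> fst ` F \<times> snd ` F" by force
    have "(\<Sum>x\<in>F. norm (case x of (d2, d4) \<Rightarrow> g2_coeff d2 d4 * h_fun d2 d4 m)) \<le> (\<Sum>(d2, d4)\<in>F. ?w d2 * ?w d4 * C)"
    proof (rule sum_mono)
      fix x assume "x \<in> F"
      obtain d2 d4 where [simp]: "x = (d2, d4)" by (cases x)
      have "\<bar>g2_coeff d2 d4\<bar> = ?w d2 * ?w d4"
        by (simp add: g2_coeff_def moebius_weight_def abs_mult)
      then show "norm (case x of (d2, d4) \<Rightarrow> g2_coeff d2 d4 * h_fun d2 d4 m) \<le> (case x of (d2, d4) \<Rightarrow> ?w d2 * ?w d4 * C)"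
        using C(2)[of d2 d4] w0 by (simp add: abs_mult mult_left_mono)
    qed
    also have "\<dots> \<le> (\<Sum>(d2, d4)\<in>fst ` F \<times> snd ` F. ?w d2 * ?w d4 * C)"
      using F sub C w0 by (intro sum_mono2) auto
    also have "\<dots> = (\<Sum>d2\<in>fst ` F. ?w d2) * (\<Sum>d4\<in>snd ` F. ?w d4) * C"
      unfolding sum_product unfolding sum.cartesian_product unfolding sum_distrib_right
      by (simp add: case_prod_unfold)
    also have "\<dots> \<le> exp 1 * exp 1 * C"
      using F C w0 by (intro mult_mono sum_moebius_weight_le mult_nonneg_nonneg sum_nonneg) auto
    finally show "(\<Sum>x\<in>F. norm (case x of (d2, d4) \<Rightarrow> g2_coeff d2 d4 * h_fun d2 d4 m)) \<le> exp 1 * exp 1 * C" .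
  qed
qed auto

text \<open>Both sides are limits of the finite identity. The terms of the double series vanish off
  squarefree \<open>d2\<close>, \<open>d4\<close>, and the squarefree numbers composed of primes up
  to \<open>z\<close> exhaust these; by unconditional summability the sum is the limit along this
  exhaustion.\<close>

lemma singular_sum_eq_infsum:
  assumes r: "r \<ge> 1"
  shows "singular_sum r = (\<Sum>\<^sub>\<infinity>(d2, d4)\<in>{1..} \<times> {1..}. g2_coeff d2 d4 * h_fun d2 d4 r) / zeta 2"
proof -
  let ?f = "\<lambda>(d2, d4). g2_coeff d2 d4 * h_fun d2 d4 r"
  let ?K = "infsum ?f ({1..} \<times> {1..})"
  define A where "A = {d::nat. squarefree d}"
  define D where "D z = (\<lambda>X. \<Prod>X) ` Pow (small_primes z)" for z
  have A_pos: "A \<subseteq> {1..}"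
  proof
    fix d assume "d \<in> A"
    then have "d \<noteq> 0" unfolding A_def by (metis mem_Collect_eq not_squarefree_0)
    then show "d \<in> {1..}" by auto
  qed
  have "(?f has_sum ?K) ({1..} \<times> {1..})"
    by (rule has_sum_infsum[OF summable_on_g2_coeff_h_fun])
  then have hs: "(?f has_sum ?K) (A \<times> A)"
  proof (rule has_sum_cong_neutral[THEN iffD1, rotated -1])
    fix x assume x: "x \<in> A \<times> A - {1..} \<times> {1..}"
    then show "?f x = 0" using A_pos by auto
  next
    fix x assume "x \<in> {1..} \<times> {1..} - A \<times> A"
    then show "?f x = 0" by (auto simp: A_def g2_coeff_def moebius_def split: if_splits)
  qed auto
  have D_sub: "D z \<subseteq> A" for z
    unfolding D_def A_def using small_primes by (auto intro!: squarefree_prod_primes intro: finite_subset)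
  have finD: "finite (D z)" for z unfolding D_def using small_primes(1) by simp
  have "filterlim (\<lambda>z. D z \<times> D z) (finite_subsets_at_top (A \<times> A)) sequentially"
    unfolding filterlim_finite_subsets_at_top
  proof (intro allI impI)
    fix X :: "(nat \<times> nat) set" assume X: "finite X \<and> X \<subseteq> A \<times> A"
    show "\<forall>\<^sub>F z in sequentially. finite (D z \<times> D z) \<and> X \<subseteq> D z \<times> D z \<and> D z \<times> D z \<subseteq> A \<times> A"
      using eventually_ge_at_top[of "\<Sum>x\<in>X. fst x + snd x"]
    proof eventually_elim
      case (elim z)
      have "X \<subseteq> D z \<times> D z"
      proof
        fix x assume x: "x \<in> X"
        then have "fst x + snd x \<le> (\<Sum>x\<in>X. fst x + snd x)" using X by (intro member_le_sum) auto
        then have "fst x \<le> z" "snd x \<le> z" using elim by auto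
        moreover have "fst x \<in> A" "snd x \<in> A" using x X by auto
        ultimately have "fst x \<in> D z" "snd x \<in> D z"
          unfolding D_def A_def by (auto intro: squarefree_in_Prod_small_primes simp del: image_iff)
        then show "x \<in> D z \<times> D z" by (cases x) auto
      qed
      then show ?case using D_sub finD by auto
    qed
  qed
  with hs have lim: "(\<lambda>z. \<Sum>x\<in>D z \<times> D z. ?f x) \<longlonglongrightarrow> ?K"
    unfolding has_sum_def by (rule filterlim_compose)
  have sumD: "(\<Sum>x\<in>D z \<times> D z. ?f x)
      = (\<Sum>X\<in>Pow (small_primes z). \<Sum>Y\<in>Pow (small_primes z). g2_coeff (\<Prod>X) (\<Prod>Y) * h_fun (\<Prod>X) (\<Prod>Y) r)" for z
    unfolding sum.cartesian_product[symmetric] D_def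
    by (simp only: sum.reindex[OF inj_on_Prod_small_primes] o_def)
  have "(\<lambda>z. (\<Prod>p\<in>small_primes z. 1 - 1 / (real p)\<^sup>2) * (\<Sum>x\<in>D z \<times> D z. ?f x)) \<longlonglongrightarrow> 1 / zeta 2 * ?K"
    by (intro tendsto_mult euler_product_zeta_2 lim)
  moreover have "\<forall>\<^sub>F z in sequentially. (\<Prod>p\<in>small_primes z. 1 - 1 / (real p)\<^sup>2) * (\<Sum>x\<in>D z \<times> D z. ?f x)
     = (\<Sum>k | 0 \<le> k \<and> k < int r \<and> coprime k (int r).
            \<Prod>p\<in>small_primes z. 1 - residue_count {(0, 0), (1, 0), (k, - int r)} p / (real p)\<^sup>2)"
    \<comment> \<open>For \<open>z \<ge> r\<close> all primes of \<open>r\<close> are among the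
      primes up to \<open>z\<close>, as the finite identity requires.\<close>
    using eventually_ge_at_top[of r]
  proof eventually_elim
    case (elim z)
    have "prime_factors r \<subseteq> small_primes z"
    proof
      fix p assume "p \<in> prime_factors r"
      then have "prime p" "p dvd r" by auto
      moreover from this have "p \<le> r" using r by (intro dvd_imp_le) auto
      ultimately show "p \<in> small_primes z" using elim by (simp add: small_primes_def)
    qed
    from truncated_singular_series_identity[OF r small_primes(1) small_primes(2) this]
    show ?case unfolding sumD by simp
  qed
  ultimately have "(\<lambda>z. \<Sum>k | 0 \<le> k \<and> k < int r \<and> coprime k (int r).
            \<Prod>p\<in>small_primes z. 1 - residue_count {(0, 0), (1, 0), (k, - int r)} p / (real p)\<^sup>2) \<longlonglongrightarrow> 1 / zeta 2 * ?K"
    by (rule Lim_transform_eventually)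
  moreover have "(\<lambda>z. \<Sum>k | 0 \<le> k \<and> k < int r \<and> coprime k (int r).
            \<Prod>p\<in>small_primes z. 1 - residue_count {(0, 0), (1, 0), (k, - int r)} p / (real p)\<^sup>2) \<longlonglongrightarrow> singular_sum r"
    unfolding singular_sum_def by (intro tendsto_sum LIMSEQ_singular_product)
  ultimately have "1 / zeta 2 * ?K = singular_sum r" by (rule LIMSEQ_unique)
  then show ?thesis by simp
qed

section \<open>The pair correlation limit\<close>

text \<open>The antiderivative \<open>- ln (t / c) / t - 1 / t\<close> takes the value
  \<open>- 1 / c\<close> at \<open>c\<close>; with \<open>u = c / \<Lambda> < 1\<close> its
  increment up to \<open>\<Lambda>\<close> is \<open>(1 - u + u ln u) / c\<close>.\<close>

lemma has_integral_log_kernel: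
  fixes c \<Lambda> :: real
  assumes c: "c > 0" and \<Lambda>: "\<Lambda> > 0"
  shows "((\<lambda>t. if c < t then ln (t / c) / t\<^sup>2 else 0) has_integral hyperbola_area (c / \<Lambda>) / c) {0..\<Lambda>}"
proof (cases "c < \<Lambda>")
  case False
  then have "hyperbola_area (c / \<Lambda>) = 0" using \<Lambda> by (simp add: hyperbola_area_def divide_less_eq)
  moreover have "((\<lambda>t. if c < t then ln (t / c) / t\<^sup>2 else 0) has_integral 0) {0..\<Lambda>}"
    using False by (intro has_integral_is_0) auto
  ultimately show ?thesis by simp
next
  case True
  let ?F = "\<lambda>t. - ln (t / c) / t - 1 / t"
  have "((\<lambda>t. ln (t / c) / t\<^sup>2) has_integral ?F \<Lambda> - ?F c) {c..\<Lambda>}"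
  proof (rule fundamental_theorem_of_calculus)
    show "c \<le> \<Lambda>" using True by simp
    fix t assume "t \<in> {c..\<Lambda>}"
    then have t: "t > 0" using c by auto
    have "(?F has_real_derivative - ((1 / c) / (t / c) * t - ln (t / c) * 1) / (t * t) - (0 * t - 1 * 1) / (t * t)) (at t within {c..\<Lambda>})"
      using t c by (auto intro!: derivative_eq_intros simp: field_simps)
    moreover have "- ((1 / c) / (t / c) * t - ln (t / c) * 1) / (t * t) - (0 * t - 1 * 1) / (t * t) = ln (t / c) / t\<^sup>2"
      using t c by (simp add: diff_divide_distrib power2_eq_square)
    ultimately show "(?F has_vector_derivative ln (t / c) / t\<^sup>2) (at t within {c..\<Lambda>})"
      by (simp only: has_real_derivative_iff_has_vector_derivative)
  qed
  moreover have "?F \<Lambda> - ?F c = hyperbola_area (c / \<Lambda>) / c"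
    using c \<Lambda> True by (simp add: hyperbola_area_def divide_less_eq ln_div field_simps)
  ultimately have "((\<lambda>t. ln (t / c) / t\<^sup>2) has_integral hyperbola_area (c / \<Lambda>) / c) {c..\<Lambda>}" by (simp only:)
  then have 2: "((\<lambda>t. if c < t then ln (t / c) / t\<^sup>2 else 0) has_integral hyperbola_area (c / \<Lambda>) / c) {c..\<Lambda>}"
    using c by (elim has_integral_eq[rotated]) auto
  have 1: "((\<lambda>t. if c < t then ln (t / c) / t\<^sup>2 else 0) has_integral 0) {0..c}"
    by (intro has_integral_is_0) auto
  show ?thesis using has_integral_combine[OF _ _ 1 2] c True by simp
qed

lemma has_sum_finite_sum:
  fixes f :: "'i \<Rightarrow> 'a \<Rightarrow> real"
  assumes "finite I" "\<And>i. i \<in> I \<Longrightarrow> (f i has_sum s i) A"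
  shows "((\<lambda>x. \<Sum>i\<in>I. f i x) has_sum (\<Sum>i\<in>I. s i)) A"
  using assms by (induction I rule: finite_induct) (auto intro!: has_sum_add)

text \<open>For fixed \<open>t\<close> only finitely many \<open>m\<close> occur, so the sum over
  \<open>m\<close> can be taken out of the double series; each inner series is then
  \<open>zeta 2 * singular_sum m\<close>, and \<open>zeta 2\<close> cancels.\<close>

lemma g2_as_finite_sum:
  fixes P :: "int poly" and t :: real
  defines "M \<equiv> {m. 1 \<le> m \<and> real m < 2 * t / beta P}"
  shows "(\<lambda>(d2, d4). g2_term P t d2 d4) summable_on {1..} \<times> {1..}"
    and "g2 P t = (\<Sum>m\<in>M. singular_sum m * ln (2 * t / (real m * beta P))) / t\<^sup>2"
proof -
  let ?A = "{1..} \<times> {1..} :: (nat \<times> nat) set"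
  let ?l = "\<lambda>m. ln (2 * t / (real m * beta P))"
  let ?K = "\<lambda>m. infsum (\<lambda>(d2, d4). g2_coeff d2 d4 * h_fun d2 d4 m) ?A"
  have finM: "finite M"
    by (rule finite_subset[of _ "{..nat \<lceil>2 * t / beta P\<rceil>}"]) (auto simp: M_def, linarith)
  have term_eq: "(\<lambda>(d2, d4). g2_term P t d2 d4) = (\<lambda>x. \<Sum>m\<in>M. ?l m * (case x of (d2, d4) \<Rightarrow> g2_coeff d2 d4 * h_fun d2 d4 m))"
  proof (rule ext, clarify)
    fix d2 d4
    have "g2_term P t d2 d4 = g2_coeff d2 d4 * (\<Sum>m\<in>M. h_fun d2 d4 m * ?l m)"
      unfolding g2_term_def g2_coeff_def M_def ..
    then show "g2_term P t d2 d4 = (\<Sum>m\<in>M. ?l m * (g2_coeff d2 d4 * h_fun d2 d4 m))"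
      by (simp only: sum_distrib_left mult_ac)
  qed
  have hs: "((\<lambda>(d2, d4). g2_term P t d2 d4) has_sum (\<Sum>m\<in>M. ?l m * ?K m)) ?A"
    unfolding term_eq
    by (intro has_sum_finite_sum finM has_sum_cmult_right has_sum_infsum summable_on_g2_coeff_h_fun)
  then show "(\<lambda>(d2, d4). g2_term P t d2 d4) summable_on ?A"
    by (auto simp: summable_on_def)
  from hs have inf: "infsum (\<lambda>(d2, d4). g2_term P t d2 d4) ?A = (\<Sum>m\<in>M. ?l m * ?K m)"
    by (rule infsumI)
  have "(\<Sum>m\<in>M. ?l m * ?K m) = zeta 2 * (\<Sum>m\<in>M. singular_sum m * ?l m)"
    unfolding sum_distrib_left
    using euler_product_zeta_2(1) by (intro sum.cong refl) (simp add: M_def singular_sum_eq_infsum)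
  then show "g2 P t = (\<Sum>m\<in>M. singular_sum m * ?l m) / t\<^sup>2"
    unfolding g2_def inf using euler_product_zeta_2(1) by simp
qed

text \<open>The range of \<open>m\<close> in \<open>g2\<close> moves with \<open>t\<close>. Putting
  the cutoff \<open>m * beta P / 2 < t\<close> into the integrand replaces it by the range
  \<open>{1..R}\<close>, which serves all \<open>t \<le> \<Lambda>\<close> at once.\<close>

lemma g2_has_integral:
  fixes P :: "int poly"
  assumes \<beta>: "beta P > 0" and \<Lambda>: "\<Lambda> > 0" and R: "real R > 2 * \<Lambda> / beta P"
  shows "(g2 P has_integral (\<Sum>m\<in>{1..R}. singular_sum m * (hyperbola_area (real m * beta P / (2 * \<Lambda>)) / (real m * beta P / 2)))) {0..\<Lambda>}"
proof -
  let ?c = "\<lambda>m. real m * beta P / 2"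
  let ?\<phi> = "\<lambda>m t. if ?c m < t then ln (t / ?c m) / t\<^sup>2 else 0"
  have "((\<lambda>t. \<Sum>m\<in>{1..R}. singular_sum m * ?\<phi> m t) has_integral
      (\<Sum>m\<in>{1..R}. singular_sum m * (hyperbola_area (?c m / \<Lambda>) / ?c m))) {0..\<Lambda>}"
    using \<beta> \<Lambda> by (intro has_integral_sum has_integral_mult_right has_integral_log_kernel) auto
  moreover have "(\<Sum>m\<in>{1..R}. singular_sum m * ?\<phi> m t) = g2 P t" if t: "t \<in> {0..\<Lambda>}" for t
  proof -
    let ?M = "{m. 1 \<le> m \<and> real m < 2 * t / beta P}"
    have iff: "real m < 2 * t / beta P \<longleftrightarrow> ?c m < t" for m
      using \<beta> by (simp add: less_divide_eq mult.commute)
    have "?M \<subseteq> {1..R}"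
    proof
      fix m assume m: "m \<in> ?M"
      have "2 * t / beta P \<le> 2 * \<Lambda> / beta P" using t \<beta> by (intro divide_right_mono) auto
      then have "real m \<le> real R" using m R by auto
      then show "m \<in> {1..R}" using m by auto
    qed
    then have "(\<Sum>m\<in>{1..R}. singular_sum m * ?\<phi> m t) = (\<Sum>m\<in>?M. singular_sum m * (ln (2 * t / (real m * beta P)) / t\<^sup>2))"
    proof (intro sum.mono_neutral_cong_right)
      show "\<forall>i\<in>{1..R} - ?M. singular_sum i * ?\<phi> i t = 0" using iff by auto
      show "singular_sum m * ?\<phi> m t = singular_sum m * (ln (2 * t / (real m * beta P)) / t\<^sup>2)" if "m \<in> ?M" for m
      proof -
        have "?c m < t" using that iff[of m] by blast
        then have "?\<phi> m t = ln (t / ?c m) / t\<^sup>2" by (simp only: if_True)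
        moreover have "t / ?c m = 2 * t / (real m * beta P)" by simp
        ultimately show ?thesis by (simp only:)
      qed
    qed auto
    also have "\<dots> = g2 P t" unfolding g2_as_finite_sum(2) sum_divide_distrib by simp
    finally show ?thesis .
  qed
  ultimately have "(g2 P has_integral (\<Sum>m\<in>{1..R}. singular_sum m * (hyperbola_area (?c m / \<Lambda>) / ?c m))) {0..\<Lambda>}"
    by (rule has_integral_eq[rotated])
  then show ?thesis by (simp add: mult.commute)
qed

lemma card_int_farey_limit:
  "(\<lambda>Q. real (card (int_farey Q)) / (real Q)\<^sup>2) \<longlonglongrightarrow> beta ([:0, 1:] * [:1, 1:]) / 2"
proof -
  have "(\<Prod>p | prime p \<and> p \<le> z. 1 - residue_count {(0, 0), (- 1, 0)} p / (real p)\<^sup>2)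
      = (\<Prod>p\<in>small_primes z. 1 - 2 / (real p)\<^sup>2)" for z
    by (intro prod.cong) (auto simp: small_primes_def residue_count_pair)
  then have "(\<lambda>z. \<Prod>p | prime p \<and> p \<le> z. 1 - residue_count {(0, 0), (- 1, 0)} p / (real p)\<^sup>2)
      \<longlonglongrightarrow> beta ([:0, 1:] * [:1, 1:])"
    using beta_x_x1(1) by (simp only:)
  from card_triangle_coprime_limit[OF this] show ?thesis by (simp add: card_int_farey)
qed

text \<open>For large \<open>Q\<close> every determinant is at most \<open>R\<close>, so the count
  is a sum over a fixed finite set of \<open>r\<close> and \<open>k\<close>, and limits are taken
  termwise. The threshold \<open>T = r N / \<Lambda>\<close> divided by \<open>Q^2\<close> tends to
  \<open>r \<beta> / (2 \<Lambda>)\<close>; terms for which this is at least 1 have area 0.\<close>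

lemma card_close_pairs_limit:
  fixes \<Lambda> :: real
  defines "\<beta> \<equiv> beta ([:0, 1:] * [:1, 1:])"
  assumes \<Lambda>: "\<Lambda> > 0" and R: "real R > 2 * \<Lambda> / \<beta>"
  shows "(\<lambda>Q. real (card (close_pairs (int_farey Q) \<Lambda>)) / (real Q)\<^sup>2)
    \<longlonglongrightarrow> (\<Sum>r\<in>{1..R}. hyperbola_area (real r * \<beta> / (2 * \<Lambda>)) / real r * singular_sum r)"
proof -
  have \<beta>: "\<beta> > 0" unfolding \<beta>_def by (rule beta_x_x1)
  define N where "N Q = real (card (int_farey Q))" for Q
  have N: "(\<lambda>Q. N Q / (real Q)\<^sup>2) \<longlonglongrightarrow> \<beta> / 2" unfolding N_def \<beta>_def by (rule card_int_farey_limit)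
  define T where "T r Q = real r * N Q / \<Lambda>" for r Q
  define K where "K r = {k. 0 \<le> k \<and> k < int r \<and> coprime k (int r)}" for r
  have finK: "finite (K r)" for r by (rule finite_subset[of _ "{0..<int r}"]) (auto simp: K_def)
  define V where "V Q r k = {(x, y). 1 \<le> y \<and> y \<le> int Q \<and> int r * x + k * y \<le> int Q \<and>
            T r Q < real_of_int ((int r * x + k * y) * y) \<and>
            coprime x y \<and> coprime (x - 1) y \<and> coprime (x - k) (y + int r)}" for Q r k
  have "(\<lambda>Q. real (card (V Q r k)) / (real Q)\<^sup>2) \<longlonglongrightarrow>
      hyperbola_area (real r * \<beta> / (2 * \<Lambda>)) / real_of_int (int r) * singular_product (int r) k"
    if r: "r \<in> {1..R}" and k: "k \<in> K r" for r k
    unfolding V_def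
  proof (rule card_hyperbola_coprime_limit)
    have "(\<lambda>Q. real r / \<Lambda> * (N Q / (real Q)\<^sup>2)) \<longlonglongrightarrow> real r / \<Lambda> * (\<beta> / 2)"
      by (intro tendsto_intros N)
    then show "(\<lambda>Q. T r Q / (real Q)\<^sup>2) \<longlonglongrightarrow> real r * \<beta> / (2 * \<Lambda>)"
      by (simp add: T_def mult.commute)
    show "real r * \<beta> / (2 * \<Lambda>) > 0" using r \<beta> \<Lambda> by simp
    show "T r Q \<ge> 0" for Q using \<Lambda> by (simp add: T_def N_def)
    show "(\<lambda>z. \<Prod>p | prime p \<and> p \<le> z. 1 - residue_count {(0, 0), (1, 0), (k, - int r)} p / (real p)\<^sup>2)
       \<longlonglongrightarrow> singular_product (int r) k"
      using LIMSEQ_singular_product by (simp only: small_primes_def)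
  qed (use r k in \<open>auto simp: K_def\<close>)
  then have "(\<lambda>Q. \<Sum>r\<in>{1..R}. \<Sum>k\<in>K r. real (card (V Q r k)) / (real Q)\<^sup>2) \<longlonglongrightarrow>
     (\<Sum>r\<in>{1..R}. \<Sum>k\<in>K r. hyperbola_area (real r * \<beta> / (2 * \<Lambda>)) / real_of_int (int r) * singular_product (int r) k)"
    by (intro tendsto_sum) auto
  also have "(\<Sum>r\<in>{1..R}. \<Sum>k\<in>K r. hyperbola_area (real r * \<beta> / (2 * \<Lambda>)) / real_of_int (int r) * singular_product (int r) k)
     = (\<Sum>r\<in>{1..R}. hyperbola_area (real r * \<beta> / (2 * \<Lambda>)) / real r * singular_sum r)"
    unfolding singular_sum_def K_def by (simp add: sum_distrib_left)
  finally have lim: "(\<lambda>Q. \<Sum>r\<in>{1..R}. \<Sum>k\<in>K r. real (card (V Q r k)) / (real Q)\<^sup>2) \<longlonglongrightarrow>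
     (\<Sum>r\<in>{1..R}. hyperbola_area (real r * \<beta> / (2 * \<Lambda>)) / real r * singular_sum r)" .
  have "\<Lambda> / real R < \<beta> / 2"
  proof -
    have "2 * \<Lambda> / \<beta> > 0" using \<Lambda> \<beta> by simp
    then have "real R > 0" using R by linarith
    then show ?thesis using R \<beta> by (simp add: field_simps)
  qed
  then have ev1: "\<forall>\<^sub>F Q in sequentially. \<Lambda> / real R < N Q / (real Q)\<^sup>2"
    by (rule order_tendstoD(1)[OF N])
  have ev2: "\<forall>\<^sub>F Q in sequentially. \<Lambda> \<le> N Q"
  proof -
    have "filterlim (\<lambda>Q. N Q / (real Q)\<^sup>2 * (real Q)\<^sup>2) at_top sequentially"
      using \<beta> by (intro filterlim_tendsto_pos_mult_at_top[OF N] filterlim_pow_at_top filterlim_real_sequentially) auto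
    then have "\<forall>\<^sub>F Q in sequentially. \<Lambda> \<le> N Q / (real Q)\<^sup>2 * (real Q)\<^sup>2" by (simp add: filterlim_at_top)
    then show ?thesis using eventually_ge_at_top[of 1] by eventually_elim auto
  qed
  have "\<forall>\<^sub>F Q in sequentially. (\<Sum>r\<in>{1..R}. \<Sum>k\<in>K r. real (card (V Q r k)) / (real Q)\<^sup>2)
      = real (card (close_pairs (int_farey Q) \<Lambda>)) / (real Q)\<^sup>2"
    using ev1 ev2 eventually_ge_at_top[of 1]
  proof eventually_elim
    case (elim Q)
    have Q: "(real Q)\<^sup>2 > 0" using elim by simp
    have Npos: "N Q > 0" using elim \<Lambda> by linarith
    let ?L = "lattice_tuples (N Q) \<Lambda> Q"
    have finL: "finite ?L" and cardL: "card (close_pairs (int_farey Q) \<Lambda>) = card ?L"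
      using card_close_pairs[OF \<Lambda>, of Q] elim unfolding N_def by auto
    let ?\<psi> = "\<lambda>(r, k, x, y). (nat r, k, x, y)"
    have T_iff: "T r Q < z \<longleftrightarrow> real r * N Q < \<Lambda> * z" for r z
      unfolding T_def using \<Lambda> by (simp add: divide_less_eq mult.commute)
    have inj: "inj_on ?\<psi> ?L" by (auto simp: inj_on_def lattice_tuples_def)
    \<comment> \<open>On the one hand \<open>r N < \<Lambda> q y \<le> \<Lambda> Q^2\<close>; on the
      other hand \<open>N > \<Lambda> Q^2 / R\<close> for large \<open>Q\<close>, by the choice of
      \<open>R\<close>.\<close>
    have bound: "r \<le> int R" if "(r, k, x, y) \<in> ?L" for r k x y
    proof -
      have t: "1 \<le> r" "1 \<le> y" "y \<le> int Q" "r * x + k * y \<le> int Q" "r * N Q < \<Lambda> * real_of_int ((r * x + k * y) * y)"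
        using that by (auto simp: lattice_tuples_def)
      have "(r * x + k * y) * y \<le> int Q * int Q"
        using t by (intro mult_mono) auto
      then have "real_of_int ((r * x + k * y) * y) \<le> real_of_int (int Q * int Q)" by (simp only: of_int_le_iff)
      then have "\<Lambda> * real_of_int ((r * x + k * y) * y) \<le> \<Lambda> * (real Q)\<^sup>2"
        using \<Lambda> by (intro mult_left_mono) (auto simp: power2_eq_square)
      with t have "r * N Q < \<Lambda> * (real Q)\<^sup>2" by linarith
      also have "\<dots> \<le> R * N Q"
      proof -
        have "0 < real R"
        proof -
          have "2 * \<Lambda> / \<beta> > 0" using \<Lambda> \<beta> by simp
          then show ?thesis using R by linarith
        qed
        then show ?thesis using elim(1) Q by (simp add: field_simps)
      qed
      finally have "real_of_int r < real R" using Npos by simp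
      then show ?thesis by linarith
    qed
    have img: "?\<psi> ` ?L = (SIGMA r:{1..R}. SIGMA k:K r. V Q r k)"
    proof (intro equalityI subsetI)
      fix v assume "v \<in> ?\<psi> ` ?L"
      then obtain r k x y where v: "v = (nat r, k, x, y)" and L: "(r, k, x, y) \<in> ?L" by auto
      have r: "r \<ge> 1" "int (nat r) = r" "real (nat r) = real_of_int r" using L by (auto simp: lattice_tuples_def)
      have "nat r \<in> {1..R}" using r bound[OF L] by auto
      moreover have "k \<in> K (nat r)" using L r by (auto simp: K_def lattice_tuples_def)
      moreover have "(x, y) \<in> V Q (nat r) k" unfolding V_def T_iff using L r by (auto simp: lattice_tuples_def)
      ultimately show "v \<in> (SIGMA r:{1..R}. SIGMA k:K r. V Q r k)" unfolding v by auto
    next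
      fix v assume "v \<in> (SIGMA r:{1..R}. SIGMA k:K r. V Q r k)"
      then obtain r k x y where v: "v = (r, k, x, y)" "r \<in> {1..R}" "k \<in> K r" "(x, y) \<in> V Q r k" by auto
      then have "(int r, k, x, y) \<in> ?L" unfolding V_def T_iff K_def lattice_tuples_def by auto
      moreover have "v = ?\<psi> (int r, k, x, y)" using v by simp
      ultimately show "v \<in> ?\<psi> ` ?L" by (metis (no_types, lifting) imageI)
    qed
    have finV: "finite (V Q r k)" if "r \<in> {1..R}" "k \<in> K r" for r k
    proof (rule finite_subset)
      show "V Q r k \<subseteq> (\<lambda>(r, k, x, y). (x, y)) ` (?\<psi> ` ?L)" unfolding img using that by force
    qed (use finL in simp)
    have "card ?L = card (SIGMA r:{1..R}. SIGMA k:K r. V Q r k)"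
      using card_image[OF inj] by (simp only: img)
    also have "\<dots> = (\<Sum>r\<in>{1..R}. \<Sum>k\<in>K r. card (V Q r k))"
      using finK finV by (simp add: card_SigmaI)
    finally have "real (card ?L) = (\<Sum>r\<in>{1..R}. \<Sum>k\<in>K r. real (card (V Q r k)))" by simp
    then show ?case unfolding cardL by (simp only: sum_divide_distrib)
  qed
  with lim show ?thesis by (rule Lim_transform_eventually)
qed

theorem theorem1p4:
  fixes P :: "int poly"
  assumes "P = [:0, 1:] * [:1, 1:]"
  shows "(\<forall>t>0. (\<lambda>(d2, d4). g2_term P t d2 d4) summable_on {1..} \<times> {1..}) \<and>
         (\<forall>\<Lambda>>0. g2 P integrable_on {0..\<Lambda>} \<and>
           (\<lambda>Q. pair_correlation (poly_farey P Q) \<Lambda>) \<longlonglongrightarrow> integral {0..\<Lambda>} (g2 P))"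
proof (intro conjI allI impI)
  fix t :: real
  show "(\<lambda>(d2, d4). g2_term P t d2 d4) summable_on {1..} \<times> {1..}" by (rule g2_as_finite_sum)
next
  fix \<Lambda> :: real assume \<Lambda>: "\<Lambda> > 0"
  define \<beta> where "\<beta> = beta P"
  have \<beta>: "\<beta> > 0" unfolding \<beta>_def assms by (rule beta_x_x1)
  \<comment> \<open>Any \<open>R\<close> beyond the contributing determinants will do; it lets the
    limit and the integral be written as sums over the same range.\<close>
  obtain R :: nat where R: "real R > 2 * \<Lambda> / \<beta>" using reals_Archimedean2 by blast
  let ?I = "\<Sum>m\<in>{1..R}. singular_sum m * (hyperbola_area (real m * \<beta> / (2 * \<Lambda>)) / (real m * \<beta> / 2))"
  have I: "(g2 P has_integral ?I) {0..\<Lambda>}"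
    using g2_has_integral[of P \<Lambda> R] \<beta> \<Lambda> R unfolding \<beta>_def by blast
  then show "g2 P integrable_on {0..\<Lambda>}" by blast
  let ?c = "\<lambda>Q. real (card (close_pairs (int_farey Q) \<Lambda>))" and ?N = "\<lambda>Q. real (card (int_farey Q))"
  have c_lim: "(\<lambda>Q. ?c Q / (real Q)\<^sup>2) \<longlonglongrightarrow> (\<Sum>r\<in>{1..R}. hyperbola_area (real r * \<beta> / (2 * \<Lambda>)) / real r * singular_sum r)"
    using R unfolding \<beta>_def assms by (rule card_close_pairs_limit[OF \<Lambda>])
  have N_lim: "(\<lambda>Q. ?N Q / (real Q)\<^sup>2) \<longlonglongrightarrow> \<beta> / 2"
    unfolding \<beta>_def assms by (rule card_int_farey_limit)
  have "(\<lambda>Q. (?c Q / (real Q)\<^sup>2) / (?N Q / (real Q)\<^sup>2))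
     \<longlonglongrightarrow> (\<Sum>r\<in>{1..R}. hyperbola_area (real r * \<beta> / (2 * \<Lambda>)) / real r * singular_sum r) / (\<beta> / 2)"
    using \<beta> by (intro tendsto_divide[OF c_lim N_lim]) simp
  also have "(\<Sum>r\<in>{1..R}. hyperbola_area (real r * \<beta> / (2 * \<Lambda>)) / real r * singular_sum r) / (\<beta> / 2) = ?I"
    unfolding sum_divide_distrib by (intro sum.cong refl) (simp add: mult_ac)
  also have "?I = integral {0..\<Lambda>} (g2 P)" using I by (simp add: integral_unique)
  finally have "(\<lambda>Q. (?c Q / (real Q)\<^sup>2) / (?N Q / (real Q)\<^sup>2)) \<longlonglongrightarrow> integral {0..\<Lambda>} (g2 P)" .
  moreover have "\<forall>\<^sub>F Q in sequentially. (?c Q / (real Q)\<^sup>2) / (?N Q / (real Q)\<^sup>2) = pair_correlation (poly_farey P Q) \<Lambda>"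
    using eventually_ge_at_top[of 1]
  proof eventually_elim
    case (elim Q)
    have "pair_correlation (poly_farey P Q) \<Lambda> = 1 / ?N Q * ?c Q"
      unfolding pair_correlation_def close_pairs_def assms poly_farey_eq_int_farey ..
    then show ?case using elim by simp
  qed
  ultimately show "(\<lambda>Q. pair_correlation (poly_farey P Q) \<Lambda>) \<longlonglongrightarrow> integral {0..\<Lambda>} (g2 P)"
    by (rule Lim_transform_eventually)
qed

end
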